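(* Let $N$ and $\Pi$ be the integer and prime counting functions of a Beurling generalized number system, and suppose the zeta function $\zeta(s)=\int_{1^-}^\infty x^{-s}\,dN(x)=\exp\left(\int_1^\infty x^{-s}\,d\Pi(x)\right)$ converges for $\operatorname{Re}s>1$. Suppose there are a discrete set of points $0<\eta<t_1<t_2<\dots$ and constants $\beta_1,\beta_2,\dots>-1$ such that (a) $\log\zeta(s)-\log(1/(s-1))$ has $A_{loc}$-boundary behavior on $1+i(-\eta,\eta)$; (b) for each $T>0$ there is a constant $K_T>0$ such that $$\log|\zeta(\sigma+it)|\le K_T+\sum_{0<t_n<T}\beta_n\log|\sigma-1+i(t-t_n)|$$ for every $\eta/2<t<T$ and $1<\sigma<2$. Then $N$ has a positive asymptotic density, i.e. there is $a>0$ with $N(x)\sim ax$ as $x\to\infty$.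
   Context: A Beurling generalized prime system is a non-decreasing unbounded sequence of reals $1<p_1\le p_2\le\dots$; the generalized integers are the multiplicative semigroup generated by the $p_k$ and $1$, listed with multiplicity as $1=n_0<n_1\le n_2\le\dots$. $N(x)=\sum_{n_k\le x}1$, $\pi(x)=\sum_{p_k\le x}1$, $\Pi(x)=\sum_{j\ge1}\frac1j\pi(x^{1/j})$. Here $\log\zeta(s)$ denotes $\int_1^\infty x^{-s}\,d\Pi(x)$ and $\log(1/(s-1))$ is the principal branch on $\operatorname{Re}s>1$. Boundary behavior: an analytic $G$ on $\operatorname{Re}s>1$ has $A_{loc}$-boundary behavior on $1+iU$ ($U\subseteq\mathbb{R}$ open) if there is $g\in A_{loc}(U)$ with $\lim_{\sigma\to1^+}\int G(\sigma+it)\varphi(t)\,dt=\int g(t)\varphi(t)\,dt$ for all $\varphi\in\mathcal{D}(U)$, where $A_{loc}(U)$ is the space of continuous functions on $U$ that near each point coincide with the Fourier transform of an $L^1(\mathbb{R})$ function. *)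

theory Defs
  imports
    "HOL-Analysis.Analysis"
    "HOL-Probability.Distribution_Functions"
    "HOL-Library.Landau_Symbols"
    "HOL-Library.Multiset"
begin

definition beurling_primes :: "(nat \<Rightarrow> real) \<Rightarrow> bool" where
  "beurling_primes p \<longleftrightarrow> 1 < p 0 \<and> mono p \<and> \<not> bdd_above (range p)"

text \<open>
  Generalized integers are counted with multiplicity: they are indexed by the finite multisets
  \<open>M\<close> of prime indices, \<open>M\<close> representing the product of the \<open>p k\<close>, \<open>k \<in># M\<close>, and the empty
  multiset representing \<open>1\<close>.
\<close>

definition integer_count :: "(nat \<Rightarrow> real) \<Rightarrow> real \<Rightarrow> real" where
  "integer_count p x = real (card {M :: nat multiset. (\<Prod>k\<in>#M. p k) \<le> x})"

definition prime_count :: "(nat \<Rightarrow> real) \<Rightarrow> real \<Rightarrow> real" where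
  "prime_count p x = real (card {k. p k \<le> x})"

text \<open>
  The summation index is shifted, \<open>j\<close> standing for \<open>j + 1\<close>. For a system of Beurling primes only
  finitely many terms are nonzero. Using \<^const>\<open>root\<close>, which is monotone on the whole real line,
  makes the function vanish for \<open>x \<le> 1\<close>, negative \<open>x\<close> included.
\<close>

definition riemann_prime_count :: "(nat \<Rightarrow> real) \<Rightarrow> real \<Rightarrow> real" where
  "riemann_prime_count p x = (\<Sum>j. prime_count p (root (Suc j) x) / real (Suc j))"

text \<open>
  Both counting functions are nondecreasing and right-continuous, so that \<^const>\<open>interval_measure\<close>
  yields their Lebesgue--Stieltjes measures. The lower limit \<open>1\<^sup>-\<close> means that the mass of \<open>dN\<close>
  at \<open>1\<close> is included.
\<close>

definition beurling_zeta_converges :: "(nat \<Rightarrow> real) \<Rightarrow> complex \<Rightarrow> bool" where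
  "beurling_zeta_converges p s \<longleftrightarrow>
     set_integrable (interval_measure (integer_count p)) {1..} (\<lambda>x. complex_of_real x powr (- s))"

definition beurling_zeta :: "(nat \<Rightarrow> real) \<Rightarrow> complex \<Rightarrow> complex" where
  "beurling_zeta p s =
     (LINT x:{1..}|interval_measure (integer_count p). complex_of_real x powr (- s))"

definition log_beurling_zeta :: "(nat \<Rightarrow> real) \<Rightarrow> complex \<Rightarrow> complex" where
  "log_beurling_zeta p s =
     (LINT x:{1<..}|interval_measure (riemann_prime_count p). complex_of_real x powr (- s))"

definition fourier_transform :: "(real \<Rightarrow> complex) \<Rightarrow> real \<Rightarrow> complex" where
  "fourier_transform f t = (LINT x|lborel. f x * cis (- (t * x)))"

definition A_loc :: "real set \<Rightarrow> (real \<Rightarrow> complex) set" where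
  "A_loc U = {g. continuous_on U g \<and>
     (\<forall>t\<^sub>0\<in>U. \<exists>V f. open V \<and> t\<^sub>0 \<in> V \<and> V \<subseteq> U \<and> integrable lborel f \<and>
        (\<forall>t\<in>V. g t = fourier_transform f t))}"

definition test_functions :: "real set \<Rightarrow> (real \<Rightarrow> complex) set" where
  "test_functions U = {\<phi>.
     (\<forall>n t. ((\<lambda>h x. vector_derivative h (at x)) ^^ n) \<phi> differentiable (at t)) \<and>
     compact (closure {t. \<phi> t \<noteq> 0}) \<and> closure {t. \<phi> t \<noteq> 0} \<subseteq> U}"

text \<open>
  The values of \<open>g\<close> outside \<open>U\<close> are irrelevant, since test functions vanish there.
\<close>

definition A_loc_boundary_behavior :: "(complex \<Rightarrow> complex) \<Rightarrow> real set \<Rightarrow> bool" where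
  "A_loc_boundary_behavior G U \<longleftrightarrow>
     open U \<and> G analytic_on {s. Re s > 1} \<and>
     (\<exists>g\<in>A_loc U. \<forall>\<phi>\<in>test_functions U.
        ((\<lambda>\<sigma>. LINT t|lborel. G (Complex \<sigma> t) * \<phi> t) \<longlongrightarrow> (LINT t|lborel. g t * \<phi> t))
          (at_right 1))"

end

theory Submission
  imports Defs
    "HOL-Complex_Analysis.Complex_Analysis"
    "HOL-Probability.Characteristic_Functions"
    "HOL-Probability.Sinc_Integral"
    "HOL-Real_Asymp.Real_Asymp"
begin

text \<open>
  Put \<open>B u = exp (- u) * N (exp u)\<close>, so that \<open>\<zeta> s / s\<close> on the line \<open>Re s = 1 + \<delta>\<close> is the Fourier
  transform of \<open>exp (- \<delta> * u) * B u\<close>. By the Wiener--Ikehara argument it suffices that the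
  convolution of \<open>B\<close> with every Fejer kernel converges at infinity to \<open>a\<close> times the mass of the kernel.
  Two Fejer kernels differ on the Fourier side by a function that is \<open>O(t)\<close> at the origin; by (b), and by
  boundedness of \<open>(s - 1) * \<zeta> s\<close> near \<open>1\<close>, its product with \<open>\<zeta> s / s\<close> is dominated by an integrable
  function uniformly in \<open>\<delta>\<close> (here \<open>\<beta> > -1\<close> enters). A Riemann--Lebesgue lemma for dominated families,
  proved with Bessel's inequality and hence without boundary values, shows that the kernel does not matter.

  For one kernel with small spectrum, \<open>(s - 1) * \<zeta> s\<close> tends to \<open>exp (g t)\<close> and \<open>g\<close> is the Fourier
  transform of an integrable \<open>f\<close>. Differences of the convolution then agree with differences of
  \<open>exp (T)\<close> applied to a primitive of the Fejer kernel, \<open>T\<close> being convolution with \<open>f\<close>; since \<open>T\<close> multiplies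
  the limit at infinity by the integral of \<open>f\<close>, the limit is \<open>exp (g 0)\<close> times the mass of the kernel.

  That \<open>log \<zeta> s - log (1 / (s - 1))\<close> converges locally uniformly to \<open>g\<close>, and not merely as a distribution,
  uses that \<open>log \<zeta>\<close> is the Laplace transform of a positive measure: testing against mollifiers with
  nonnegative Fourier transform gives the growth \<open>O(1 / (\<sigma> - 1))\<close>, and the maximum principle on
  rectangles shows that the mollified functions are uniformly Cauchy up to the boundary.
\<close>

section \<open>A Riemann--Lebesgue lemma for dominated families\<close>

text \<open>Hypothesis (b) is only an upper bound, so beyond \<open>\<eta>\<close> there is no
  boundary function to integrate against. Hence the value of the limit has to come from a kernel
  with spectrum in \<open>[-e, e]\<close>, where \<open>g\<close> is a Fourier transform, and wider
  kernels enter only through differences. The exponential of \<open>g\<close> is never written as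
  the transform of a function, since it contains the transform of a Dirac mass; instead the
  exponential series of convolution with \<open>f\<close> acts on a bounded function whose limits at
  both ends are tracked (\<open>smoothed_step\<close>). Nothing is known beforehand about the size
  of \<open>B\<close>; the boundedness of \<open>\<delta>\<close> times the integral of
  \<open>exp (- \<delta> * u) * B u\<close>, summed over dyadic \<open>\<delta>\<close>, makes
  \<open>B u / (1 + u\<^sup>2)\<close> integrable, which is enough for every Fejer convolution to
  exist. Positivity of the prime measure acts twice, both times through monotonicity in
  \<open>\<sigma>\<close>: a bound near \<open>\<sigma> = 1\<close> persists for larger
  \<open>\<sigma>\<close>, and convergence at height 0 controls all heights.\<close>

lemma norm_cis_diff_le: "cmod (cis x - cis y) \<le> \<bar>x - y\<bar>"
proof -
  have "cmod (cis (x - y) - 1) \<le> \<bar>x - y\<bar>"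
    using iexp_approx1[of "x - y" 0] by (simp add: cis_conv_exp)
  moreover have "cis x - cis y = cis y * (cis (x - y) - 1)"
    by (simp add: right_diff_distrib cis_mult)
  ultimately show ?thesis by (simp add: norm_mult)
qed

lemma norm_integral_le_AE:
  fixes f :: "'a \<Rightarrow> 'b::{banach, second_countable_topology}"
  assumes "integrable M f" "integrable M g" "AE x in M. norm (f x) \<le> g x"
  shows "norm (integral\<^sup>L M f) \<le> integral\<^sup>L M g"
proof -
  have "norm (integral\<^sup>L M f) \<le> (LINT x|M. norm (f x))" by (rule integral_norm_bound)
  also have "\<dots> \<le> integral\<^sup>L M g" using assms by (intro integral_mono_AE) auto
  finally show ?thesis .
qed

lemma measurable_cis [measurable]: "cis \<in> borel_measurable borel"
  by (intro borel_measurable_continuous_onI continuous_intros)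

text \<open>Orthogonality on one period. The phase is left as a difference of two products because
  it has this shape when the squared modulus of a trigonometric sum is expanded in
  \<open>bessel_cis\<close>.\<close>

lemma integral_cis_period:
  fixes T :: real and j k :: nat
  assumes T: "T > 0"
  shows "(LINT t|lborel. indicator {-T..T} t *\<^sub>R cis (t * (real j * pi / T) - t * (real k * pi / T)))
           = (if j = k then complex_of_real (2 * T) else 0)"
proof (cases "j = k")
  case True
  then show ?thesis using T by (simp add: measure_def scaleR_conv_of_real)
next
  case False
  define a where "a = (real j - real k) * pi / T"
  have a0: "a \<noteq> 0" using False T by (simp add: a_def)
  have aT: "a * T = (real j - real k) * pi" using T by (simp add: a_def)
  have "(LINT t|lborel. indicator {-T..T} t *\<^sub>R cis (t * a)) = cis (T * a) / (\<i> * a) - cis ((-T) * a) / (\<i> * a)"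
  proof (rule integral_FTC_atLeastAtMost)
    show "((\<lambda>t. cis (t * a) / (\<i> * complex_of_real a)) has_vector_derivative cis (x * a)) (at x within {-T..T})" for x
      unfolding has_vector_derivative_def using a0
      by (auto intro!: derivative_eq_intros simp: fun_eq_iff scaleR_conv_of_real field_simps)
  qed (use T in \<open>auto intro!: continuous_intros\<close>)
  also have "cis ((-T) * a) = cis (T * a)"
  proof -
    \<comment> \<open>The endpoint phases differ by \<open>2 * T * a\<close>, an integer multiple of
      2 pi, so the primitive takes the same value at both ends.\<close>
    have "cis (T * a) = cis (- (T * a)) * cis (2 * (T * a))" by (simp add: cis_mult)
    also have "2 * (T * a) = 2 * pi * of_int (int j - int k)" using aT by (simp add: mult.commute)
    also have "cis (2 * pi * of_int (int j - int k)) = 1" by (rule cis_multiple_2pi) auto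
    finally show ?thesis by simp
  qed
  finally have "(LINT t|lborel. indicator {-T..T} t *\<^sub>R cis (t * a)) = 0" by simp
  moreover have "t * (real j * pi / T) - t * (real k * pi / T) = t * a" for t
    by (simp add: a_def diff_divide_distrib left_diff_distrib right_diff_distrib)
  ultimately show ?thesis using False by simp
qed

lemma integrable_bounded_support:
  fixes g :: "real \<Rightarrow> 'a::{banach, second_countable_topology}"
  assumes [measurable]: "g \<in> borel_measurable borel"
    and bd: "\<And>t. norm (g t) \<le> M" and supp: "\<And>t. \<bar>t\<bar> > T \<Longrightarrow> g t = 0"
  shows "integrable lborel g"
proof (rule Bochner_Integration.integrable_bound)
  show "integrable lborel (\<lambda>t. indicator {-T..T} t * M :: real)"
    by (intro integrable_mult_left integrable_real_indicator) (auto simp: emeasure_lborel_Icc_eq)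
  show "AE t in lborel. norm (g t) \<le> norm (indicator {-T..T} t * M)"
  proof (intro AE_I2)
    fix t show "norm (g t) \<le> norm (indicator {-T..T} t * M)"
      using bd[of t] supp[of t] norm_ge_zero[of "g t"]
      by (cases "t \<in> {-T..T}") (auto simp: abs_le_iff not_le)
  qed
qed simp

text \<open>Pairing \<open>g\<close> with the trigonometric sum \<open>s\<close> built from the
  conjugate coefficients gives exactly \<open>S\<close>. A weighted arithmetic-geometric mean
  inequality splits the pairing; the integral of the squared modulus of \<open>s\<close> returns
  half of \<open>S\<close>, which is absorbed. The bound does not depend on
  \<open>m\<close>.\<close>

lemma bessel_cis:
  fixes g :: "real \<Rightarrow> complex" and m :: nat
  assumes T: "T > 0" and g [measurable]: "g \<in> borel_measurable borel"
    and bd: "\<And>t. cmod (g t) \<le> M" and supp: "\<And>t. \<bar>t\<bar> > T \<Longrightarrow> g t = 0"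
  shows "(\<Sum>j<m. (cmod (LINT t|lborel. g t * cis (t * (real j * pi / T))))\<^sup>2) \<le> 4 * T\<^sup>2 * M\<^sup>2"
proof -
  define e where "e = (\<lambda>j t. cis (t * (real j * pi / T)))"
  define c where "c = (\<lambda>j. LINT t|lborel. g t * e j t)"
  define s where "s = (\<lambda>t. indicator {-T..T} t *\<^sub>R (\<Sum>j<m. cnj (c j) * e j t))"
  define S where "S = (\<Sum>j<m. (cmod (c j))\<^sup>2)"
  have M0: "M \<ge> 0" using bd[of 0] norm_ge_zero order_trans by blast
  have [measurable]: "e j \<in> borel_measurable borel" for j unfolding e_def by measurable
  have [measurable]: "s \<in> borel_measurable borel" unfolding s_def by measurable
  have ne: "cmod (e j t) = 1" for j t by (simp add: e_def)
  have ige: "integrable lborel (\<lambda>t. g t * e j t)" for j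
    by (rule integrable_bounded_support[of _ M T]) (auto simp: norm_mult ne bd supp)
  have gs: "g t * s t = (\<Sum>j<m. cnj (c j) * (g t * e j t))" for t
    using supp[of t] by (cases "t \<in> {-T..T}") (auto simp: s_def sum_distrib_left algebra_simps abs_le_iff not_le)
  have int_gs: "(LINT t|lborel. g t * s t) = of_real S"
  proof -
    have "(LINT t|lborel. g t * s t) = (\<Sum>j<m. cnj (c j) * c j)"
      unfolding gs using ige by (simp add: c_def)
    also have "\<dots> = of_real S" unfolding S_def of_real_sum
      by (rule sum.cong) (simp_all add: complex_norm_square mult.commute del: of_real_power)
    finally show ?thesis .
  qed
  have ss: "complex_of_real ((cmod (s t))\<^sup>2) = (\<Sum>j<m. \<Sum>k<m. cnj (c j) * c k *
      (indicator {-T..T} t *\<^sub>R cis (t * (real j * pi / T) - t * (real k * pi / T))))" for t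
  proof (cases "t \<in> {-T..T}")
    case True
    have "complex_of_real ((cmod (s t))\<^sup>2) = (\<Sum>j<m. cnj (c j) * e j t) * cnj (\<Sum>j<m. cnj (c j) * e j t)"
      using True by (simp add: s_def complex_norm_square del: of_real_power)
    also have "\<dots> = (\<Sum>j<m. \<Sum>k<m. (cnj (c j) * e j t) * (c k * cnj (e k t)))"
      by (simp add: cnj_sum sum_product)
    also have "\<dots> = (\<Sum>j<m. \<Sum>k<m. cnj (c j) * c k * cis (t * (real j * pi / T) - t * (real k * pi / T)))"
      by (intro sum.cong refl) (simp add: e_def cis_cnj algebra_simps cis_mult[symmetric] cis_divide[symmetric] divide_inverse)
    finally show ?thesis using True by simp
  qed (simp add: s_def)
  have sbd: "cmod (s t) \<le> (\<Sum>j<m. cmod (c j))" for t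
  proof -
    have "cmod (\<Sum>j<m. cnj (c j) * e j t) \<le> (\<Sum>j<m. cmod (c j))"
      by (rule sum_norm_le) (simp add: norm_mult ne)
    then show ?thesis by (cases "t \<in> {-T..T}") (auto simp: s_def intro: sum_nonneg)
  qed
  have is2: "integrable lborel (\<lambda>t. (cmod (s t))\<^sup>2)"
  proof (rule integrable_bounded_support[of _ "(\<Sum>j<m. cmod (c j))\<^sup>2" T])
    show "norm ((cmod (s t))\<^sup>2) \<le> (\<Sum>j<m. cmod (c j))\<^sup>2" for t
      using power_mono[OF sbd[of t], of 2] by simp
  qed (auto simp: s_def indicator_def)
  have ig2: "integrable lborel (\<lambda>t. (cmod (g t))\<^sup>2)"
  proof (rule integrable_bounded_support[of _ "M\<^sup>2" T])
    show "norm ((cmod (g t))\<^sup>2) \<le> M\<^sup>2" for t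
      using power_mono[OF bd[of t], of 2] by simp
  qed (auto simp: supp)
  have int_s2: "(LINT t|lborel. (cmod (s t))\<^sup>2) = 2 * T * S"
  proof -
    have icis: "integrable lborel (\<lambda>t. indicator {-T..T} t *\<^sub>R cis (t * (real j * pi / T) - t * (real k * pi / T)))" for j k
      by (rule integrable_bounded_support[of _ 1 T]) (auto simp: indicator_def)
    have "complex_of_real (LINT t|lborel. (cmod (s t))\<^sup>2) = (LINT t|lborel. complex_of_real ((cmod (s t))\<^sup>2))"
      by (rule integral_of_real[symmetric, OF is2])
    also have "\<dots> = (\<Sum>j<m. \<Sum>k<m. cnj (c j) * c k * (if j = k then complex_of_real (2 * T) else 0))"
      unfolding ss integral_cis_period[OF T, symmetric]
      by (subst Bochner_Integration.integral_sum; intro Bochner_Integration.integrable_sum integrable_mult_right icis sum.cong refl)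
         (subst Bochner_Integration.integral_sum; intro integrable_mult_right icis sum.cong refl integral_mult_right_zero)
    also have "\<dots> = (\<Sum>j<m. complex_of_real (2 * T * (cmod (c j))\<^sup>2))"
    proof (intro sum.cong refl)
      fix j assume "j \<in> {..<m}"
      have "(\<Sum>k<m. cnj (c j) * c k * (if j = k then complex_of_real (2 * T) else 0)) =
            (\<Sum>k<m. if k = j then cnj (c j) * c j * complex_of_real (2 * T) else 0)"
        by (intro sum.cong refl) auto
      also have "\<dots> = cnj (c j) * c j * complex_of_real (2 * T)" using \<open>j \<in> {..<m}\<close> by simp
      also have "\<dots> = complex_of_real (2 * T * (cmod (c j))\<^sup>2)"
        using complex_norm_square[of "c j"] by (simp add: mult_ac)
      finally show "(\<Sum>k<m. cnj (c j) * c k * (if j = k then complex_of_real (2 * T) else 0)) = \<dots>" .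
    qed
    also have "\<dots> = complex_of_real (2 * T * S)" by (simp add: S_def sum_distrib_left)
    finally show ?thesis using of_real_eq_iff by blast
  qed
  have int_g2: "(LINT t|lborel. (cmod (g t))\<^sup>2) \<le> 2 * T * M\<^sup>2"
  proof -
    have "(LINT t|lborel. (cmod (g t))\<^sup>2) \<le> (LINT t|lborel. indicator {-T..T} t * M\<^sup>2)"
    proof (rule integral_mono[OF ig2])
      show "integrable lborel (\<lambda>t. indicator {-T..T} t * M\<^sup>2)"
        by (rule integrable_bounded_support[of _ "M\<^sup>2" T]) (auto simp: indicator_def)
      show "(cmod (g t))\<^sup>2 \<le> indicator {-T..T} t * M\<^sup>2" for t
        using power_mono[OF bd[of t], of 2] supp[of t]
        by (cases "t \<in> {-T..T}") (auto simp: abs_le_iff not_le)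
    qed
    also have "\<dots> = 2 * T * M\<^sup>2" using T by (simp add: measure_def)
    finally show ?thesis .
  qed
  have "S = cmod (LINT t|lborel. g t * s t)"
    unfolding int_gs norm_of_real using sum_nonneg[of "{..<m}" "\<lambda>j. (cmod (c j))\<^sup>2"] by (simp add: S_def)
  also have "\<dots> \<le> (LINT t|lborel. T * (cmod (g t))\<^sup>2 + (cmod (s t))\<^sup>2 / (4 * T))"
  proof (rule norm_integral_le_AE[OF _ _ AE_I2])
    show "integrable lborel (\<lambda>t. g t * s t)" unfolding gs using ige by simp
    show "integrable lborel (\<lambda>t. T * (cmod (g t))\<^sup>2 + (cmod (s t))\<^sup>2 / (4 * T))" using ig2 is2 by simp
    fix t
    \<comment> \<open>The weight \<open>2 * T\<close> is the one for which \<open>int_s2\<close>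
      turns the second term into \<open>S / 2\<close>.\<close>
    have "0 \<le> (2 * T * cmod (g t) - cmod (s t))\<^sup>2 / (4 * T)" using T by simp
    also have "\<dots> = T * (cmod (g t))\<^sup>2 + (cmod (s t))\<^sup>2 / (4 * T) - cmod (g t) * cmod (s t)"
      using T by (simp add: field_simps power2_eq_square)
    finally show "cmod (g t * s t) \<le> T * (cmod (g t))\<^sup>2 + (cmod (s t))\<^sup>2 / (4 * T)"
      by (simp add: norm_mult)
  qed
  also have "\<dots> = T * (LINT t|lborel. (cmod (g t))\<^sup>2) + S / 2"
    using ig2 is2 T by (simp add: int_s2 field_simps)
  also have "\<dots> \<le> T * (2 * T * M\<^sup>2) + S / 2" using int_g2 T by simp
  finally have "S \<le> 4 * T\<^sup>2 * M\<^sup>2" by (simp add: power2_eq_square)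
  then show ?thesis by (simp add: S_def c_def e_def)
qed

text \<open>The functions \<open>g n\<close> need not converge, only their Fourier integrals do.
  Common support and a common majorant make these integrals Lipschitz with one constant, so
  \<open>J\<close> is known up to \<open>e\<close> from its values on a grid. After truncation at a
  common height, Bessel bounds the number of grid points where \<open>J\<close> is large, so that
  none are left far out.\<close>

lemma dominated_riemann_lebesgue:
  fixes g :: "nat \<Rightarrow> real \<Rightarrow> complex" and h :: "real \<Rightarrow> real" and J :: "real \<Rightarrow> complex"
  assumes T: "T > 0" and g [measurable]: "\<And>n. g n \<in> borel_measurable borel"
    and h: "integrable lborel h"
    and dom: "\<And>n. AE t in lborel. cmod (g n t) \<le> h t"
    and supp: "\<And>n t. \<bar>t\<bar> > T \<Longrightarrow> g n t = 0"
    and lim: "\<And>y. (\<lambda>n. LINT t|lborel. g n t * cis (t * y)) \<longlonglongrightarrow> J y"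
  shows "(J \<longlongrightarrow> 0) at_top"
proof -
  have [measurable]: "h \<in> borel_measurable borel" using h by auto
  define I where "I = (\<lambda>n y. LINT t|lborel. g n t * cis (t * y))"
  have ig: "integrable lborel (\<lambda>t. g n t * cis (t * y))" for n y
    using h by (rule Bochner_Integration.integrable_bound)
      (use dom[of n] in \<open>auto elim!: eventually_mono simp: norm_mult\<close>)
  define H where "H = (LINT t|lborel. \<bar>h t\<bar>)"
  have H0: "H \<ge> 0" by (simp add: H_def)
  have Ilip: "cmod (I n y - I n y') \<le> \<bar>y - y'\<bar> * (T * H)" for n y y'
  proof -
    have "I n y - I n y' = (LINT t|lborel. g n t * cis (t * y) - g n t * cis (t * y'))"
      unfolding I_def using ig by simp
    also have "cmod \<dots> \<le> (LINT t|lborel. (\<bar>y - y'\<bar> * T) * \<bar>h t\<bar>)"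
    proof (rule norm_integral_le_AE)
      show "integrable lborel (\<lambda>t. g n t * cis (t * y) - g n t * cis (t * y'))" using ig by simp
      show "integrable lborel (\<lambda>t. (\<bar>y - y'\<bar> * T) * \<bar>h t\<bar>)" using h by simp
      show "AE t in lborel. cmod (g n t * cis (t * y) - g n t * cis (t * y')) \<le> (\<bar>y - y'\<bar> * T) * \<bar>h t\<bar>"
        using dom[of n]
      proof eventually_elim
        case (elim t)
        show ?case
        proof (cases "\<bar>t\<bar> > T")
          case True then show ?thesis using T by (simp add: supp)
        next
          case False
          have "cmod (g n t * cis (t * y) - g n t * cis (t * y')) = cmod (g n t) * cmod (cis (t * y) - cis (t * y'))"
            by (simp add: norm_mult flip: right_diff_distrib)
          also have "\<dots> \<le> \<bar>h t\<bar> * (T * \<bar>y - y'\<bar>)"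
          proof (intro mult_mono)
            have "cmod (cis (t * y) - cis (t * y')) \<le> \<bar>t * y - t * y'\<bar>" by (rule norm_cis_diff_le)
            also have "\<dots> = \<bar>t\<bar> * \<bar>y - y'\<bar>" by (simp add: abs_mult flip: right_diff_distrib)
            also have "\<dots> \<le> T * \<bar>y - y'\<bar>" using False by (intro mult_right_mono) auto
            finally show "cmod (cis (t * y) - cis (t * y')) \<le> T * \<bar>y - y'\<bar>" .
          qed (use elim in auto)
          finally show ?thesis by (simp add: mult_ac)
        qed
      qed
    qed
    finally show ?thesis by (simp add: H_def mult_ac)
  qed
  have Jlip: "cmod (J y - J y') \<le> \<bar>y - y'\<bar> * (T * H)" for y y'
  proof (rule Lim_bounded)
    show "(\<lambda>n. cmod (I n y - I n y')) \<longlonglongrightarrow> cmod (J y - J y')"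
      unfolding I_def by (intro tendsto_intros lim)
  qed (use Ilip in auto)
  have tail: "(\<lambda>m. LINT t|lborel. (if h t > real m then h t else 0)) \<longlonglongrightarrow> integral\<^sup>L lborel (\<lambda>t::real. (0::real))"
  proof (rule integral_dominated_convergence[where w="\<lambda>t. \<bar>h t\<bar>"])
    show "AE t in lborel. (\<lambda>m. if h t > real m then h t else 0) \<longlonglongrightarrow> 0"
    proof (intro AE_I2 tendsto_eventually)
      fix t
      obtain m0 :: nat where "h t \<le> real m0" using real_arch_simple by blast
      then show "\<forall>\<^sub>F m in sequentially. (if h t > real m then h t else 0) = 0"
        unfolding eventually_sequentially by (intro exI[of _ m0]) auto
    qed
  qed (use h in auto)
  show ?thesis
  proof (rule tendstoI)
    fix e0 :: real assume "e0 > 0"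
    define e where "e = e0 / 4"
    have e: "e > 0" using \<open>e0 > 0\<close> by (simp add: e_def)
    obtain m :: nat where m: "(LINT t|lborel. (if h t > real m then h t else 0)) < e"
      using order_tendstoD(2)[OF tail, of e] e by (auto simp: eventually_sequentially)
    \<comment> \<open>Bessel is applied with half-period \<open>T'\<close>: enlarging it refines the
      grid of mesh \<open>pi / T'\<close> until one mesh width changes \<open>J\<close> by at most
      \<open>e\<close>.\<close>
    define T' where "T' = max T (pi * (T * H) / e)"
    have T': "T' > 0" "T \<le> T'" "pi / T' * (T * H) \<le> e"
    proof -
      show "T' > 0" "T \<le> T'" using T by (auto simp: T'_def)
      have "pi * (T * H) / e \<le> T'" by (simp add: T'_def)
      then show "pi / T' * (T * H) \<le> e" using e \<open>T' > 0\<close> by (simp add: field_simps)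
    qed
    define y where "y = (\<lambda>j. real j * pi / T')"
    \<comment> \<open>The second condition is there because domination holds only almost everywhere,
      while \<open>bessel_cis\<close> asks for a pointwise bound.\<close>
    define gM where "gM = (\<lambda>n t. if h t \<le> real m \<and> cmod (g n t) \<le> h t then g n t else 0)"
    have [measurable]: "gM n \<in> borel_measurable borel" for n unfolding gM_def by measurable
    have gMb: "cmod (gM n t) \<le> real m" for n t by (auto simp: gM_def)
    have bess: "(\<Sum>j<k. (cmod (LINT t|lborel. gM n t * cis (t * y j)))\<^sup>2) \<le> 4 * T'\<^sup>2 * (real m)\<^sup>2" for n k
      unfolding y_def by (rule bessel_cis[OF T'(1) _ gMb]) (use T' supp in \<open>auto simp: gM_def\<close>)
    have close: "cmod (I n y - (LINT t|lborel. gM n t * cis (t * y))) < e" for n y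
    proof -
      have igM: "integrable lborel (\<lambda>t. gM n t * cis (t * y))"
        by (rule integrable_bounded_support[of _ "real m" T]) (auto simp: norm_mult gMb supp gM_def)
      have "I n y - (LINT t|lborel. gM n t * cis (t * y)) = (LINT t|lborel. g n t * cis (t * y) - gM n t * cis (t * y))"
        unfolding I_def using ig igM by simp
      also have "cmod \<dots> \<le> (LINT t|lborel. (if h t > real m then h t else 0))"
      proof (rule norm_integral_le_AE)
        show "integrable lborel (\<lambda>t. g n t * cis (t * y) - gM n t * cis (t * y))" using ig igM by simp
        show "integrable lborel (\<lambda>t. (if h t > real m then h t else 0))"
          using h by (rule Bochner_Integration.integrable_bound) auto
        show "AE t in lborel. cmod (g n t * cis (t * y) - gM n t * cis (t * y)) \<le> (if h t > real m then h t else 0)"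
          using dom[of n] by eventually_elim (auto simp: gM_def norm_mult)
      qed
      finally show ?thesis using m by simp
    qed
    \<comment> \<open>Two losses of \<open>e\<close>: \<open>3 * e\<close> for \<open>J\<close>
      leaves \<open>2 * e\<close> for some \<open>I n\<close> and \<open>e\<close> for its
      truncation. The index \<open>n\<close> depends on the finite set \<open>X\<close>, but the
      bound on \<open>card X\<close> does not.\<close>
    have fin: "finite {j. cmod (J (y j)) \<ge> 3 * e}"
    proof (rule finite_if_finite_subsets_card_bdd[THEN conjunct1])
      fix X assume X1: "X \<subseteq> {j. cmod (J (y j)) \<ge> 3 * e}" and X2: "finite X"
      show "card X \<le> nat \<lceil>4 * T'\<^sup>2 * (real m)\<^sup>2 / e\<^sup>2\<rceil>"
      proof -
        note X = X1 X2
        have "\<forall>\<^sub>F n in sequentially. \<forall>j\<in>X. cmod (I n (y j)) > 2 * e"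
        proof (rule eventually_ball_finite)
          show "\<forall>j\<in>X. \<forall>\<^sub>F n in sequentially. cmod (I n (y j)) > 2 * e"
          proof
            fix j assume "j \<in> X"
            then have "cmod (J (y j)) > 2 * e" using X e by auto
            moreover have "(\<lambda>n. cmod (I n (y j))) \<longlonglongrightarrow> cmod (J (y j))" unfolding I_def by (intro tendsto_intros lim)
            ultimately show "\<forall>\<^sub>F n in sequentially. cmod (I n (y j)) > 2 * e" by (rule order_tendstoD(1)[rotated])
          qed
        qed (use X in auto)
        then obtain n where n: "\<forall>j\<in>X. cmod (I n (y j)) > 2 * e" by (auto simp: eventually_sequentially)
        obtain k where k: "X \<subseteq> {..<k}" using X finite_nat_iff_bounded by blast
        have "real (card X) * e\<^sup>2 = (\<Sum>j\<in>X. e\<^sup>2)" by simp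
        also have "\<dots> \<le> (\<Sum>j\<in>X. (cmod (LINT t|lborel. gM n t * cis (t * y j)))\<^sup>2)"
        proof (intro sum_mono power_mono)
          fix j assume "j \<in> X"
          with n have "2 * e < cmod (I n (y j))" by auto
          also have "\<dots> \<le> cmod (I n (y j) - (LINT t|lborel. gM n t * cis (t * y j))) + cmod (LINT t|lborel. gM n t * cis (t * y j))"
            by (metis diff_add_cancel norm_triangle_ineq)
          finally show "e \<le> cmod (LINT t|lborel. gM n t * cis (t * y j))" using close[of n "y j"] by linarith
        qed (use e in auto)
        also have "\<dots> \<le> (\<Sum>j<k. (cmod (LINT t|lborel. gM n t * cis (t * y j)))\<^sup>2)"
          using k by (intro sum_mono2) auto
        also note bess[of n k]
        finally have "real (card X) \<le> 4 * T'\<^sup>2 * (real m)\<^sup>2 / e\<^sup>2" using e by (simp add: field_simps)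
        then show "card X \<le> nat \<lceil>4 * T'\<^sup>2 * (real m)\<^sup>2 / e\<^sup>2\<rceil>" by linarith
      qed
    qed
    then obtain j0 where j0: "\<And>j. j \<ge> j0 \<Longrightarrow> cmod (J (y j)) < 3 * e"
      by (metis (mono_tags, lifting) finite_nat_set_iff_bounded leD mem_Collect_eq not_le_imp_less)
    show "\<forall>\<^sub>F x in at_top. dist (J x) 0 < e0"
    proof (rule eventually_at_top_linorderI[of "max 0 ((real j0 + 1) * pi / T')"])
      fix x assume x: "max 0 ((real j0 + 1) * pi / T') \<le> x"
      define j where "j = nat \<lfloor>x * T' / pi\<rfloor>"
      have "x \<ge> 0" using x by (meson max.boundedE)
      then have x0: "x * T' / pi \<ge> 0" using T' by simp
      have j1: "real j \<le> x * T' / pi" "x * T' / pi < real j + 1" using x0 by (simp_all add: j_def)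
      have "real j0 + 1 \<le> x * T' / pi" using x T' by (simp add: field_simps)
      with j1 have "j0 \<le> j" by linarith
      have "\<bar>x - y j\<bar> \<le> pi / T'"
      proof -
        have "y j \<le> x" using j1(1) T' by (simp add: y_def field_simps)
        moreover have "x \<le> y j + pi / T'" using j1(2) T' by (simp add: y_def field_simps)
        ultimately show ?thesis by simp
      qed
      then have "\<bar>x - y j\<bar> * (T * H) \<le> pi / T' * (T * H)" using T H0 by (intro mult_right_mono) auto
      with Jlip[of x "y j"] T'(3) have "cmod (J x - J (y j)) \<le> e" by linarith
      with j0[OF \<open>j0 \<le> j\<close>] have "cmod (J x) < 4 * e"
        using norm_triangle_ineq2[of "J x" "J (y j)"] by linarith
      then show "dist (J x) 0 < e0" by (simp add: e_def)
    qed
  qed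
qed

section \<open>Fejer kernels\<close>

lemma (in pair_sigma_finite) integrable_product_bound:
  fixes f :: "'a \<times> 'b \<Rightarrow> 'c::{banach, second_countable_topology}" and a :: "'a \<Rightarrow> real" and b :: "'b \<Rightarrow> real"
  assumes f [measurable]: "f \<in> borel_measurable (M1 \<Otimes>\<^sub>M M2)"
    and a: "integrable M1 a" and b: "integrable M2 b"
    and bd: "\<And>x y. norm (f (x, y)) \<le> a x * b y"
  shows "integrable (M1 \<Otimes>\<^sub>M M2) f"
proof (rule Bochner_Integration.integrable_bound)
  have [measurable]: "a \<in> borel_measurable M1" "b \<in> borel_measurable M2" using a b by auto
  show "integrable (M1 \<Otimes>\<^sub>M M2) (\<lambda>(x, y). a x * b y)"
    by (rule Fubini_integrable) (use a b in \<open>auto simp: abs_mult\<close>)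
  show "AE z in M1 \<Otimes>\<^sub>M M2. norm (f z) \<le> norm (case z of (x, y) \<Rightarrow> a x * b y)"
    using bd by (auto simp: order.trans[OF _ abs_ge_self])
qed simp

lemma (in pair_sigma_finite) fubini_swap_bound:
  fixes f :: "'a \<Rightarrow> 'b \<Rightarrow> 'c::{banach, second_countable_topology}" and a :: "'a \<Rightarrow> real" and b :: "'b \<Rightarrow> real"
  assumes "(\<lambda>(x, y). f x y) \<in> borel_measurable (M1 \<Otimes>\<^sub>M M2)"
    and "integrable M1 a" and "integrable M2 b"
    and "\<And>x y. norm (f x y) \<le> a x * b y"
  shows "(LINT x|M1. LINT y|M2. f x y) = (LINT y|M2. LINT x|M1. f x y)"
  using Fubini_integral[OF integrable_product_bound[OF assms(1-3)]] assms(4) by simp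

definition tent :: "real \<Rightarrow> real \<Rightarrow> real" where
  "tent L t = max 0 (1 - \<bar>t\<bar> / L)"

text \<open>In closed form \<open>L * (sin (L * x / 2) / (L * x / 2))\<^sup>2\<close>, the Fourier
  transform of \<open>tent L\<close> with no factor 1 / (2 pi); the separate value is the limit at
  0.\<close>

definition fejer :: "real \<Rightarrow> real \<Rightarrow> real" where
  "fejer L x = (if x = 0 then L else 2 * (1 - cos (L * x)) / (L * x\<^sup>2))"

lemma measurable_tent [measurable]: "tent L \<in> borel_measurable borel"
  unfolding tent_def by measurable

lemma measurable_fejer [measurable]: "fejer L \<in> borel_measurable borel"
  unfolding fejer_def by measurable

lemma tent_nonneg [simp]: "tent L t \<ge> 0" by (simp add: tent_def)

lemma tent_le_1: "L > 0 \<Longrightarrow> tent L t \<le> 1" by (simp add: tent_def)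

lemma tent_eq_0: "L > 0 \<Longrightarrow> \<bar>t\<bar> \<ge> L \<Longrightarrow> tent L t = 0"
  by (simp add: tent_def field_simps)

text \<open>Applied to two tents, this makes their difference \<open>O(t)\<close> at the origin,
  which is what cancels the pole of the zeta function at 1.\<close>

lemma tent_diff_1: "L > 0 \<Longrightarrow> \<bar>tent L t - 1\<bar> \<le> \<bar>t\<bar> / L"
  by (simp add: tent_def max_def field_simps)

lemma integrable_tent: "L > 0 \<Longrightarrow> integrable lborel (tent L)"
  by (rule integrable_bounded_support[of _ 1 L]) (auto simp: tent_le_1 tent_eq_0)

lemma fejer_nonneg: "L > 0 \<Longrightarrow> fejer L x \<ge> 0"
  by (simp add: fejer_def)

lemma fejer_minus [simp]: "fejer L (- x) = fejer L x" by (simp add: fejer_def)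

text \<open>The constant adds the bound \<open>L\<close> for the kernel, which matters near 0, and
  the bound \<open>4 / L\<close> for \<open>x\<^sup>2 * fejer L x\<close>, which matters at
  infinity.\<close>

lemma fejer_le: "L > 0 \<Longrightarrow> fejer L x \<le> (L + 4 / L) / (1 + x\<^sup>2)"
proof -
  assume L: "L > 0"
  have "fejer L x \<le> L"
  proof (cases "x = 0")
    case False
    have "1 - cos (L * x) = 2 * (sin (L * x / 2))\<^sup>2" using cos_double_sin[of "L * x / 2"] by simp
    also have "(sin (L * x / 2))\<^sup>2 \<le> (L * x / 2)\<^sup>2"
      by (rule abs_le_square_iff[THEN iffD1, OF abs_sin_x_le_abs_x])
    finally have "2 * (1 - cos (L * x)) \<le> L * (L * x\<^sup>2)" by (simp add: power2_eq_square)
    then show ?thesis using False L by (simp add: fejer_def field_simps)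
  qed (use L in \<open>simp add: fejer_def\<close>)
  moreover have "x\<^sup>2 * fejer L x \<le> 4 / L"
  proof (cases "x = 0")
    case False
    have "2 * (1 - c) \<le> 4" if "- 1 \<le> c" for c :: real using that by simp
    from this[OF cos_ge_minus_one] have "2 * (1 - cos (L * x)) \<le> 4" .
    moreover have "x\<^sup>2 * fejer L x = 2 * (1 - cos (L * x)) / L" using False L by (simp add: fejer_def)
    ultimately show ?thesis using L by (simp add: divide_right_mono)
  qed (use L in simp)
  ultimately have "(1 + x\<^sup>2) * fejer L x \<le> L + 4 / L" by (simp add: distrib_right)
  moreover have "1 + x\<^sup>2 > 0" by (simp add: add_pos_nonneg)
  ultimately show ?thesis by (simp add: pos_le_divide_eq mult.commute)
qed

lemma integrable_inverse_square: "integrable lborel (\<lambda>x::real. 1 / (1 + x\<^sup>2))"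
  using integrable_inverse_1_plus_square
  by (simp add: set_integrable_def inverse_eq_divide)

lemma integrable_fejer: "L > 0 \<Longrightarrow> integrable lborel (fejer L)"
proof (rule Bochner_Integration.integrable_bound)
  assume L: "L > 0"
  show "integrable lborel (\<lambda>x. (L + 4 / L) * (1 / (1 + x\<^sup>2)))"
    by (rule integrable_mult_right) (rule integrable_inverse_square)
  show "AE x in lborel. norm (fejer L x) \<le> norm ((L + 4 / L) * (1 / (1 + x\<^sup>2)))"
    using L fejer_le[OF L] fejer_nonneg[OF L] by (auto simp: abs_mult abs_of_nonneg)
qed simp

text \<open>The tent is linear on each side of the origin, so the fundamental theorem is applied
  twice. The primitives \<open>F1\<close> and \<open>F2\<close> come from one integration by parts
  and divide by \<open>x\<close>, which is why \<open>x = 0\<close> is treated separately.\<close>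

lemma integral_tent_cis:
  assumes L: "L > 0"
  shows "(LINT t|lborel. complex_of_real (tent L t) * cis (t * x)) = complex_of_real (fejer L x)"
proof -
  define f1 where "f1 = (\<lambda>t. complex_of_real (1 - t / L) * cis (t * x))"
  define f2 where "f2 = (\<lambda>t. complex_of_real (1 + t / L) * cis (t * x))"
  have c1: "continuous_on A f1" and c2: "continuous_on A f2" for A
    unfolding f1_def f2_def using L by (auto intro!: continuous_intros)
  have i1: "integrable lborel (\<lambda>t. indicator {0..L} t *\<^sub>R f1 t)"
    using borel_integrable_compact[OF compact_Icc c1[of "{0..L}"]] by simp
  have i2: "integrable lborel (\<lambda>t. indicator {-L..0} t *\<^sub>R f2 t)"
    using borel_integrable_compact[OF compact_Icc c2[of "{-L..0}"]] by simp
  have "(LINT t|lborel. complex_of_real (tent L t) * cis (t * x)) =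
        (LINT t|lborel. indicator {0..L} t *\<^sub>R f1 t + indicator {-L..0} t *\<^sub>R f2 t)"
  proof (rule integral_cong_AE)
    show "AE t in lborel. complex_of_real (tent L t) * cis (t * x) = indicator {0..L} t *\<^sub>R f1 t + indicator {-L..0} t *\<^sub>R f2 t"
    \<comment> \<open>Both closed intervals contain 0, where the two pieces would be counted
      together.\<close>
    proof (rule AE_mp[OF AE_lborel_singleton[of 0]], intro AE_I2 impI)
      fix t :: real assume "t \<noteq> 0"
      then show "complex_of_real (tent L t) * cis (t * x) = indicator {0..L} t *\<^sub>R f1 t + indicator {-L..0} t *\<^sub>R f2 t"
        using L by (auto simp: tent_def f1_def f2_def indicator_def max_def field_simps abs_if split: if_splits)
    qed
  qed (auto simp: f1_def f2_def)
  also have "\<dots> = (LINT t|lborel. indicator {0..L} t *\<^sub>R f1 t) + (LINT t|lborel. indicator {-L..0} t *\<^sub>R f2 t)"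
    using i1 i2 by simp
  also have "\<dots> = complex_of_real (fejer L x)"
  proof (cases "x = 0")
    case True
    have "(LINT t|lborel. indicator {0..L} t *\<^sub>R f1 t) = complex_of_real (L - L\<^sup>2 / (2 * L)) - complex_of_real (0 - 0\<^sup>2 / (2 * L))"
      by (rule integral_FTC_atLeastAtMost[OF _ _ c1])
        (use L True in \<open>auto intro!: derivative_eq_intros simp: f1_def has_vector_derivative_def fun_eq_iff scaleR_conv_of_real field_simps\<close>)
    moreover have "(LINT t|lborel. indicator {-L..0} t *\<^sub>R f2 t) = complex_of_real (0 + 0\<^sup>2 / (2 * L)) - complex_of_real (-L + (-L)\<^sup>2 / (2 * L))"
      by (rule integral_FTC_atLeastAtMost[OF _ _ c2])
        (use L True in \<open>auto intro!: derivative_eq_intros simp: f2_def has_vector_derivative_def fun_eq_iff scaleR_conv_of_real field_simps\<close>)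
    ultimately have "(LINT t|lborel. indicator {0..L} t *\<^sub>R f1 t) + (LINT t|lborel. indicator {-L..0} t *\<^sub>R f2 t)
        = complex_of_real (L - L\<^sup>2 / (2 * L) + (0 - (-L + (-L)\<^sup>2 / (2 * L))))" by (simp only: of_real_add of_real_diff) simp
    also have "L - L\<^sup>2 / (2 * L) + (0 - (-L + (-L)\<^sup>2 / (2 * L))) = L" using L by (simp add: field_simps power2_eq_square)
    finally show ?thesis using True by (simp add: fejer_def)
  next
    case False
    define F1 where "F1 = (\<lambda>t. complex_of_real (1 - t / L) * cis (t * x) / (\<i> * of_real x) - cis (t * x) / of_real (L * x\<^sup>2))"
    define F2 where "F2 = (\<lambda>t. complex_of_real (1 + t / L) * cis (t * x) / (\<i> * of_real x) + cis (t * x) / of_real (L * x\<^sup>2))"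
    have "(LINT t|lborel. indicator {0..L} t *\<^sub>R f1 t) = F1 L - F1 0"
      by (rule integral_FTC_atLeastAtMost[OF _ _ c1])
        (use L False in \<open>auto intro!: derivative_eq_intros simp: f1_def F1_def has_vector_derivative_def fun_eq_iff scaleR_conv_of_real field_simps power2_eq_square\<close>)
    moreover have "(LINT t|lborel. indicator {-L..0} t *\<^sub>R f2 t) = F2 0 - F2 (-L)"
      by (rule integral_FTC_atLeastAtMost[OF _ _ c2])
        (use L False in \<open>auto intro!: derivative_eq_intros simp: f2_def F2_def has_vector_derivative_def fun_eq_iff scaleR_conv_of_real field_simps power2_eq_square\<close>)
    ultimately have "(LINT t|lborel. indicator {0..L} t *\<^sub>R f1 t) + (LINT t|lborel. indicator {-L..0} t *\<^sub>R f2 t)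
        = F1 L - F1 0 + (F2 0 - F2 (-L))" by simp
    also have "\<dots> = (2 - (cis (L * x) + cis (- (L * x)))) / of_real (L * x\<^sup>2)"
      using L by (simp add: F1_def F2_def diff_divide_distrib add_divide_distrib)
    also have "cis (L * x) + cis (- (L * x)) = 2 * of_real (cos (L * x))"
      by (simp add: complex_eq_iff)
    finally show ?thesis using False L by (simp add: fejer_def)
  qed
  finally show ?thesis .
qed

lemma fejer_scale: "L > 0 \<Longrightarrow> fejer L x = L * fejer 1 (L * x)"
  by (simp add: fejer_def power2_eq_square)

text \<open>The number 2 pi, kept as a symbol because it is divided out in the end.\<close>

definition fejer_mass :: real where "fejer_mass = (LINT x|lborel. fejer 1 x)"

lemma integral_fejer:
  assumes "L > 0" shows "(LINT x|lborel. fejer L x) = fejer_mass"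
  using lborel_integral_real_affine[of L "fejer 1" 0] assms
  by (simp add: fejer_mass_def fejer_scale[of L])

lemma fejer_mass_pos: "fejer_mass > 0"
proof -
  have "fejer_mass \<ge> 0" unfolding fejer_mass_def by (rule Bochner_Integration.integral_nonneg) (simp add: fejer_nonneg)
  moreover have "fejer_mass \<noteq> 0"
  proof
    assume "fejer_mass = 0"
    then have "AE x in lborel. fejer 1 x = 0"
      unfolding fejer_mass_def by (subst (asm) integral_nonneg_eq_0_iff_AE) (auto simp: fejer_nonneg integrable_fejer)
    moreover have "fejer 1 x \<noteq> 0" if "x \<in> {0<..<1}" for x
    proof -
      have "cos x < cos 0" using that pi_gt3 by (intro cos_monotone_0_pi) auto
      then show ?thesis using that by (simp add: fejer_def)
    qed
    ultimately have "AE x in lborel. x \<notin> {0<..<1::real}" by (auto elim!: eventually_mono)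
    then have "emeasure lborel {0<..<1::real} = 0"
      by (subst (asm) AE_iff_measurable[where N="{0<..<1}"]) auto
    then show False by simp
  qed
  ultimately show ?thesis by linarith
qed

section \<open>Primitives of the Fejer kernel and the Wiener algebra\<close>

text \<open>The integral of \<open>cis (t * w)\<close> for \<open>w\<close> from \<open>y'\<close>
  to \<open>y\<close>, hence the multiplier that belongs to a difference of two values of a
  primitive. At \<open>t = 0\<close> division by zero gives 0 instead of \<open>y - y'\<close>; this
  is a single point, and the bound below survives there.\<close>

definition cis_quot :: "real \<Rightarrow> real \<Rightarrow> real \<Rightarrow> complex" where
  "cis_quot y y' t = (cis (t * y) - cis (t * y')) / (\<i> * of_real t)"

lemma measurable_cis_quot [measurable]: "(\<lambda>t. cis_quot y y' t) \<in> borel_measurable borel"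
  unfolding cis_quot_def by measurable

lemma norm_cis_quot_le: "cmod (cis_quot y y' t) \<le> \<bar>y - y'\<bar>"
proof (cases "t = 0")
  case False
  have "cmod (cis (t * y) - cis (t * y')) \<le> \<bar>t * y - t * y'\<bar>" by (rule norm_cis_diff_le)
  also have "\<dots> = \<bar>t\<bar> * \<bar>y - y'\<bar>" by (simp add: abs_mult flip: right_diff_distrib)
  finally show ?thesis using False by (simp add: cis_quot_def norm_divide norm_mult field_simps)
qed (simp add: cis_quot_def)

text \<open>Translation by \<open>x\<close> becomes a character; integrated against \<open>f\<close>
  it produces \<open>fourier_transform f\<close>, so convolution with \<open>f\<close> acts on
  multipliers by multiplication.\<close>

lemma cis_quot_shift: "cis_quot (y - x) (y' - x) t = cis (- (t * x)) * cis_quot y y' t"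
  by (simp add: cis_quot_def right_diff_distrib cis_mult field_simps flip: cis_divide)

text \<open>Only differences are represented spectrally, because the transform of \<open>K\<close>
  itself would be \<open>tent e t * m t / (\<i> * t)\<close>, singular at the origin. The limit 0 at
  minus infinity fixes the additive constant, and the limit \<open>l\<close> is carried along
  because the density is read off from it.\<close>

definition smoothed_step :: "real \<Rightarrow> (real \<Rightarrow> complex) \<Rightarrow> complex \<Rightarrow> (real \<Rightarrow> complex) \<Rightarrow> bool" where
  "smoothed_step e K l m \<longleftrightarrow> K \<in> borel_measurable borel \<and> bounded (range K) \<and>
     (K \<longlongrightarrow> 0) at_bot \<and> (K \<longlongrightarrow> l) at_top \<and> m \<in> borel_measurable borel \<and> bounded (range m) \<and>
     (\<forall>y y'. K y - K y' = (LINT t|lborel. of_real (tent e t) * cis_quot y y' t * m t))"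

lemma integrable_tent_mult:
  assumes e: "e > 0" and [measurable]: "f \<in> borel_measurable borel" and bd: "\<And>t. cmod (f t) \<le> M"
  shows "integrable lborel (\<lambda>t. complex_of_real (tent e t) * f t)"
proof (rule integrable_bounded_support[of _ M e])
  show "cmod (of_real (tent e t) * f t) \<le> M" for t
    using mult_mono[OF tent_le_1[OF e, of t] bd[of t]] by (simp add: norm_mult)
qed (use e in \<open>auto simp: tent_eq_0\<close>)

text \<open>The function is the primitive of the Fejer kernel that vanishes at minus infinity;
  integrating \<open>integral_tent_cis\<close> over an interval turns the character into
  \<open>cis_quot\<close>.\<close>

lemma smoothed_step_base:
  assumes e: "e > 0"
  shows "smoothed_step e (\<lambda>z. of_real (LINT w|lborel. indicator {..z} w * fejer e w)) (of_real fejer_mass) (\<lambda>_. 1)"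
proof -
  define K where "K = (\<lambda>z. LINT w|lborel. indicator {..z} w * fejer e w)"
  have iK: "integrable lborel (\<lambda>w. indicator A w * fejer e w)" if "A \<in> sets borel" for A
    by (rule Bochner_Integration.integrable_bound[OF integrable_fejer[OF e]]) (use that in \<open>auto simp: indicator_def\<close>)
  have Kb: "0 \<le> K z" "K z \<le> fejer_mass" for z
  proof -
    show "0 \<le> K z" unfolding K_def by (rule Bochner_Integration.integral_nonneg) (simp add: fejer_nonneg e)
    show "K z \<le> fejer_mass" unfolding K_def integral_fejer[OF e, symmetric]
      by (rule integral_mono[OF iK integrable_fejer[OF e]]) (auto simp: indicator_def fejer_nonneg e)
  qed
  have diff0: "complex_of_real (K y - K y') = (LINT t|lborel. of_real (tent e t) * cis_quot y y' t)" if "y' \<le> y" for y y'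
  proof -
    have "K y - K y' = (LINT w|lborel. indicator {..y} w * fejer e w - indicator {..y'} w * fejer e w)"
      unfolding K_def using iK by simp
    also have "\<dots> = (LINT w|lborel. indicator {y'<..y} w * fejer e w)"
      using that by (intro Bochner_Integration.integral_cong) (auto simp: indicator_def)
    finally have "complex_of_real (K y - K y') = (LINT w|lborel. complex_of_real (indicator {y'<..y} w * fejer e w))"
      by (simp only: integral_complex_of_real)
    also have "\<dots> = (LINT w|lborel. LINT t|lborel. of_real (indicator {y'<..y} w) * (of_real (tent e t) * cis (t * w)))"
      by (simp add: integral_tent_cis[OF e])
    also have "\<dots> = (LINT t|lborel. LINT w|lborel. of_real (indicator {y'<..y} w) * (of_real (tent e t) * cis (t * w)))"
    proof (rule lborel_pair.fubini_swap_bound)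
      show "integrable lborel (\<lambda>w. indicator {y'<..y} w :: real)"
        using that by (intro integrable_real_indicator) auto
      show "cmod (of_real (indicator {y'<..y} w) * (of_real (tent e t) * cis (t * w))) \<le> indicator {y'<..y} w * tent e t" for w t
        by (simp add: norm_mult)
    qed (use integrable_tent[OF e] in simp_all)
    also have "\<dots> = (LINT t|lborel. of_real (tent e t) * (LINT w|lborel. indicator {y'..y} w *\<^sub>R cis (t * w)))"
    proof (intro Bochner_Integration.integral_cong refl)
      fix t
      have "(LINT w|lborel. of_real (indicator {y'<..y} w) * (of_real (tent e t) * cis (t * w)))
          = (LINT w|lborel. of_real (tent e t) * (indicator {y'<..y} w *\<^sub>R cis (t * w)))"
        by (intro Bochner_Integration.integral_cong refl) (simp add: scaleR_conv_of_real)
      also have "\<dots> = of_real (tent e t) * (LINT w|lborel. indicator {y'<..y} w *\<^sub>R cis (t * w))"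
        by (rule integral_mult_right_zero)
      also have "(LINT w|lborel. indicator {y'<..y} w *\<^sub>R cis (t * w)) = (LINT w|lborel. indicator {y'..y} w *\<^sub>R cis (t * w))"
      proof (rule integral_cong_AE)
        show "AE w in lborel. indicator {y'<..y} w *\<^sub>R cis (t * w) = indicator {y'..y} w *\<^sub>R cis (t * w)"
          by (rule AE_mp[OF AE_lborel_singleton[of y']]) (auto simp: indicator_def)
      qed auto
      finally show "(LINT w|lborel. of_real (indicator {y'<..y} w) * (of_real (tent e t) * cis (t * w))) =
         of_real (tent e t) * (LINT w|lborel. indicator {y'..y} w *\<^sub>R cis (t * w))" .
    qed
    also have "\<dots> = (LINT t|lborel. of_real (tent e t) * cis_quot y y' t)"
    proof (rule integral_cong_AE)
      show "AE t in lborel. of_real (tent e t) * (LINT w|lborel. indicator {y'..y} w *\<^sub>R cis (t * w)) = of_real (tent e t) * cis_quot y y' t"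
      proof (rule AE_mp[OF AE_lborel_singleton[of 0]], intro AE_I2 impI)
        fix t :: real assume t: "t \<noteq> 0"
        have "(LINT w|lborel. indicator {y'..y} w *\<^sub>R cis (t * w)) = cis (t * y) / (\<i> * t) - cis (t * y') / (\<i> * t)"
        proof (rule integral_FTC_atLeastAtMost[OF that])
          show "((\<lambda>w. cis (t * w) / (\<i> * complex_of_real t)) has_vector_derivative cis (t * x)) (at x within {y'..y})" for x
            unfolding has_vector_derivative_def using t
            by (auto intro!: derivative_eq_intros simp: fun_eq_iff scaleR_conv_of_real field_simps)
        qed (auto intro!: continuous_intros)
        then show "of_real (tent e t) * (LINT w|lborel. indicator {y'..y} w *\<^sub>R cis (t * w)) = of_real (tent e t) * cis_quot y y' t"
          by (simp add: cis_quot_def diff_divide_distrib)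
      qed
    qed simp_all
    finally show ?thesis .
  qed
  have diff: "complex_of_real (K y) - complex_of_real (K y') = (LINT t|lborel. of_real (tent e t) * cis_quot y y' t * 1)" for y y'
  proof (cases "y' \<le> y")
    case True then show ?thesis using diff0 by simp
  next
    case False
    then have "complex_of_real (K y' - K y) = (LINT t|lborel. of_real (tent e t) * cis_quot y' y t)" by (intro diff0) auto
    moreover have "cis_quot y' y t = - cis_quot y y' t" for t by (simp add: cis_quot_def diff_divide_distrib)
    ultimately show ?thesis by (simp add: algebra_simps)
  qed
  have mono: "mono K"
    unfolding K_def
    by (intro monoI integral_mono iK) (auto simp: indicator_def fejer_nonneg e)
  have [measurable]: "K \<in> borel_measurable borel" by (rule borel_measurable_mono[OF mono])
  have top: "(K \<longlongrightarrow> fejer_mass) at_top"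
    unfolding K_def integral_fejer[OF e, symmetric]
  proof (rule integral_dominated_convergence_at_top[where w="fejer e"])
    show "AE x in lborel. ((\<lambda>z. indicator {..z} x * fejer e x) \<longlongrightarrow> fejer e x) at_top"
    proof (intro AE_I2 tendsto_eventually)
      fix x show "\<forall>\<^sub>F z in at_top. indicator {..z} x * fejer e x = fejer e x"
        using eventually_ge_at_top[of x] by eventually_elim simp
    qed
    show "\<forall>\<^sub>F i in at_top. AE x in lborel. norm (indicator {..i} x * fejer e x) \<le> fejer e x"
      by (intro always_eventually allI AE_I2) (auto simp: indicator_def fejer_nonneg e)
  qed (use integrable_fejer[OF e] in auto)
  have bot: "(K \<longlongrightarrow> 0) at_bot"
    unfolding filterlim_at_bot_mirror
  proof -
    have "((\<lambda>z. LINT w|lborel. indicator {..-z} w * fejer e w) \<longlongrightarrow> (LINT w|(lborel::real measure). 0)) at_top"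
    proof (rule integral_dominated_convergence_at_top[where w="fejer e"])
      show "AE x in lborel. ((\<lambda>z. indicator {..-z} x * fejer e x) \<longlongrightarrow> 0) at_top"
      proof (intro AE_I2 tendsto_eventually)
        fix x :: real show "\<forall>\<^sub>F z in at_top. indicator {..-z} x * fejer e x = 0"
          using eventually_gt_at_top[of "-x"] by eventually_elim (simp add: indicator_def)
      qed
      show "\<forall>\<^sub>F i in at_top. AE x in lborel. norm (indicator {..-i} x * fejer e x) \<le> fejer e x"
        by (intro always_eventually allI AE_I2) (auto simp: indicator_def fejer_nonneg e)
    qed (use integrable_fejer[OF e] in auto)
    then show "((\<lambda>x. K (- x)) \<longlongrightarrow> 0) at_top" by (simp add: K_def)
  qed
  have "bounded (range (\<lambda>z. complex_of_real (K z)))"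
    using Kb by (intro boundedI[of _ fejer_mass]) auto
  then have "smoothed_step e (\<lambda>z. of_real (K z)) (of_real fejer_mass) (\<lambda>_. 1)"
    unfolding smoothed_step_def using diff top bot
    by (auto simp: tendsto_of_real_iff intro: tendsto_of_real[of K 0 at_bot, simplified])
  then show ?thesis by (simp add: K_def)
qed

text \<open>Both limits pass under the integral since \<open>K\<close> is bounded and
  \<open>f\<close> is integrable. At plus infinity \<open>K (y - x)\<close> tends to
  \<open>l\<close> for each fixed \<open>x\<close>, so the limit picks up the integral of
  \<open>f\<close>.\<close>

lemma smoothed_step_convolve:
  assumes e: "e > 0" and K: "smoothed_step e K l m" and f: "integrable lborel f"
  shows "smoothed_step e (\<lambda>y. LINT x|lborel. f x * K (y - x)) (l * (LINT x|lborel. f x)) (\<lambda>t. m t * fourier_transform f t)"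
proof -
  have [measurable]: "f \<in> borel_measurable borel" using f by auto
  have [measurable]: "K \<in> borel_measurable borel" "m \<in> borel_measurable borel"
    using K by (auto simp: smoothed_step_def)
  obtain k where k: "\<And>z. cmod (K z) \<le> k" using K by (auto simp: smoothed_step_def bounded_iff)
  obtain M where M: "\<And>z. cmod (m z) \<le> M" using K by (auto simp: smoothed_step_def bounded_iff)
  have k0: "k \<ge> 0" using k[of 0] norm_ge_zero order_trans by blast
  have M0: "M \<ge> 0" using M[of 0] norm_ge_zero order_trans by blast
  define H where "H = (LINT x|lborel. cmod (f x))"
  have bd: "cmod (f x * K (g x)) \<le> k * cmod (f x)" for x g
    using k[of "g x"] by (simp add: norm_mult mult.commute[of k] mult_left_mono)
  have iK: "integrable lborel (\<lambda>x. f x * K (y - x))" for y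
  proof (rule Bochner_Integration.integrable_bound)
    show "integrable lborel (\<lambda>x. k * cmod (f x))" using f by simp
    show "AE x in lborel. norm (f x * K (y - x)) \<le> norm (k * cmod (f x))"
      using bd[of _ "\<lambda>x. y - x"] k0 by (auto simp: abs_mult)
  qed simp
  have "cmod (LINT x|lborel. f x * K (y - x)) \<le> k * H" for y
    unfolding H_def integral_mult_right_zero[symmetric]
    by (rule norm_integral_le_AE[OF iK]) (use f bd in auto)
  then have b1: "bounded (range (\<lambda>y. LINT x|lborel. f x * K (y - x)))"
    by (intro boundedI[of _ "k * H"]) auto
  have ff: "cmod (fourier_transform f t) \<le> H" for t
    unfolding fourier_transform_def H_def
  proof (rule norm_integral_le_AE)
    show "integrable lborel (\<lambda>x. f x * cis (- (t * x)))"
      using f by (rule Bochner_Integration.integrable_bound) (auto simp: norm_mult)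
  qed (use f in \<open>auto simp: norm_mult\<close>)
  have H0: "H \<ge> 0" by (simp add: H_def)
  have b2: "bounded (range (\<lambda>t. m t * fourier_transform f t))"
    by (intro boundedI[of _ "M * H"]) (auto simp: norm_mult intro!: mult_mono M ff M0 H0)
  have m1: "(\<lambda>y. LINT x|lborel. f x * K (y - x)) \<in> borel_measurable borel" by measurable
  have m2: "(\<lambda>t. m t * fourier_transform f t) \<in> borel_measurable borel"
    unfolding fourier_transform_def by measurable
  have top: "((\<lambda>y. LINT x|lborel. f x * K (y - x)) \<longlongrightarrow> l * (LINT x|lborel. f x)) at_top"
  proof -
    have "((\<lambda>y. LINT x|lborel. f x * K (y - x)) \<longlongrightarrow> (LINT x|lborel. f x * l)) at_top"
    proof (rule integral_dominated_convergence_at_top[where w="\<lambda>x. k * cmod (f x)"])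
      show "AE x in lborel. ((\<lambda>y. f x * K (y - x)) \<longlongrightarrow> f x * l) at_top"
      proof (intro AE_I2 tendsto_intros)
        fix x
        have "filterlim (\<lambda>y::real. y - x) at_top at_top" by real_asymp
        then show "((\<lambda>y. K (y - x)) \<longlongrightarrow> l) at_top"
          using K by (auto simp: smoothed_step_def intro: filterlim_compose)
      qed
      show "\<forall>\<^sub>F i in at_top. AE x in lborel. norm (f x * K (i - x)) \<le> k * cmod (f x)"
        by (intro always_eventually allI AE_I2 bd)
    qed (use f in auto)
    then show ?thesis by (simp add: mult.commute)
  qed
  have bot: "((\<lambda>y. LINT x|lborel. f x * K (y - x)) \<longlongrightarrow> 0) at_bot"
    unfolding filterlim_at_bot_mirror
  proof -
    have "((\<lambda>y. LINT x|lborel. f x * K (- y - x)) \<longlongrightarrow> (LINT x|(lborel::real measure). 0)) at_top"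
    proof (rule integral_dominated_convergence_at_top[where w="\<lambda>x. k * cmod (f x)"])
      show "AE x in lborel. ((\<lambda>y. f x * K (- y - x)) \<longlongrightarrow> 0) at_top"
      proof (intro AE_I2 tendsto_mult_right_zero)
        fix x :: real
        have "filterlim (\<lambda>y. - y - x) at_bot at_top" by real_asymp
        then show "((\<lambda>y. K (- y - x)) \<longlongrightarrow> 0) at_top"
          using K by (auto simp: smoothed_step_def intro: filterlim_compose)
      qed
      show "\<forall>\<^sub>F i in at_top. AE x in lborel. norm (f x * K (- i - x)) \<le> k * cmod (f x)"
        by (intro always_eventually allI AE_I2 bd)
    qed (use f in auto)
    then show "((\<lambda>y. LINT x|lborel. f x * K (- y - x)) \<longlongrightarrow> 0) at_top" by simp
  qed
  have diff: "(LINT x|lborel. f x * K (y - x)) - (LINT x|lborel. f x * K (y' - x)) =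
     (LINT t|lborel. of_real (tent e t) * cis_quot y y' t * (m t * fourier_transform f t))" for y y'
  proof -
    have "(LINT x|lborel. f x * K (y - x)) - (LINT x|lborel. f x * K (y' - x)) =
          (LINT x|lborel. f x * (K (y - x) - K (y' - x)))"
      using iK by (simp add: right_diff_distrib)
    also have "\<dots> = (LINT x|lborel. LINT t|lborel. f x * (of_real (tent e t) * (cis (- (t * x)) * cis_quot y y' t) * m t))"
      using K by (simp add: smoothed_step_def cis_quot_shift)
    also have "\<dots> = (LINT t|lborel. LINT x|lborel. f x * (of_real (tent e t) * (cis (- (t * x)) * cis_quot y y' t) * m t))"
    proof (rule lborel_pair.fubini_swap_bound)
      show "integrable lborel (\<lambda>x. cmod (f x))" using f by simp
      show "integrable lborel (\<lambda>t. tent e t * (\<bar>y - y'\<bar> * M))" using integrable_tent[OF e] by simp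
      show "cmod (f x * (of_real (tent e t) * (cis (- (t * x)) * cis_quot y y' t) * m t)) \<le> cmod (f x) * (tent e t * (\<bar>y - y'\<bar> * M))" for x t
        by (simp add: norm_mult mult.assoc) (intro mult_left_mono mult_mono M norm_cis_quot_le; simp)
    qed simp
    also have "\<dots> = (LINT t|lborel. of_real (tent e t) * cis_quot y y' t * (m t * fourier_transform f t))"
      unfolding fourier_transform_def integral_mult_right_zero[symmetric]
      by (simp add: mult_ac)
    finally show ?thesis .
  qed
  show ?thesis unfolding smoothed_step_def using b1 b2 m1 m2 top bot diff by blast
qed

text \<open>Exponential series of the operator of convolution with \<open>f\<close>. The
  \<open>n\<close>-th iterate is bounded by \<open>k * H ^ n\<close>, so the series converges
  uniformly and inherits the limits at both ends. Each iteration multiplies the limit by the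
  integral of \<open>f\<close> and the multiplier by \<open>fourier_transform f\<close>, so both
  factors get exponentiated.\<close>

lemma smoothed_step_exp:
  assumes e: "e > 0" and K: "smoothed_step e K l m" and f: "integrable lborel f"
  obtains K' where "smoothed_step e K' (l * exp (LINT x|lborel. f x)) (\<lambda>t. m t * exp (fourier_transform f t))"
proof -
  define \<kappa> where "\<kappa> = (\<lambda>n. ((\<lambda>K y. LINT x|lborel. f x * K (y - x)) ^^ n) K)"
  define H where "H = (LINT x|lborel. cmod (f x))"
  have H0: "H \<ge> 0" by (simp add: H_def)
  obtain k where k: "\<And>z. cmod (K z) \<le> k" using K by (auto simp: smoothed_step_def bounded_iff)
  obtain M where M: "\<And>z. cmod (m z) \<le> M" using K by (auto simp: smoothed_step_def bounded_iff)
  have k0: "k \<ge> 0" using k[of 0] norm_ge_zero order_trans by blast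
  have M0: "M \<ge> 0" using M[of 0] norm_ge_zero order_trans by blast
  have [measurable]: "f \<in> borel_measurable borel" using f by auto
  have st: "smoothed_step e (\<kappa> n) (l * (LINT x|lborel. f x) ^ n) (\<lambda>t. m t * fourier_transform f t ^ n)" for n
  proof (induction n)
    case (Suc n)
    from smoothed_step_convolve[OF e Suc f] show ?case by (simp add: \<kappa>_def mult_ac)
  qed (use K in \<open>simp add: \<kappa>_def\<close>)
  have meas [measurable]: "\<kappa> n \<in> borel_measurable borel" for n using st by (simp add: smoothed_step_def)
  have [measurable]: "m \<in> borel_measurable borel" using K by (simp add: smoothed_step_def)
  have \<kappa>b: "cmod (\<kappa> n y) \<le> k * H ^ n" for n y
  proof (induction n arbitrary: y)
    case (Suc n)
    have b: "cmod (f x * \<kappa> n (y - x)) \<le> (k * H ^ n) * cmod (f x)" for x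
      using Suc[of "y - x"] by (simp add: norm_mult mult.commute[of _ "cmod (f x)"] mult_left_mono)
    have "cmod (LINT x|lborel. f x * \<kappa> n (y - x)) \<le> (LINT x|lborel. (k * H ^ n) * cmod (f x))"
    proof (rule norm_integral_le_AE)
      show i: "integrable lborel (\<lambda>x. (k * H ^ n) * cmod (f x))" using f by simp
      show "integrable lborel (\<lambda>x. f x * \<kappa> n (y - x))"
        by (rule Bochner_Integration.integrable_bound[OF i]) (use b in \<open>auto intro: order.trans[OF _ abs_ge_self]\<close>)
    qed (use b in auto)
    then show ?case by (simp add: \<kappa>_def H_def mult_ac)
  qed (use k in \<open>simp add: \<kappa>_def\<close>)
  define b where "b = (\<lambda>n. k * (H ^ n /\<^sub>R fact n))"
  have sb: "summable b" unfolding b_def by (intro summable_mult summable_exp_generic)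
  have tb: "cmod (\<kappa> n y /\<^sub>R fact n) \<le> b n" for n y
    using \<kappa>b[of n y] by (simp add: b_def divide_inverse mult.commute[of _ "inverse _"] mult.left_commute[of _ "inverse _"] mult_left_mono)
  define K' where "K' = (\<lambda>y. \<Sum>n. \<kappa> n y /\<^sub>R fact n)"
  have ul: "uniform_limit UNIV (\<lambda>N y. \<Sum>n<N. \<kappa> n y /\<^sub>R fact n) K' sequentially"
    unfolding K'_def by (rule Weierstrass_m_test) (use tb sb in auto)
  have [measurable]: "K' \<in> borel_measurable borel" unfolding K'_def by measurable
  have sm: "summable (\<lambda>n. \<kappa> n y /\<^sub>R fact n)" for y
    by (rule summable_comparison_test'[OF sb, of 0]) (use tb in auto)
  have K'b: "cmod (K' y) \<le> suminf b" for y
    unfolding K'_def by (rule order.trans[OF summable_norm suminf_le]) (use tb sb in \<open>auto intro: summable_comparison_test'[OF sb, of 0]\<close>)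
  have lim: "(K' \<longlongrightarrow> suminf L) F" if L: "\<And>n. ((\<lambda>y. \<kappa> n y /\<^sub>R fact n) \<longlongrightarrow> L n) F" and sL: "summable L" for L and F :: "real filter"
  proof (rule swap_uniform_limit')
    show "\<forall>\<^sub>F N in sequentially. ((\<lambda>y. \<Sum>n<N. \<kappa> n y /\<^sub>R fact n) \<longlongrightarrow> (\<Sum>n<N. L n)) F"
      by (intro always_eventually allI tendsto_sum L)
    show "(\<lambda>N. \<Sum>n<N. L n) \<longlonglongrightarrow> suminf L" using sL by (rule summable_LIMSEQ)
  qed (use ul in auto)
  have top: "(K' \<longlongrightarrow> l * exp (LINT x|lborel. f x)) at_top"
  proof -
    have "(K' \<longlongrightarrow> (\<Sum>n. (l * (LINT x|lborel. f x) ^ n) /\<^sub>R fact n)) at_top"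
    proof (rule lim)
      show "((\<lambda>y. \<kappa> n y /\<^sub>R fact n) \<longlongrightarrow> (l * (LINT x|lborel. f x) ^ n) /\<^sub>R fact n) at_top" for n
        using st[of n] by (intro tendsto_intros) (simp add: smoothed_step_def)
      show "summable (\<lambda>n. (l * (LINT x|lborel. f x) ^ n) /\<^sub>R fact n)"
        using summable_mult[OF summable_exp_generic, of l] by (simp add: mult_scaleR_right)
    qed
    also have "(\<Sum>n. (l * (LINT x|lborel. f x) ^ n) /\<^sub>R fact n) = l * exp (LINT x|lborel. f x)"
      unfolding exp_def by (subst suminf_mult[symmetric]) (auto simp: summable_exp_generic)
    finally show ?thesis .
  qed
  have bot: "(K' \<longlongrightarrow> 0) at_bot"
  proof -
    have "(K' \<longlongrightarrow> (\<Sum>n::nat. 0)) at_bot"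
    proof (rule lim)
      show "((\<lambda>y. \<kappa> n y /\<^sub>R fact n) \<longlongrightarrow> 0) at_bot" for n
      proof -
        have "((\<lambda>y. \<kappa> n y /\<^sub>R fact n) \<longlongrightarrow> 0 /\<^sub>R fact n) at_bot"
          using st[of n] by (intro tendsto_intros) (simp add: smoothed_step_def)
        then show ?thesis by simp
      qed
    qed auto
    then show ?thesis by simp
  qed
  have ff: "cmod (fourier_transform f t) \<le> H" for t
    unfolding fourier_transform_def H_def
  proof (rule norm_integral_le_AE)
    show "integrable lborel (\<lambda>x. f x * cis (- (t * x)))"
      using f by (rule Bochner_Integration.integrable_bound) (auto simp: norm_mult)
  qed (use f in \<open>auto simp: norm_mult\<close>)
  have [measurable]: "fourier_transform f \<in> borel_measurable borel" unfolding fourier_transform_def by measurable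
  have mb: "cmod (m t * exp (fourier_transform f t)) \<le> M * exp H" for t
  proof -
    have "cmod (exp (fourier_transform f t)) \<le> exp H" using ff[of t] complex_Re_le_cmod[of "fourier_transform f t"] by simp
    then show ?thesis using M[of t] M0 by (simp add: norm_mult mult_mono)
  qed
  have diff: "K' y - K' y' = (LINT t|lborel. of_real (tent e t) * cis_quot y y' t * (m t * exp (fourier_transform f t)))" for y y'
  proof -
    \<comment> \<open>Partial sums of the exponential on the multiplier side; \<open>exp H\<close>
      dominates them, so the integral passes to the limit.\<close>
    define s where "s = (\<lambda>N t. of_real (tent e t) * (cis_quot y y' t * (m t * (\<Sum>n<N. fourier_transform f t ^ n /\<^sub>R fact n))))"
    have "(\<lambda>N. LINT t|lborel. s N t) \<longlonglongrightarrow> (LINT t|lborel. of_real (tent e t) * (cis_quot y y' t * (m t * exp (fourier_transform f t))))"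
    proof (rule integral_dominated_convergence[where w="\<lambda>t. tent e t * (\<bar>y - y'\<bar> * (M * exp H))"])
      show "integrable lborel (\<lambda>t. tent e t * (\<bar>y - y'\<bar> * (M * exp H)))" using integrable_tent[OF e] by simp
      show "AE t in lborel. (\<lambda>N. s N t) \<longlonglongrightarrow> of_real (tent e t) * (cis_quot y y' t * (m t * exp (fourier_transform f t)))"
        unfolding s_def by (intro AE_I2 tendsto_intros) (use exp_converges[of "fourier_transform f _"] in \<open>auto simp: sums_def\<close>)
      show "AE t in lborel. norm (s N t) \<le> tent e t * (\<bar>y - y'\<bar> * (M * exp H))" for N
      proof (intro AE_I2)
        fix t
        have "cmod (\<Sum>n<N. fourier_transform f t ^ n /\<^sub>R fact n) \<le> (\<Sum>n<N. H ^ n /\<^sub>R fact n)"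
          by (rule sum_norm_le) (auto simp: norm_power intro!: mult_left_mono power_mono ff)
        also have "\<dots> \<le> exp H" unfolding exp_def
          by (rule sum_le_suminf[OF summable_exp_generic]) (use H0 in auto)
        finally show "norm (s N t) \<le> tent e t * (\<bar>y - y'\<bar> * (M * exp H))"
          unfolding s_def norm_mult by (intro mult_mono norm_cis_quot_le M) (auto simp: M0 intro!: mult_nonneg_nonneg)
      qed
    qed (simp_all add: s_def)
    moreover have "(LINT t|lborel. s N t) = (\<Sum>n<N. \<kappa> n y /\<^sub>R fact n) - (\<Sum>n<N. \<kappa> n y' /\<^sub>R fact n)" for N
    proof -
      have i: "integrable lborel (\<lambda>t. of_real (tent e t) * (cis_quot y y' t * (m t * fourier_transform f t ^ n)))" for n
      proof (rule integrable_tent_mult[OF e])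
        show "cmod (cis_quot y y' t * (m t * fourier_transform f t ^ n)) \<le> \<bar>y - y'\<bar> * (M * H ^ n)" for t
          unfolding norm_mult norm_power by (intro mult_mono norm_cis_quot_le M power_mono ff) (auto simp: M0 H0)
      qed simp
      have "s N t = (\<Sum>n<N. (of_real (tent e t) * (cis_quot y y' t * (m t * fourier_transform f t ^ n))) /\<^sub>R fact n)" for t
        by (simp add: s_def sum_distrib_left)
      then have "(LINT t|lborel. s N t) = (\<Sum>n<N. (LINT t|lborel. of_real (tent e t) * (cis_quot y y' t * (m t * fourier_transform f t ^ n))) /\<^sub>R fact n)"
        using i by simp
      also have "\<dots> = (\<Sum>n<N. (\<kappa> n y - \<kappa> n y') /\<^sub>R fact n)"
      proof (intro sum.cong refl)
        fix n
        have "\<kappa> n y - \<kappa> n y' = (LINT t|lborel. of_real (tent e t) * cis_quot y y' t * (m t * fourier_transform f t ^ n))"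
          using st[of n] by (simp add: smoothed_step_def)
        then show "(LINT t|lborel. of_real (tent e t) * (cis_quot y y' t * (m t * fourier_transform f t ^ n))) /\<^sub>R fact n = (\<kappa> n y - \<kappa> n y') /\<^sub>R fact n"
          by (simp add: mult.assoc)
      qed
      finally show ?thesis by (simp add: scaleR_diff_right sum_subtractf)
    qed
    moreover have "(\<lambda>N. (\<Sum>n<N. \<kappa> n y /\<^sub>R fact n) - (\<Sum>n<N. \<kappa> n y' /\<^sub>R fact n)) \<longlonglongrightarrow> K' y - K' y'"
      unfolding K'_def by (intro tendsto_diff summable_LIMSEQ sm)
    ultimately show ?thesis using LIMSEQ_unique by (simp add: mult.assoc)
  qed
  have "smoothed_step e K' (l * exp (LINT x|lborel. f x)) (\<lambda>t. m t * exp (fourier_transform f t))"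
    unfolding smoothed_step_def
  proof (intro conjI allI diff top bot)
    show "bounded (range K')" by (rule boundedI) (use K'b in auto)
    show "bounded (range (\<lambda>t. m t * exp (fourier_transform f t)))" by (rule boundedI) (use mb in auto)
  qed measurable
  then show ?thesis by (rule that)
qed

section \<open>A Tauberian theorem\<close>

definition laplace_line :: "(real \<Rightarrow> real) \<Rightarrow> real \<Rightarrow> real \<Rightarrow> complex" where
  "laplace_line B \<delta> t = (LINT u|lborel. of_real (exp (- (\<delta> * u)) * B u) * cis (- (t * u)))"

lemma measurable_laplace_line [measurable]:
  assumes [measurable]: "B \<in> borel_measurable borel"
  shows "laplace_line B \<delta> \<in> borel_measurable borel"
  unfolding laplace_line_def by measurable

text \<open>Used with \<open>a = 0\<close> for the exponential density, whose transform is
  \<open>1 / Complex 1 t\<close>, and with \<open>a = ln (val M)\<close> for the contribution of one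
  generalized integer to the Laplace transform of the counting function.\<close>

lemma exp_integral_atLeast:
  fixes s :: complex
  assumes s: "Re s > 0"
  shows "integrable lborel (\<lambda>u. indicator {a..} u *\<^sub>R exp (- s * of_real u))"
    and "(LINT u|lborel. indicator {a..} u *\<^sub>R exp (- s * of_real u)) = exp (- s * of_real a) / s"
proof -
  have s0: "s \<noteq> 0" using s by auto
  have "((\<lambda>u. exp (- Re s * u)) has_integral exp (- Re s * a) / Re s) {a..}"
    by (rule has_integral_exp_minus_to_infinity[OF s])
  then have "(\<lambda>u. exp (- Re s * u)) absolutely_integrable_on {a..}"
    by (intro nonnegative_absolutely_integrable_1) (auto simp: integrable_on_def)
  then have "integrable lebesgue (\<lambda>u. indicator {a..} u * exp (- Re s * u))"
    by (simp add: set_integrable_def)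
  then have w: "integrable lborel (\<lambda>u. indicator {a..} u * exp (- Re s * u))"
    by (subst (asm) integrable_completion) auto
  have m [measurable]: "(\<lambda>u. exp (- s * complex_of_real u)) \<in> borel_measurable borel"
    by (intro borel_measurable_continuous_onI continuous_intros)
  show "integrable lborel (\<lambda>u. indicator {a..} u *\<^sub>R exp (- s * of_real u))"
    by (rule Bochner_Integration.integrable_bound[OF w]) (auto simp: indicator_def)
  have "((\<lambda>b. LINT u|lborel. indicator {a..b} u *\<^sub>R exp (- s * of_real u)) \<longlongrightarrow> (LINT u|lborel. indicator {a..} u *\<^sub>R exp (- s * of_real u))) at_top"
  proof (rule integral_dominated_convergence_at_top[OF _ _ w])
    show "\<forall>\<^sub>F b in at_top. AE u in lborel. norm (indicator {a..b} u *\<^sub>R exp (- s * of_real u)) \<le> indicator {a..} u * exp (- Re s * u)"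
      by (intro always_eventually allI AE_I2) (auto simp: indicator_def)
    show "AE u in lborel. ((\<lambda>b. indicator {a..b} u *\<^sub>R exp (- s * of_real u)) \<longlongrightarrow> indicator {a..} u *\<^sub>R exp (- s * of_real u)) at_top"
    proof (intro AE_I2 tendsto_eventually)
      fix u show "\<forall>\<^sub>F b in at_top. indicator {a..b} u *\<^sub>R exp (- s * complex_of_real u) = indicator {a..} u *\<^sub>R exp (- s * of_real u)"
        using eventually_ge_at_top[of u] by eventually_elim (auto simp: indicator_def)
    qed
  qed measurable
  moreover have "((\<lambda>b. LINT u|lborel. indicator {a..b} u *\<^sub>R exp (- s * of_real u)) \<longlongrightarrow> exp (- s * of_real a) / s) at_top"
  proof (rule Lim_transform_eventually)
    have "((\<lambda>b. - exp (- s * of_real b) / s + exp (- s * of_real a) / s) \<longlongrightarrow> 0 + exp (- s * of_real a) / s) at_top"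
    proof (intro tendsto_add tendsto_const)
      have "((\<lambda>b. exp (- Re s * b)) \<longlongrightarrow> 0) at_top" using s by real_asymp
      then have "((\<lambda>b. cmod (- exp (- s * of_real b))) \<longlongrightarrow> 0) at_top" by simp
      then have "((\<lambda>b. - exp (- s * of_real b)) \<longlongrightarrow> 0) at_top" by (rule tendsto_norm_zero_cancel)
      then show "((\<lambda>b. - exp (- s * of_real b) / s) \<longlongrightarrow> 0) at_top"
        using tendsto_divide_zero by blast
    qed
    then show "((\<lambda>b. - exp (- s * of_real b) / s + exp (- s * of_real a) / s) \<longlongrightarrow> exp (- s * of_real a) / s) at_top" by simp
    show "\<forall>\<^sub>F b in at_top. - exp (- s * of_real b) / s + exp (- s * of_real a) / s = (LINT u|lborel. indicator {a..b} u *\<^sub>R exp (- s * of_real u))"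
      using eventually_ge_at_top[of a]
    proof eventually_elim
      case (elim b)
      have "(LINT u|lborel. indicator {a..b} u *\<^sub>R exp (- s * of_real u)) = - exp (- s * of_real b) / s - (- exp (- s * of_real a) / s)"
      proof (rule integral_FTC_atLeastAtMost[OF elim])
        show "((\<lambda>u. - exp (- s * complex_of_real u) / s) has_vector_derivative exp (- s * of_real x)) (at x within {a..b})" for x
          by (rule has_vector_derivative_real_field[where f="\<lambda>z. - exp (- s * z) / s"])
             (use s0 in \<open>auto intro!: derivative_eq_intros\<close>)
      qed (auto intro!: continuous_intros)
      then show ?case by simp
    qed
  qed
  ultimately show "(LINT u|lborel. indicator {a..} u *\<^sub>R exp (- s * of_real u)) = exp (- s * of_real a) / s"
    by (rule tendsto_unique[rotated]) simp
qed

text \<open>Dyadic scale: for \<open>2 ^ n \<le> 1 + u < 2 ^ (n + 1)\<close> the weight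
  \<open>(1/4) ^ n\<close> is comparable to \<open>1 / (1 + u\<^sup>2)\<close>, and the exponential
  is at least \<open>exp (- 2)\<close>.\<close>

lemma inverse_square_le_sum_exp:
  fixes u :: real
  assumes "u \<ge> 0"
  shows "\<exists>n::nat. 1 / (1 + u\<^sup>2) \<le> 2 * exp 2 * ((1/4) ^ n * exp (- ((1/2) ^ n * u)))"
proof -
  define n where "n = nat \<lfloor>log 2 (1 + u)\<rfloor>"
  have l0: "log 2 (1 + u) \<ge> 0" using assms by simp
  have n1: "real n \<le> log 2 (1 + u)" and n2: "log 2 (1 + u) < real n + 1" using l0 by (auto simp: n_def)
  have "2 powr real n \<le> 1 + u" using n1 assms by (simp add: le_log_iff)
  then have a: "2 ^ n \<le> 1 + u" by (simp add: powr_realpow)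
  have "1 + u < 2 powr (real n + 1)" using n2 assms by (simp add: log_less_iff)
  then have b: "1 + u < 2 * 2 ^ n" by (simp add: powr_add powr_realpow)
  have "(4::real) ^ n = (2 ^ n)\<^sup>2" by (simp add: power2_eq_square flip: power_mult_distrib)
  also have "\<dots> \<le> (1 + u)\<^sup>2" using a by (intro power_mono) auto
  also have "\<dots> \<le> 2 * (1 + u\<^sup>2)" using sum_squares_bound[of 1 u] by (simp add: power2_sum)
  finally have c: "1 / (1 + u\<^sup>2) \<le> 2 * (1/4) ^ n"
    by (simp add: power_divide field_simps add_pos_nonneg)
  have "(1/2) ^ n * u \<le> 2" using b by (simp add: power_divide field_simps)
  then have "1 \<le> exp 2 * exp (- ((1/2) ^ n * u))" by (simp flip: exp_add)
  then have "2 * (1/4) ^ n * 1 \<le> 2 * (1/4) ^ n * (exp 2 * exp (- ((1/2) ^ n * u)))" by (intro mult_left_mono) auto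
  then have "2 * (1/4) ^ n \<le> 2 * exp 2 * ((1/4) ^ n * exp (- ((1/2) ^ n * u)))" by (simp only: mult_1_right mult_ac)
  with c show ?thesis by (intro exI[of _ n]) linarith
qed

text \<open>Summing the hypothesis over \<open>\<delta> = (1/2) ^ n\<close> with weights
  \<open>(1/4) ^ n\<close> gives terms of size at most a multiple of \<open>C * (1/2) ^ n\<close>,
  while the weighted exponentials together dominate \<open>1 / (1 + u\<^sup>2)\<close>.\<close>

lemma integrable_over_square:
  fixes B :: "real \<Rightarrow> real"
  assumes [measurable]: "B \<in> borel_measurable borel" and B0: "\<And>u. B u \<ge> 0" and Bneg: "\<And>u. u < 0 \<Longrightarrow> B u = 0"
    and Bint: "\<And>\<delta>. \<delta> > 0 \<Longrightarrow> integrable lborel (\<lambda>u. exp (- (\<delta> * u)) * B u)"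
    and C: "\<And>\<delta>. 0 < \<delta> \<Longrightarrow> \<delta> \<le> 1 \<Longrightarrow> \<delta> * (LINT u|lborel. exp (- (\<delta> * u)) * B u) \<le> C"
  shows "integrable lborel (\<lambda>u. B u / (1 + u\<^sup>2))"
proof (rule integrableI_bounded)
  define c where "c = 2 * exp (2::real)"
  have c0: "c \<ge> 0" by (simp add: c_def)
  have "(\<integral>\<^sup>+u. ennreal (norm (B u / (1 + u\<^sup>2))) \<partial>lborel) \<le>
        (\<integral>\<^sup>+u. (\<Sum>n. ennreal (c * ((1/4) ^ n * exp (- ((1/2) ^ n * u)) * B u))) \<partial>lborel)"
  proof (rule nn_integral_mono)
    fix u :: real
    show "ennreal (norm (B u / (1 + u\<^sup>2))) \<le> (\<Sum>n. ennreal (c * ((1/4) ^ n * exp (- ((1/2) ^ n * u)) * B u)))"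
    proof (cases "u < 0")
      case False
      then obtain n where n: "1 / (1 + u\<^sup>2) \<le> c * ((1/4) ^ n * exp (- ((1/2) ^ n * u)))"
        using inverse_square_le_sum_exp[of u] by (auto simp: c_def)
      have "norm (B u / (1 + u\<^sup>2)) = 1 / (1 + u\<^sup>2) * B u" using B0[of u] by (simp add: add_nonneg_nonneg)
      also have "\<dots> \<le> c * ((1/4) ^ n * exp (- ((1/2) ^ n * u)) * B u)"
        using mult_right_mono[OF n B0[of u]] by (simp add: mult_ac)
      finally have "ennreal (norm (B u / (1 + u\<^sup>2))) \<le> ennreal (c * ((1/4) ^ n * exp (- ((1/2) ^ n * u)) * B u))"
        by (rule ennreal_leI)
      also have "\<dots> \<le> (\<Sum>n. ennreal (c * ((1/4) ^ n * exp (- ((1/2) ^ n * u)) * B u)))"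
        using sum_le_suminf[of "\<lambda>n. ennreal (c * ((1/4) ^ n * exp (- ((1/2) ^ n * u)) * B u))" "{n}"] by simp
      finally show ?thesis .
    qed (simp add: Bneg)
  qed
  also have "\<dots> = (\<Sum>n. \<integral>\<^sup>+u. ennreal (c * ((1/4) ^ n * exp (- ((1/2) ^ n * u)) * B u)) \<partial>lborel)"
    by (rule nn_integral_suminf) measurable
  also have "\<dots> \<le> (\<Sum>n. ennreal (c * C * (1/2) ^ n))"
  proof (rule suminf_le)
    fix n :: nat
    define d where "d = (1/2::real) ^ n"
    have d: "0 < d" "d \<le> 1" by (auto simp: d_def power_le_one)
    have dd: "(1/4) ^ n = d * d" by (simp add: d_def flip: power_mult_distrib)
    have i: "integrable lborel (\<lambda>u. c * (d * d * exp (- (d * u)) * B u))"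
      using Bint[OF d(1)] by (simp add: mult.assoc)
    have "(\<integral>\<^sup>+u. ennreal (c * (d * d * exp (- (d * u)) * B u)) \<partial>lborel) = ennreal (LINT u|lborel. c * (d * d * exp (- (d * u)) * B u))"
      by (rule nn_integral_eq_integral[OF i]) (use c0 B0 in auto)
    also have "(LINT u|lborel. c * (d * d * exp (- (d * u)) * B u)) = c * (d * (d * (LINT u|lborel. exp (- (d * u)) * B u)))"
      by (simp add: mult.assoc)
    also have "\<dots> \<le> c * (d * C)" using C[OF d] d c0 by (intro mult_left_mono) auto
    finally show "(\<integral>\<^sup>+u. ennreal (c * ((1/4) ^ n * exp (- ((1/2) ^ n * u)) * B u)) \<partial>lborel) \<le> ennreal (c * C * (1/2) ^ n)"
      unfolding dd by (simp add: d_def mult_ac ennreal_leI)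
  qed auto
  also have "\<dots> < \<infinity>"
  proof -
    have "0 \<le> 1 * (LINT u|lborel. exp (- (1 * u)) * B u)" using B0 by (auto intro!: Bochner_Integration.integral_nonneg)
    with C[of 1] have "C \<ge> 0" by simp
    then have "(\<Sum>n. ennreal (c * C * (1/2) ^ n)) = ennreal (\<Sum>n. c * C * (1/2) ^ n)"
      using c0 by (intro suminf_ennreal2 summable_mult summable_geometric) auto
    then show ?thesis by simp
  qed
  finally show "(\<integral>\<^sup>+u. ennreal (norm (B u / (1 + u\<^sup>2))) \<partial>lborel) < \<infinity>" .
qed simp

text \<open>Peetre's inequality: moving the centre of \<open>1 / (1 + u\<^sup>2)\<close> costs a
  factor that depends on \<open>y\<close> alone. The proof writes the difference as a sum of
  squares.\<close>

lemma fejer_shift_le: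
  assumes L: "L > 0"
  shows "fejer L (u - y) \<le> ((L + 4 / L) * (2 * (1 + y\<^sup>2))) * (1 / (1 + u\<^sup>2))"
proof -
  have "1 + u\<^sup>2 \<le> 2 * (1 + y\<^sup>2) * (1 + (u - y)\<^sup>2)"
  proof -
    have "0 \<le> (u - 2 * y)\<^sup>2 + 2 * y\<^sup>2 * (u - y)\<^sup>2 + 1" by simp
    moreover have "2 * (1 + y\<^sup>2) * (1 + (u - y)\<^sup>2) - (1 + u\<^sup>2) = (u - 2 * y)\<^sup>2 + 2 * y\<^sup>2 * (u - y)\<^sup>2 + 1"
      by (simp add: power2_eq_square algebra_simps)
    ultimately show ?thesis by linarith
  qed
  then have "1 / (1 + (u - y)\<^sup>2) \<le> 2 * (1 + y\<^sup>2) / (1 + u\<^sup>2)"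
    by (simp add: field_simps add_pos_nonneg)
  then have "(L + 4 / L) * (1 / (1 + (u - y)\<^sup>2)) \<le> (L + 4 / L) * (2 * (1 + y\<^sup>2) / (1 + u\<^sup>2))"
    using L by (intro mult_left_mono) auto
  with fejer_le[OF L, of "u - y"] show ?thesis by simp
qed

text \<open>Parseval's formula for the pair \<open>tent L\<close> and \<open>fejer L\<close>; the
  damping \<open>exp (- (\<delta> * u))\<close> provides the absolute convergence for exchanging the
  integrals.\<close>

lemma laplace_line_fejer:
  fixes B :: "real \<Rightarrow> real"
  assumes L: "L > 0" and [measurable]: "B \<in> borel_measurable borel"
    and Bint: "integrable lborel (\<lambda>u. exp (- (\<delta> * u)) * B u)"
  shows "(LINT t|lborel. of_real (tent L t) * laplace_line B \<delta> t * cis (t * y)) =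
         of_real (LINT u|lborel. exp (- (\<delta> * u)) * B u * fejer L (u - y))"
proof -
  have "(LINT t|lborel. of_real (tent L t) * laplace_line B \<delta> t * cis (t * y)) =
     (LINT t|lborel. LINT u|lborel. of_real (exp (- (\<delta> * u)) * B u) * (of_real (tent L t) * cis (t * (y - u))))"
  proof (rule Bochner_Integration.integral_cong[OF refl])
    fix t
    have "of_real (tent L t) * laplace_line B \<delta> t * cis (t * y) =
      (LINT u|lborel. (of_real (tent L t) * cis (t * y)) * (of_real (exp (- (\<delta> * u)) * B u) * cis (- (t * u))))"
      by (simp only: integral_mult_right_zero laplace_line_def mult_ac)
    also have "\<dots> = (LINT u|lborel. of_real (exp (- (\<delta> * u)) * B u) * (of_real (tent L t) * cis (t * (y - u))))"
      by (intro Bochner_Integration.integral_cong refl) (simp add: right_diff_distrib cis_divide[symmetric] divide_inverse)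
    finally show "of_real (tent L t) * laplace_line B \<delta> t * cis (t * y) = \<dots>" .
  qed
  also have "\<dots> = (LINT u|lborel. LINT t|lborel. of_real (exp (- (\<delta> * u)) * B u) * (of_real (tent L t) * cis (t * (y - u))))"
  proof (rule lborel_pair.fubini_swap_bound)
    show "integrable lborel (tent L)" by (rule integrable_tent[OF L])
    show "integrable lborel (\<lambda>u. \<bar>exp (- (\<delta> * u)) * B u\<bar>)" using Bint by simp
    show "cmod (of_real (exp (- (\<delta> * u)) * B u) * (of_real (tent L t) * cis (t * (y - u)))) \<le> tent L t * \<bar>exp (- (\<delta> * u)) * B u\<bar>" for t u
      by (simp add: norm_mult abs_mult)
  qed simp
  also have "\<dots> = (LINT u|lborel. of_real (exp (- (\<delta> * u)) * B u * fejer L (u - y)))"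
  proof (rule Bochner_Integration.integral_cong[OF refl])
    fix u
    have "fejer L (y - u) = fejer L (u - y)" using fejer_minus[of L "u - y"] by simp
    then show "(LINT t|lborel. of_real (exp (- (\<delta> * u)) * B u) * (of_real (tent L t) * cis (t * (y - u)))) = complex_of_real (exp (- (\<delta> * u)) * B u * fejer L (u - y))"
      by (simp add: integral_tent_cis[OF L])
  qed
  finally show ?thesis by (simp only: integral_complex_of_real)
qed

text \<open>A concrete sequence inside (0, 1): the bounds on the Laplace transform are stated for
  \<open>\<delta> < 1\<close>, and dominated convergence is applied along sequences.\<close>

definition approach_seq :: "nat \<Rightarrow> real" where "approach_seq n = 1 / real (n + 2)"

lemma approach_seq: "0 < approach_seq n" "approach_seq n < 1" "approach_seq \<longlonglongrightarrow> 0"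
  unfolding approach_seq_def by (simp, simp, real_asymp)

section \<open>Fejer convolutions of a function with bounded Abel means\<close>

context
  fixes B :: "real \<Rightarrow> real" and C :: real
  assumes Bm [measurable]: "B \<in> borel_measurable borel" and B0: "\<And>u. B u \<ge> 0" and Bneg: "\<And>u. u < 0 \<Longrightarrow> B u = 0"
    and Bint: "\<And>\<delta>. \<delta> > 0 \<Longrightarrow> integrable lborel (\<lambda>u. exp (- (\<delta> * u)) * B u)"
    and C: "\<And>\<delta>. 0 < \<delta> \<Longrightarrow> \<delta> \<le> 1 \<Longrightarrow> \<delta> * (LINT u|lborel. exp (- (\<delta> * u)) * B u) \<le> C"
begin

lemma integrable_fejer_conv: "L > 0 \<Longrightarrow> integrable lborel (\<lambda>u. B u * fejer L (u - y))"
proof (rule Bochner_Integration.integrable_bound)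
  assume L: "L > 0"
  show "integrable lborel (\<lambda>u. ((L + 4 / L) * (2 * (1 + y\<^sup>2))) * (B u / (1 + u\<^sup>2)))"
    by (intro integrable_mult_right integrable_over_square[OF Bm B0 Bneg Bint C]) auto
  show "AE u in lborel. norm (B u * fejer L (u - y)) \<le> norm (((L + 4 / L) * (2 * (1 + y\<^sup>2))) * (B u / (1 + u\<^sup>2)))"
  proof (intro AE_I2)
    fix u
    have "norm (B u * fejer L (u - y)) = B u * fejer L (u - y)" using B0 fejer_nonneg[OF L] by simp
    also have "\<dots> \<le> B u * (((L + 4 / L) * (2 * (1 + y\<^sup>2))) * (1 / (1 + u\<^sup>2)))"
      by (intro mult_left_mono fejer_shift_le L B0)
    also have "\<dots> = ((L + 4 / L) * (2 * (1 + y\<^sup>2))) * (B u / (1 + u\<^sup>2))" by simp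
    also have "\<dots> \<le> norm \<dots>" by (simp only: real_norm_def abs_ge_self)
    finally show "norm (B u * fejer L (u - y)) \<le> norm (((L + 4 / L) * (2 * (1 + y\<^sup>2))) * (B u / (1 + u\<^sup>2)))" .
  qed
qed simp

text \<open>The kernel moves away from the half-line that carries \<open>B\<close>. In
  \<open>fejer_conv_near_zero\<close> this settles the additive constant that differences leave
  open.\<close>

lemma fejer_conv_at_bot:
  assumes L: "L > 0"
  shows "((\<lambda>y. LINT u|lborel. B u * fejer L (u - y)) \<longlongrightarrow> 0) at_bot"
  unfolding filterlim_at_bot_mirror
proof -
  have "((\<lambda>y. LINT u|lborel. B u * fejer L (u - (- y))) \<longlongrightarrow> (LINT u|(lborel::real measure). 0)) at_top"
  proof (rule integral_dominated_convergence_at_top[where w="\<lambda>u. (L + 4 / L) * (B u / (1 + u\<^sup>2))"])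
    show "integrable lborel (\<lambda>u. (L + 4 / L) * (B u / (1 + u\<^sup>2)))"
      by (intro integrable_mult_right integrable_over_square[OF Bm B0 Bneg Bint C]) auto
    show "\<forall>\<^sub>F y in at_top. AE u in lborel. norm (B u * fejer L (u - (- y))) \<le> (L + 4 / L) * (B u / (1 + u\<^sup>2))"
      using eventually_ge_at_top[of 0]
    proof eventually_elim
      case (elim y)
      show ?case
      proof (intro AE_I2)
        fix u
        show "norm (B u * fejer L (u - (- y))) \<le> (L + 4 / L) * (B u / (1 + u\<^sup>2))"
        proof (cases "u < 0")
          case False
          have "fejer L (u + y) \<le> (L + 4 / L) / (1 + (u + y)\<^sup>2)" by (rule fejer_le[OF L])
          also have "\<dots> \<le> (L + 4 / L) / (1 + u\<^sup>2)"
            using False elim L by (intro divide_left_mono) (auto intro!: power_mono mult_pos_pos add_pos_nonneg)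
          finally have "B u * fejer L (u + y) \<le> B u * ((L + 4 / L) / (1 + u\<^sup>2))" by (intro mult_left_mono B0)
          then show ?thesis using B0[of u] fejer_nonneg[OF L, of "u + y"] by (simp add: abs_mult mult.commute)
        qed (simp add: Bneg)
      qed
    qed
    show "AE u in lborel. ((\<lambda>y. B u * fejer L (u - (- y))) \<longlongrightarrow> 0) at_top"
    proof (intro AE_I2 tendsto_mult_right_zero)
      fix u :: real
      show "((\<lambda>y. fejer L (u - (- y))) \<longlongrightarrow> 0) at_top"
      proof (rule tendsto_sandwich[OF _ _ tendsto_const])
        show "((\<lambda>y. (L + 4 / L) / (1 + (u - (- y))\<^sup>2)) \<longlongrightarrow> 0) at_top" by real_asymp
      qed (use fejer_le[OF L] fejer_nonneg[OF L] in auto)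
    qed
  qed auto
  then show "((\<lambda>y. LINT u|lborel. B u * fejer L (u - (- y))) \<longlongrightarrow> 0) at_top" by simp
qed

text \<open>The damping factor is at most 1 wherever \<open>B\<close> is nonzero, so the undamped
  integrand is the majorant.\<close>

lemma tent_laplace_tendsto:
  assumes L: "L > 0"
  shows "(\<lambda>n. LINT t|lborel. of_real (tent L t) * laplace_line B (approach_seq n) t * cis (t * y))
     \<longlonglongrightarrow> complex_of_real (LINT u|lborel. B u * fejer L (u - y))"
proof -
  have "(\<lambda>n. LINT u|lborel. exp (- (approach_seq n * u)) * B u * fejer L (u - y)) \<longlonglongrightarrow> (LINT u|lborel. B u * fejer L (u - y))"
  proof (rule integral_dominated_convergence[where w="\<lambda>u. B u * fejer L (u - y)"])
    show "integrable lborel (\<lambda>u. B u * fejer L (u - y))" by (rule integrable_fejer_conv[OF L])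
    show "AE u in lborel. (\<lambda>n. exp (- (approach_seq n * u)) * B u * fejer L (u - y)) \<longlonglongrightarrow> B u * fejer L (u - y)"
      by (intro AE_I2) (auto intro!: tendsto_eq_intros approach_seq)
    show "AE u in lborel. norm (exp (- (approach_seq n * u)) * B u * fejer L (u - y)) \<le> B u * fejer L (u - y)" for n
    proof (intro AE_I2)
      fix u
      have "exp (- (approach_seq n * u)) * (B u * fejer L (u - y)) \<le> 1 * (B u * fejer L (u - y))" if "u \<ge> 0"
        using that approach_seq(1)[of n] B0[of u] fejer_nonneg[OF L, of "u - y"] by (intro mult_right_mono) auto
      then show "norm (exp (- (approach_seq n * u)) * B u * fejer L (u - y)) \<le> B u * fejer L (u - y)"
        using B0[of u] fejer_nonneg[OF L, of "u - y"] Bneg[of u] by (cases "u < 0") (auto simp: abs_mult mult.assoc)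
    qed
  qed auto
  then show ?thesis
    using laplace_line_fejer[OF L Bm Bint] approach_seq(1) by (simp add: tendsto_of_real_iff)
qed

lemma integrable_tent_laplace:
  assumes L: "L > 0" and d: "\<delta> > 0"
  shows "integrable lborel (\<lambda>t. of_real (tent L t) * laplace_line B \<delta> t * cis (t * y))"
proof -
  have "integrable lborel (\<lambda>t. of_real (tent L t) * (laplace_line B \<delta> t * cis (t * y)))"
  proof (rule integrable_tent_mult[OF L])
    show "cmod (laplace_line B \<delta> t * cis (t * y)) \<le> (LINT u|lborel. exp (- (\<delta> * u)) * B u)" for t
      unfolding norm_mult norm_cis mult_1_right laplace_line_def
    proof (rule norm_integral_le_AE)
      show "integrable lborel (\<lambda>u. of_real (exp (- (\<delta> * u)) * B u) * cis (- (t * u)))"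
        using Bint[OF d] by (rule Bochner_Integration.integrable_bound) (auto simp: norm_mult)
    qed (use Bint[OF d] B0 in \<open>auto simp: norm_mult\<close>)
  qed simp
  then show ?thesis by (simp add: mult.assoc)
qed

text \<open>The hypothesis \<open>dom\<close> controls the Laplace transform only after
  multiplication by \<open>\<bar>t\<bar>\<close>; the missing factor is supplied by
  \<open>tent_diff_1\<close> for the two tents.\<close>

lemma fejer_conv_diff_tendsto:
  assumes L: "L > 0" and e: "e > 0"
    and h: "integrable lborel h"
    and dom: "\<And>\<delta>. 0 < \<delta> \<Longrightarrow> \<delta> < 1 \<Longrightarrow> AE t in lborel. \<bar>t\<bar> \<le> max L e \<longrightarrow> \<bar>t\<bar> * cmod (laplace_line B \<delta> t) \<le> h t"
  shows "((\<lambda>y. (LINT u|lborel. B u * fejer L (u - y)) - (LINT u|lborel. B u * fejer e (u - y))) \<longlongrightarrow> 0) at_top"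
proof -
  define g where "g = (\<lambda>n t. complex_of_real (tent L t - tent e t) * laplace_line B (approach_seq n) t)"
  have "((\<lambda>y. complex_of_real ((LINT u|lborel. B u * fejer L (u - y)) - (LINT u|lborel. B u * fejer e (u - y)))) \<longlongrightarrow> 0) at_top"
  proof (rule dominated_riemann_lebesgue[where g=g and T="max L e" and h="\<lambda>t. (1 / L + 1 / e) * \<bar>h t\<bar>"])
    show "integrable lborel (\<lambda>t. (1 / L + 1 / e) * \<bar>h t\<bar>)" using h by simp
    show "AE t in lborel. cmod (g n t) \<le> (1 / L + 1 / e) * \<bar>h t\<bar>" for n
      using dom[OF approach_seq(1)[of n] approach_seq(2)]
    proof eventually_elim
      case (elim t)
      show ?case
      proof (cases "\<bar>t\<bar> \<le> max L e")
        case True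
        have "\<bar>tent L t - tent e t\<bar> \<le> \<bar>t\<bar> / L + \<bar>t\<bar> / e"
          using tent_diff_1[OF L, of t] tent_diff_1[OF e, of t] by linarith
        also have "\<dots> = (1 / L + 1 / e) * \<bar>t\<bar>" by (simp add: distrib_right)
        finally have "cmod (g n t) \<le> (1 / L + 1 / e) * \<bar>t\<bar> * cmod (laplace_line B (approach_seq n) t)"
          unfolding g_def norm_mult norm_of_real by (intro mult_right_mono) auto
        also have "\<dots> \<le> (1 / L + 1 / e) * \<bar>h t\<bar>"
          unfolding mult.assoc using L e elim True by (intro mult_left_mono) auto
        finally show ?thesis .
      qed (use L e in \<open>simp add: g_def tent_eq_0\<close>)
    qed
    show "g n t = 0" if "\<bar>t\<bar> > max L e" for n t using that L e by (simp add: g_def tent_eq_0)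
    show "(\<lambda>n. LINT t|lborel. g n t * cis (t * y)) \<longlonglongrightarrow> complex_of_real ((LINT u|lborel. B u * fejer L (u - y)) - (LINT u|lborel. B u * fejer e (u - y)))" for y
    proof -
      have "(LINT t|lborel. g n t * cis (t * y)) = (LINT t|lborel. of_real (tent L t) * laplace_line B (approach_seq n) t * cis (t * y))
          - (LINT t|lborel. of_real (tent e t) * laplace_line B (approach_seq n) t * cis (t * y))" for n
        using integrable_tent_laplace[OF L approach_seq(1)] integrable_tent_laplace[OF e approach_seq(1)]
        by (simp add: g_def left_diff_distrib)
      then show ?thesis
        using tendsto_diff[OF tent_laplace_tendsto[OF L, of y] tent_laplace_tendsto[OF e, of y]] by simp
    qed
  qed (use L in \<open>auto simp: g_def\<close>)
  then show ?thesis by (subst (asm) tendsto_of_real_iff[where c=0, simplified]) 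
qed

text \<open>In a difference of two values, \<open>cis (t * y) - cis (t * y')\<close> divided by
  \<open>Complex \<delta> t\<close> tends to \<open>cis_quot\<close>, while
  \<open>Complex \<delta> t * laplace_line B \<delta> t\<close> stays bounded and converges. So the
  convolution has the differences of a \<open>smoothed_step\<close>, and both functions vanish at
  minus infinity, hence agree.\<close>

lemma fejer_conv_near_zero:
  assumes e: "e > 0" and f: "integrable lborel f"
    and bd: "\<And>\<delta> t. 0 < \<delta> \<Longrightarrow> \<delta> < 1 \<Longrightarrow> \<bar>t\<bar> \<le> e \<Longrightarrow> cmod (Complex \<delta> t * laplace_line B \<delta> t) \<le> C'"
    and lim: "\<And>t. \<bar>t\<bar> \<le> e \<Longrightarrow> (\<lambda>n. Complex (approach_seq n) t * laplace_line B (approach_seq n) t)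
                 \<longlonglongrightarrow> exp (fourier_transform f t) / Complex 1 t"
  shows "((\<lambda>y. complex_of_real (LINT u|lborel. B u * fejer e (u - y))) \<longlongrightarrow> of_real fejer_mass * exp (LINT x|lborel. f x)) at_top"
proof -
  define I where "I = (\<lambda>y. LINT u|lborel. B u * fejer e (u - y))"
  \<comment> \<open>The factor \<open>1 / Complex 1 t\<close> stems from the division by
    \<open>s\<close> in \<open>\<zeta> s / s\<close>. It is the transform of the exponential
    density, whose mass 1 leaves the limit unchanged.\<close>
  define \<theta> where "\<theta> = (\<lambda>v. indicator {0..} v *\<^sub>R exp (- (1::complex) * of_real v))"
  have i\<theta>: "integrable lborel \<theta>" and \<theta>1: "(LINT v|lborel. \<theta> v) = 1"
    unfolding \<theta>_def using exp_integral_atLeast[of 1 0] by auto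
  have f\<theta>: "fourier_transform \<theta> t = 1 / Complex 1 t" for t
  proof -
    have "fourier_transform \<theta> t = (LINT x|lborel. indicator {0..} x *\<^sub>R exp (- Complex 1 t * of_real x))"
      unfolding fourier_transform_def \<theta>_def
      by (intro Bochner_Integration.integral_cong refl)
         (simp add: cis_conv_exp complex_eq_iff[of "Complex 1 t"] Complex_eq algebra_simps flip: exp_add)
    then show ?thesis using exp_integral_atLeast(2)[of "Complex 1 t" 0] by simp
  qed
  obtain K where "smoothed_step e K (of_real fejer_mass * (LINT v|lborel. \<theta> v) * exp (LINT x|lborel. f x))
     (\<lambda>t. 1 * fourier_transform \<theta> t * exp (fourier_transform f t))"
    using smoothed_step_exp[OF e smoothed_step_convolve[OF e smoothed_step_base[OF e] i\<theta>] f] by blast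
  then have K: "(K \<longlongrightarrow> 0) at_bot" "(K \<longlongrightarrow> of_real fejer_mass * exp (LINT x|lborel. f x)) at_top"
    and Kd: "\<And>y y'. K y - K y' = (LINT t|lborel. of_real (tent e t) * cis_quot y y' t * (exp (fourier_transform f t) / Complex 1 t))"
    by (auto simp: smoothed_step_def \<theta>1 f\<theta>)
  have [measurable]: "f \<in> borel_measurable borel" using f by auto
  have [measurable]: "(\<lambda>t. Complex c t) \<in> borel_measurable borel" for c
    unfolding Complex_eq by measurable
  have diff: "complex_of_real (I y) - complex_of_real (I y') = K y - K y'" for y y'
  proof -
    have "(\<lambda>n. LINT t|lborel. of_real (tent e t) * (cis (t * y) - cis (t * y')) * laplace_line B (approach_seq n) t)
       \<longlonglongrightarrow> (LINT t|lborel. of_real (tent e t) * cis_quot y y' t * (exp (fourier_transform f t) / Complex 1 t))"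
    proof (rule integral_dominated_convergence[where w="\<lambda>t. tent e t * (\<bar>y - y'\<bar> * C')"])
      show "integrable lborel (\<lambda>t. tent e t * (\<bar>y - y'\<bar> * C'))" using integrable_tent[OF e] by simp
      show "AE t in lborel. (\<lambda>n. of_real (tent e t) * (cis (t * y) - cis (t * y')) * laplace_line B (approach_seq n) t)
         \<longlonglongrightarrow> of_real (tent e t) * cis_quot y y' t * (exp (fourier_transform f t) / Complex 1 t)"
      proof (rule AE_mp[OF AE_lborel_singleton[of 0]], intro AE_I2 impI)
        fix t :: real assume t: "t \<noteq> 0"
        show "(\<lambda>n. of_real (tent e t) * (cis (t * y) - cis (t * y')) * laplace_line B (approach_seq n) t)
         \<longlonglongrightarrow> of_real (tent e t) * cis_quot y y' t * (exp (fourier_transform f t) / Complex 1 t)"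
        proof (cases "\<bar>t\<bar> \<le> e")
          case True
          have "(\<lambda>n. Complex (approach_seq n) t) \<longlonglongrightarrow> Complex 0 t" by (intro tendsto_Complex approach_seq tendsto_const)
          moreover have "Complex 0 t \<noteq> 0" using t by (simp add: complex_eq_iff)
          ultimately have "(\<lambda>n. of_real (tent e t) * ((cis (t * y) - cis (t * y')) / Complex (approach_seq n) t) *
              (Complex (approach_seq n) t * laplace_line B (approach_seq n) t))
              \<longlonglongrightarrow> of_real (tent e t) * ((cis (t * y) - cis (t * y')) / Complex 0 t) * (exp (fourier_transform f t) / Complex 1 t)"
            by (intro tendsto_mult tendsto_divide tendsto_const lim True)
          moreover have "Complex 0 t = \<i> * of_real t" by (simp add: complex_eq_iff)
          moreover have "Complex (approach_seq n) t \<noteq> 0" for n using t by (simp add: complex_eq_iff)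
          ultimately show ?thesis by (simp add: cis_quot_def mult.assoc)
        qed (use e in \<open>simp add: tent_eq_0\<close>)
      qed
      show "AE t in lborel. norm (of_real (tent e t) * (cis (t * y) - cis (t * y')) * laplace_line B (approach_seq n) t) \<le> tent e t * (\<bar>y - y'\<bar> * C')" for n
      proof (intro AE_I2)
        fix t
        show "norm (of_real (tent e t) * (cis (t * y) - cis (t * y')) * laplace_line B (approach_seq n) t) \<le> tent e t * (\<bar>y - y'\<bar> * C')"
        proof (cases "\<bar>t\<bar> \<le> e")
          case True
          have "cmod (cis (t * y) - cis (t * y')) \<le> \<bar>t * y - t * y'\<bar>" by (rule norm_cis_diff_le)
          also have "\<dots> = \<bar>y - y'\<bar> * \<bar>t\<bar>" by (simp add: abs_mult mult.commute flip: right_diff_distrib)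
          also have "\<dots> \<le> \<bar>y - y'\<bar> * cmod (Complex (approach_seq n) t)"
            using abs_Im_le_cmod[of "Complex (approach_seq n) t"] by (intro mult_left_mono) auto
          finally have "cmod (cis (t * y) - cis (t * y')) * cmod (laplace_line B (approach_seq n) t) \<le>
             \<bar>y - y'\<bar> * cmod (Complex (approach_seq n) t * laplace_line B (approach_seq n) t)"
            unfolding norm_mult mult.assoc[symmetric] by (intro mult_right_mono) auto
          also have "\<dots> \<le> \<bar>y - y'\<bar> * C'" using approach_seq True by (intro mult_left_mono bd) auto
          finally show ?thesis unfolding norm_mult mult.assoc by (simp add: mult_left_mono)
        qed (use e in \<open>simp add: tent_eq_0\<close>)
      qed
    qed (unfold fourier_transform_def, measurable)
    moreover have "(LINT t|lborel. of_real (tent e t) * (cis (t * y) - cis (t * y')) * laplace_line B (approach_seq n) t) =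
       (LINT t|lborel. of_real (tent e t) * laplace_line B (approach_seq n) t * cis (t * y)) - (LINT t|lborel. of_real (tent e t) * laplace_line B (approach_seq n) t * cis (t * y'))" for n
      by (subst Bochner_Integration.integral_diff[symmetric, OF integrable_tent_laplace[OF e approach_seq(1)] integrable_tent_laplace[OF e approach_seq(1)]])
         (simp add: algebra_simps)
    moreover have "(\<lambda>n. (LINT t|lborel. of_real (tent e t) * laplace_line B (approach_seq n) t * cis (t * y)) - (LINT t|lborel. of_real (tent e t) * laplace_line B (approach_seq n) t * cis (t * y')))
       \<longlonglongrightarrow> complex_of_real (I y) - complex_of_real (I y')"
      unfolding I_def by (intro tendsto_diff tent_laplace_tendsto[OF e])
    ultimately show ?thesis using Kd LIMSEQ_unique by auto
  qed
  have eq: "complex_of_real (I y) = K y" for y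
  proof -
    have "((\<lambda>y'. complex_of_real (I y) - complex_of_real (I y')) \<longlongrightarrow> complex_of_real (I y) - of_real 0) at_bot"
      using fejer_conv_at_bot[OF e] unfolding I_def by (intro tendsto_diff tendsto_const tendsto_of_real)
    moreover have "((\<lambda>y'. K y - K y') \<longlongrightarrow> K y - 0) at_bot" by (intro tendsto_diff tendsto_const K)
    ultimately have "complex_of_real (I y) - of_real 0 = K y - 0"
      unfolding diff by (intro tendsto_unique[of at_bot]) auto
    then show ?thesis by simp
  qed
  show ?thesis using K(2) unfolding eq[symmetric] I_def .
qed

end

text \<open>By \<open>mono\<close>, moving to the right by at most \<open>2 * h\<close> can shrink
  \<open>B\<close> by no more than the factor \<open>exp (- (2 * h))\<close>. A Fejer kernel with
  large \<open>L\<close> has nearly all of its mass on an interval of that length. So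
  \<open>h\<close> is fixed first, close to 0, and \<open>L\<close> afterwards.\<close>

lemma tauberian_fejer:
  fixes B :: "real \<Rightarrow> real"
  assumes B0: "\<And>u. B u \<ge> 0" and Bneg: "\<And>u. u < 0 \<Longrightarrow> B u = 0" and mono: "\<And>u v. u \<le> v \<Longrightarrow> exp u * B u \<le> exp v * B v"
    and int: "\<And>L y. L > 0 \<Longrightarrow> integrable lborel (\<lambda>u. B u * fejer L (u - y))"
    and lim: "\<And>L. L > 0 \<Longrightarrow> ((\<lambda>y. LINT u|lborel. B u * fejer L (u - y)) \<longlongrightarrow> fejer_mass * a) at_top"
  shows "(B \<longlongrightarrow> a) at_top"
proof -
  let ?c = fejer_mass
  note c0 = fejer_mass_pos
  have a0: "a \<ge> 0"
  proof -
    have "0 \<le> ?c * a"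
      by (rule tendsto_lowerbound[OF lim[of 1]]) (auto intro!: always_eventually Bochner_Integration.integral_nonneg mult_nonneg_nonneg B0 fejer_nonneg)
    then show ?thesis using c0 by (simp add: zero_le_mult_iff)
  qed
  define P where "P = (\<lambda>L h. LINT x|lborel. indicator {-h..h} x * fejer L x)"
  have Plim: "((\<lambda>L. P L h) \<longlongrightarrow> ?c) at_top" if "h > 0" for h
  proof -
    have "((\<lambda>L. LINT x|lborel. indicator {-(L*h)..L*h} x * fejer 1 x) \<longlongrightarrow> (LINT x|lborel. fejer 1 x)) at_top"
    proof (rule integral_dominated_convergence_at_top[where w="fejer 1"])
      show "AE x in lborel. ((\<lambda>L. indicator {-(L*h)..L*h} x * fejer 1 x) \<longlongrightarrow> fejer 1 x) at_top"
      proof (intro AE_I2 tendsto_eventually)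
        fix x show "\<forall>\<^sub>F L in at_top. indicator {-(L*h)..L*h} x * fejer 1 x = fejer 1 x"
          using eventually_ge_at_top[of "\<bar>x\<bar> / h"]
        proof eventually_elim
          case (elim L)
          then have "\<bar>x\<bar> \<le> L * h" using that by (simp add: field_simps)
          then show ?case by (simp add: abs_le_iff indicator_def)
        qed
      qed
      show "\<forall>\<^sub>F L in at_top. AE x in lborel. norm (indicator {-(L*h)..L*h} x * fejer 1 x) \<le> fejer 1 x"
        by (intro always_eventually allI AE_I2) (auto simp: indicator_def fejer_nonneg)
    qed (use integrable_fejer[of 1] in auto)
    moreover have "\<forall>\<^sub>F L in at_top. (LINT x|lborel. indicator {-(L*h)..L*h} x * fejer 1 x) = P L h"
      using eventually_gt_at_top[of 0]
    proof eventually_elim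
      case (elim L)
      have "(LINT x|lborel. indicator {-(L*h)..L*h} x * fejer 1 x) = \<bar>L\<bar> *\<^sub>R (LINT x|lborel. indicator {-(L*h)..L*h} (0 + L * x) * fejer 1 (0 + L * x))"
        using elim by (intro lborel_integral_real_affine) simp
      also have "\<dots> = (LINT x|lborel. L * (indicator {-(L*h)..L*h} (L * x) * fejer 1 (L * x)))" using elim by simp
      also have "\<dots> = P L h"
        unfolding P_def
      proof (rule Bochner_Integration.integral_cong[OF refl])
        fix x
        have "L * x \<in> {-(L*h)..L*h} \<longleftrightarrow> x \<in> {-h..h}"
          using mult_le_cancel_left_pos[OF elim, of "-h" x] mult_le_cancel_left_pos[OF elim, of x h] by simp
        then show "L * (indicator {-(L*h)..L*h} (L * x) * fejer 1 (L * x)) = indicator {-h..h} x * fejer L x"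
          using elim by (simp add: fejer_scale[of L] indicator_def)
      qed
      finally show ?case .
    qed
    ultimately show ?thesis unfolding fejer_mass_def by (rule Lim_transform_eventually)
  qed
  have iP: "integrable lborel (\<lambda>x. indicator {-h..h} x * fejer L x)" if "L > 0" for L h
    by (rule Bochner_Integration.integrable_bound[OF integrable_fejer[OF that]]) (auto simp: indicator_def)
  have trans: "(LINT u|lborel. indicator {-h..h} (u - z) * fejer L (u - z)) = P L h" for L h z
    using lborel_integral_real_affine[of 1 "\<lambda>u. indicator {-h..h} (u - z) * fejer L (u - z)" z] by (simp add: P_def)
  have transm: "(LINT u|lborel. fejer L (u - z)) = ?c" if "L > 0" for L z
    using lborel_integral_real_affine[of 1 "\<lambda>u. fejer L (u - z)" z] integral_fejer[OF that] by simp
  have ish: "integrable lborel (\<lambda>u. fejer L (u - z))" if "L > 0" for L z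
    using lborel_integrable_real_affine[of "fejer L" 1 "-z"] integrable_fejer[OF that] by simp
  have ishP: "integrable lborel (\<lambda>u. indicator {-h..h} (u - z) * fejer L (u - z))" if "L > 0" for L h z
    by (rule Bochner_Integration.integrable_bound[OF ish[OF that, of z]]) (auto simp: indicator_def)
  \<comment> \<open>Centred at \<open>y + h\<close>, the kernel sees \<open>B\<close> on
    \<open>[y, y + 2 * h]\<close>, where it is at least \<open>exp (- (2 * h)) * B y\<close>; the
    rest is dropped by positivity.\<close>
  have upper: "B y * exp (- (2 * h)) * P L h \<le> (LINT u|lborel. B u * fejer L (u - (y + h)))" if L: "L > 0" and h: "h > 0" for y L h
  proof -
    have "B y * exp (- (2 * h)) * P L h = (LINT u|lborel. B y * exp (- (2 * h)) * (indicator {-h..h} (u - (y + h)) * fejer L (u - (y + h))))"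
      by (simp add: trans)
    also have "\<dots> \<le> (LINT u|lborel. B u * fejer L (u - (y + h)))"
    proof (rule integral_mono)
      show "integrable lborel (\<lambda>u. B y * exp (- (2 * h)) * (indicator {-h..h} (u - (y + h)) * fejer L (u - (y + h))))"
        by (intro integrable_mult_right ishP L)
      show "integrable lborel (\<lambda>u. B u * fejer L (u - (y + h)))" by (rule int[OF L])
      fix u
      show "B y * exp (- (2 * h)) * (indicator {-h..h} (u - (y + h)) * fejer L (u - (y + h))) \<le> B u * fejer L (u - (y + h))"
      proof (cases "u - (y + h) \<in> {-h..h}")
        case True
        then have u: "y \<le> u" "u \<le> y + 2 * h" by auto
        have "B y * exp (- (2 * h)) \<le> B y * exp (y - u)" using u by (intro mult_left_mono B0) auto
        also have "\<dots> \<le> B u" using mono[OF u(1)] by (simp add: exp_diff field_simps)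
        finally show ?thesis using True fejer_nonneg[OF L] by (simp add: mult_right_mono)
      qed (auto intro!: mult_nonneg_nonneg B0 fejer_nonneg L)
    qed
    finally show ?thesis .
  qed
  have shift: "((\<lambda>y. LINT u|lborel. B u * fejer L (u - (y + h))) \<longlongrightarrow> ?c * a) at_top" if "L > 0" for L h
  proof (rule filterlim_compose[OF lim[OF that]])
    show "filterlim (\<lambda>y. y + h) at_top at_top" by real_asymp
  qed
  have up: "\<forall>\<^sub>F y in at_top. B y < a + r" if r: "r > 0" for r
  proof -
    have "((\<lambda>h. exp (2 * h) * a) \<longlongrightarrow> exp (2 * 0) * a) (at_right 0)" by (intro tendsto_intros)
    then have "\<forall>\<^sub>F h in at_right 0. exp (2 * h) * a < a + r" using r by (intro order_tendstoD) auto
    then obtain h where h: "h > 0" "exp (2 * h) * a < a + r"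
      by (metis (mono_tags, lifting) eventually_at_right_less eventually_conj eventually_happens trivial_limit_at_right_real)
    have "((\<lambda>L. exp (- (2 * h)) * P L h * (a + r)) \<longlongrightarrow> exp (- (2 * h)) * ?c * (a + r)) at_top"
      by (intro tendsto_intros Plim h)
    moreover have "?c * a < exp (- (2 * h)) * ?c * (a + r)"
    proof -
      have "?c * a = ?c * exp (- (2 * h)) * (exp (2 * h) * a)" by (simp flip: exp_add)
      also have "\<dots> < ?c * exp (- (2 * h)) * (a + r)" using h(2) c0 by (intro mult_strict_left_mono) auto
      finally show ?thesis by (simp add: mult_ac)
    qed
    ultimately have "\<forall>\<^sub>F L in at_top. ?c * a < exp (- (2 * h)) * P L h * (a + r)" by (rule order_tendstoD)
    then obtain L where L: "L > 0" "?c * a < exp (- (2 * h)) * P L h * (a + r)"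
      by (metis (mono_tags, lifting) eventually_gt_at_top eventually_conj eventually_happens trivial_limit_at_top_linorder)
    have PL: "P L h \<ge> 0" unfolding P_def by (intro Bochner_Integration.integral_nonneg) (auto intro!: mult_nonneg_nonneg fejer_nonneg L)
    from order_tendstoD(2)[OF shift[OF L(1), of h] L(2)] show ?thesis
    proof eventually_elim
      case (elim y)
      have "B y * (exp (- (2 * h)) * P L h) < (a + r) * (exp (- (2 * h)) * P L h)"
        using elim upper[OF L(1) h(1), of y] by (simp add: mult_ac)
      then show ?case using PL by (simp add: mult_less_cancel_right)
    qed
  qed
  have lo: "\<forall>\<^sub>F y in at_top. B y > a - r" if r: "r > 0" for r
  proof -
    \<comment> \<open>In the lower estimate the tails of the kernel cannot be dropped, so a global
      bound on \<open>B\<close> comes first: the upper estimate with \<open>r = 1\<close> beyond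
      \<open>y0\<close>, and monotonicity before it.\<close>
    from up[of 1] obtain y0 where y0: "\<And>y. y \<ge> y0 \<Longrightarrow> B y < a + 1" by (auto simp: eventually_at_top_linorder)
    define M where "M = (a + 1) * exp \<bar>y0\<bar>"
    have BM: "B u \<le> M" for u
    proof -
      consider "u < 0" | "u \<ge> y0" | "0 \<le> u" "u \<le> y0" by linarith
      then show ?thesis
      proof cases
        case 1 then show ?thesis using a0 by (simp add: Bneg M_def)
      next
        case 2
        have "B u \<le> (a + 1) * 1" using y0[OF 2] by simp
        also have "\<dots> \<le> M" unfolding M_def using a0 by (intro mult_left_mono) auto
        finally show ?thesis .
      next
        case 3
        have "B u \<le> exp (y0 - u) * B y0" using mono[OF 3(2)] by (simp add: exp_diff field_simps)
        also have "\<dots> \<le> exp \<bar>y0\<bar> * (a + 1)" using y0[of y0] 3 B0[of y0] by (intro mult_mono) auto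
        finally show ?thesis by (simp add: M_def mult.commute)
      qed
    qed
    have M0: "M \<ge> 0" using BM[of 0] B0[of 0] by linarith
    \<comment> \<open>The centre \<open>y - h\<close> is written \<open>y + - h\<close> so that
      \<open>shift\<close> applies with a negative displacement. Outside the window \<open>B\<close>
      is replaced by \<open>M\<close>, and the kernel has mass \<open>?c - P L h\<close>
      there.\<close>
    have lower: "(LINT u|lborel. B u * fejer L (u - (y + - h))) \<le> B y * exp (2 * h) * ?c + M * (?c - P L h)" if L: "L > 0" and h: "h > 0" for y L h
    proof -
      have "(LINT u|lborel. B u * fejer L (u - (y + - h))) \<le> (LINT u|lborel. B y * exp (2 * h) * fejer L (u - (y + - h)) +
          M * (fejer L (u - (y + - h)) - indicator {-h..h} (u - (y + - h)) * fejer L (u - (y + - h))))"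
      proof (rule integral_mono)
        show "integrable lborel (\<lambda>u. B y * exp (2 * h) * fejer L (u - (y + - h)) +
          M * (fejer L (u - (y + - h)) - indicator {-h..h} (u - (y + - h)) * fejer L (u - (y + - h))))"
          by (intro Bochner_Integration.integrable_add Bochner_Integration.integrable_diff integrable_mult_right ish ishP L)
        show "integrable lborel (\<lambda>u. B u * fejer L (u - (y + - h)))" by (rule int[OF L])
        fix u
        have fj: "0 \<le> fejer L (u - (y + - h))" by (rule fejer_nonneg[OF L])
        show "B u * fejer L (u - (y + - h)) \<le> B y * exp (2 * h) * fejer L (u - (y + - h)) +
          M * (fejer L (u - (y + - h)) - indicator {-h..h} (u - (y + - h)) * fejer L (u - (y + - h)))"
        proof (cases "u - (y + - h) \<in> {-h..h}")
          case True
          then have u: "u \<le> y" "y - u \<le> 2 * h" by auto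
          have "B u \<le> B y * exp (y - u)" using mono[OF u(1)] by (simp add: exp_diff field_simps)
          also have "\<dots> \<le> B y * exp (2 * h)" using u by (intro mult_left_mono B0) auto
          finally show ?thesis using True fj by (simp add: mult_right_mono)
        next
          case False
          have "B u * fejer L (u - (y + - h)) \<le> M * fejer L (u - (y + - h))" by (intro mult_right_mono BM fj)
          moreover have "0 \<le> B y * exp (2 * h) * fejer L (u - (y + - h))" by (intro mult_nonneg_nonneg B0 fj) auto
          moreover have "indicator {-h..h} (u - (y + - h)) = (0::real)" using False unfolding indicator_def by (simp only: of_bool_eq)
          ultimately show ?thesis by (simp only: mult_zero_left diff_zero)
        qed
      qed
      also have "\<dots> = B y * exp (2 * h) * ?c + M * (?c - P L h)"
        using ish[OF L, of "y + - h"] ishP[OF L, of h "y + - h"] transm[OF L, of "y + - h"] trans[of h "y + - h" L]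
        by (subst Bochner_Integration.integral_add) (auto simp del: minus_add_distrib add_uminus_conv_diff)
      finally show ?thesis .
    qed
    have "((\<lambda>h. exp (2 * h) * (a - r)) \<longlongrightarrow> exp (2 * 0) * (a - r)) (at_right 0)" by (intro tendsto_intros)
    then have "\<forall>\<^sub>F h in at_right 0. exp (2 * h) * (a - r) < a" using r by (intro order_tendstoD) auto
    then obtain h where h: "h > 0" "exp (2 * h) * (a - r) < a"
      by (metis (mono_tags, lifting) eventually_at_right_less eventually_conj eventually_happens trivial_limit_at_right_real)
    have "((\<lambda>L. (a - r) * exp (2 * h) * ?c + M * (?c - P L h)) \<longlongrightarrow> (a - r) * exp (2 * h) * ?c + M * (?c - ?c)) at_top"
      by (intro tendsto_intros Plim h)
    moreover have "(a - r) * exp (2 * h) * ?c + M * (?c - ?c) < ?c * a"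
      using mult_strict_left_mono[OF h(2) c0] by (simp add: mult_ac)
    ultimately have "\<forall>\<^sub>F L in at_top. (a - r) * exp (2 * h) * ?c + M * (?c - P L h) < ?c * a" by (rule order_tendstoD)
    then obtain L where L: "L > 0" "(a - r) * exp (2 * h) * ?c + M * (?c - P L h) < ?c * a"
      by (metis (mono_tags, lifting) eventually_gt_at_top eventually_conj eventually_happens trivial_limit_at_top_linorder)
    from order_tendstoD(1)[OF shift[OF L(1), of "- h"] L(2)] show ?thesis
    proof eventually_elim
      case (elim y)
      have "(a - r) * (exp (2 * h) * ?c) < B y * (exp (2 * h) * ?c)"
        using elim lower[OF L(1) h(1), of y] by (simp add: mult_ac)
      then show ?case using c0 by (simp add: mult_less_cancel_right)
    qed
  qed
  show ?thesis
  proof (rule order_tendstoI)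
    fix b assume "b < a" then show "\<forall>\<^sub>F y in at_top. b < B y" using lo[of "a - b"] by simp
  next
    fix b assume "a < b" then show "\<forall>\<^sub>F y in at_top. B y < b" using up[of "b - a"] by simp
  qed
qed

section \<open>Mollifiers with nonnegative Fourier transform\<close>

text \<open>The standard bump, with parameters that make the family closed under differentiation:
  \<open>P\<close> collects the numerators, \<open>k\<close> the powers of the denominator, and
  \<open>w\<close> is a fixed frequency.\<close>

definition smooth_bump :: "complex poly \<Rightarrow> nat \<Rightarrow> real \<Rightarrow> real \<Rightarrow> complex" where
  "smooth_bump P k w x = (if \<bar>x\<bar> < 1
     then poly P (of_real x) * cis (w * x) * of_real (exp (- 1 / (1 - x\<^sup>2)) / (1 - x\<^sup>2) ^ k) else 0)"

text \<open>A single term, of index \<open>k + 2\<close>, of the exponential series at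
  \<open>1 / y\<close>. The two spare powers of \<open>y\<close> give vanishing to second order,
  hence derivative 0, at the ends of the support.\<close>

lemma exp_minus_inverse_le:
  assumes "(y::real) > 0"
  shows "exp (- 1 / y) / y ^ k \<le> fact (k + 2) * y\<^sup>2"
proof -
  have "(1 / y) ^ (k + 2) /\<^sub>R fact (k + 2) \<le> exp (1 / y)"
    unfolding exp_def using sum_le_suminf[OF summable_exp_generic[of "1 / y"], of "{k + 2}"] assms by simp
  then have "1 \<le> fact (k + 2) * y ^ (k + 2) * exp (1 / y)"
    using assms by (simp add: power_divide divide_simps del: power_Suc fact_Suc) (simp add: mult_ac)
  also have "\<dots> = (fact (k + 2) * y\<^sup>2) * y ^ k * exp (1 / y)" by (simp add: power_add power2_eq_square mult_ac)
  finally have "exp (- 1 / y) \<le> (fact (k + 2) * y\<^sup>2) * y ^ k" by (simp add: exp_minus divide_simps mult_ac)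
  then show ?thesis using assms by (simp add: divide_simps)
qed

lemma has_vector_derivative_zero_quadratic:
  fixes f :: "real \<Rightarrow> 'a::real_normed_vector"
  assumes "\<And>y. norm (f y) \<le> K * (y - x)\<^sup>2"
  shows "(f has_vector_derivative 0) (at x)"
proof -
  have fx: "f x = 0" using assms[of x] by simp
  show ?thesis unfolding has_vector_derivative_def
  proof (rule has_derivativeI_sandwich[of 1])
    show "((\<lambda>y. K * \<bar>y - x\<bar>) \<longlongrightarrow> 0) (at x)" by (auto intro!: tendsto_eq_intros)
    fix y assume "y \<noteq> x"
    have "norm (f y) \<le> K * (\<bar>y - x\<bar> * \<bar>y - x\<bar>)" using assms[of y] by (simp add: power2_eq_square)
    then show "norm ((f y - f x) - (y - x) *\<^sub>R 0) / norm (y - x) \<le> K * \<bar>y - x\<bar>"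
      using \<open>y \<noteq> x\<close> fx by (simp add: pos_divide_le_eq mult.assoc)
  qed (auto intro: bounded_linear_zero)
qed

text \<open>The polynomial is read off from the product and quotient rules with
  \<open>y = 1 - x\<^sup>2\<close>, encoded as \<open>[:1, 0, -1:]\<close>, over the common
  denominator \<open>y ^ (k + 2)\<close>: the exponential contributes the term with
  \<open>- 2 * x\<close>, the denominator the one with \<open>2 * k * x * y\<close>, and
  \<open>P\<close> with the character the one with \<open>y\<^sup>2\<close>.\<close>

lemma smooth_bump_deriv:
  "(smooth_bump P k w has_vector_derivative
     smooth_bump ((pderiv P + smult (\<i> * of_real w) P) * [:1, 0, -1:]\<^sup>2 + smult (2 * of_nat k) ([:0, 1:] * [:1, 0, -1:] * P) - smult 2 ([:0, 1:] * P)) (k + 2) w x) (at x)"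
  (is "(_ has_vector_derivative smooth_bump ?Q _ _ _) _")
proof -
  consider "\<bar>x\<bar> < 1" | "\<bar>x\<bar> > 1" | "\<bar>x\<bar> = 1" by linarith
  then show ?thesis
  proof cases
    case 1
    define y where "y = 1 - x\<^sup>2"
    have y: "y > 0" using 1 by (simp add: y_def abs_square_less_1)
    have dP: "((\<lambda>x. poly P (complex_of_real x)) has_vector_derivative poly (pderiv P) (of_real x)) (at x)"
      by (rule has_vector_derivative_real_field) (rule poly_DERIV)
    have dc: "((\<lambda>x. cis (w * x)) has_vector_derivative (\<i> * of_real w * cis (w * x))) (at x)"
      unfolding has_vector_derivative_def
      by (auto intro!: derivative_eq_intros simp: fun_eq_iff scaleR_conv_of_real mult_ac)
    have "((\<lambda>x. exp (- 1 / (1 - x\<^sup>2)) / (1 - x\<^sup>2) ^ k) has_real_derivative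
        (exp (- 1 / y) * (2 * real k * x * y - 2 * x) / y ^ (k + 2))) (at x)"
    proof -
      have "((\<lambda>x. exp (- 1 / (1 - x\<^sup>2)) / (1 - x\<^sup>2) ^ k) has_real_derivative
        (exp (- 1 / y) * (- (2 * x) / y\<^sup>2) * y ^ k - exp (- 1 / y) * (real k * (y ^ (k - 1) * (- (2 * x))))) / (y ^ k * y ^ k)) (at x)"
        using y unfolding y_def
        by (auto intro!: derivative_eq_intros simp: power2_eq_square)
      also have "(exp (- 1 / y) * (- (2 * x) / y\<^sup>2) * y ^ k - exp (- 1 / y) * (real k * (y ^ (k - 1) * (- (2 * x))))) / (y ^ k * y ^ k)
          = exp (- 1 / y) * (2 * real k * x * y - 2 * x) / y ^ (k + 2)"
        using y by (cases k) (simp_all add: field_simps power2_eq_square)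
      finally show ?thesis .
    qed
    then have de: "((\<lambda>x. complex_of_real (exp (- 1 / (1 - x\<^sup>2)) / (1 - x\<^sup>2) ^ k)) has_vector_derivative
        of_real (exp (- 1 / y) * (2 * real k * x * y - 2 * x) / y ^ (k + 2))) (at x)"
      by (intro has_vector_derivative_of_real) (simp add: has_real_derivative_iff_has_vector_derivative)
    define E where "E = complex_of_real (exp (- 1 / y) / y ^ (k + 2))"
    have "((\<lambda>x. poly P (of_real x) * cis (w * x) * of_real (exp (- 1 / (1 - x\<^sup>2)) / (1 - x\<^sup>2) ^ k)) has_vector_derivative
       (poly P (of_real x) * cis (w * x)) * of_real (exp (- 1 / y) * (2 * real k * x * y - 2 * x) / y ^ (k + 2)) +
       (poly P (of_real x) * (\<i> * of_real w * cis (w * x)) + poly (pderiv P) (of_real x) * cis (w * x)) * of_real (exp (- 1 / (1 - x\<^sup>2)) / (1 - x\<^sup>2) ^ k)) (at x)"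
      by (intro has_vector_derivative_mult dP dc de)
    also have "(poly P (of_real x) * cis (w * x)) * of_real (exp (- 1 / y) * (2 * real k * x * y - 2 * x) / y ^ (k + 2)) +
       (poly P (of_real x) * (\<i> * of_real w * cis (w * x)) + poly (pderiv P) (of_real x) * cis (w * x)) * of_real (exp (- 1 / (1 - x\<^sup>2)) / (1 - x\<^sup>2) ^ k)
       = smooth_bump ?Q (k + 2) w x"
    proof -
      have e1: "complex_of_real (exp (- 1 / (1 - x\<^sup>2)) / (1 - x\<^sup>2) ^ k) = of_real (y\<^sup>2) * E"
        unfolding y_def[symmetric] E_def using y by (simp add: power2_eq_square)
      have e2: "complex_of_real (exp (- 1 / y) * (2 * real k * x * y - 2 * x) / y ^ (k + 2)) = (2 * of_nat k * of_real x * of_real y - 2 * of_real x) * E"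
        by (simp add: E_def)
      have e3: "smooth_bump ?Q (k + 2) w x = poly ?Q (of_real x) * cis (w * x) * E"
        using 1 by (simp add: smooth_bump_def E_def y_def)
      have e4: "poly ?Q (of_real x) = (poly (pderiv P) (of_real x) + \<i> * of_real w * poly P (of_real x)) * of_real (y\<^sup>2)
          + 2 * of_nat k * (of_real x * of_real y * poly P (of_real x)) - 2 * (of_real x * poly P (of_real x))"
      proof -
        have "poly [:1, 0, -1:] (complex_of_real x) = of_real y" by (simp add: y_def power2_eq_square)
        moreover have "poly [:0, 1:] (complex_of_real x) = of_real x" by simp
        ultimately show ?thesis
          by (simp only: poly_add poly_diff poly_mult poly_smult poly_power of_real_power)
      qed
      show ?thesis unfolding e1 e2 e3 e4 by (simp add: algebra_simps)
    qed
    finally show ?thesis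
    proof (rule has_vector_derivative_transform_within_open[where S="{-1<..<1}"])
      show "x \<in> {-1<..<1}" using 1 by auto
    qed (auto simp: smooth_bump_def)
  next
    case 2
    have "((\<lambda>x. 0::complex) has_vector_derivative 0) (at x)" by simp
    then have "(smooth_bump P k w has_vector_derivative 0) (at x)"
    proof (rule has_vector_derivative_transform_within_open[where S="- {-1..1}"])
      show "x \<in> - {-1..1}" using 2 by auto
    qed (auto simp: smooth_bump_def)
    then show ?thesis using 2 by (simp add: smooth_bump_def)
  next
    case 3
    have "compact ((\<lambda>x. poly P (complex_of_real x)) ` {-1..1})"
      by (intro compact_continuous_image continuous_intros) auto
    then obtain M where M: "\<And>z. z \<in> {-1..1} \<Longrightarrow> cmod (poly P (of_real z)) \<le> M"
      using compact_imp_bounded bounded_iff by (metis (no_types, lifting) imageI)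
    have M0: "M \<ge> 0" using M[of 0] norm_ge_zero order_trans by (metis atLeastAtMost_iff neg_le_0_iff_le zero_le_one)
    have "(smooth_bump P k w has_vector_derivative 0) (at x)"
    proof (rule has_vector_derivative_zero_quadratic[where K="M * (fact (k + 2) * 4)"])
      fix z
      show "cmod (smooth_bump P k w z) \<le> M * (fact (k + 2) * 4) * (z - x)\<^sup>2"
      proof (cases "\<bar>z\<bar> < 1")
        case True
        define y where "y = 1 - z\<^sup>2"
        have y: "y > 0" using True by (simp add: y_def abs_square_less_1)
        have x2: "x\<^sup>2 = 1" using 3 by (metis abs_1 power2_abs power_one)
        \<comment> \<open>Factoring \<open>x\<^sup>2 - z\<^sup>2\<close> bounds \<open>y\<close> by
          twice the distance to the endpoint \<open>x\<close>, so second-order decay in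
          \<open>y\<close> becomes second-order decay in \<open>z - x\<close>.\<close>
        have "\<bar>y\<bar> = \<bar>x - z\<bar> * \<bar>x + z\<bar>" unfolding y_def x2[symmetric] by (simp add: abs_mult[symmetric] algebra_simps power2_eq_square)
        also have "\<dots> \<le> \<bar>x - z\<bar> * 2" using True 3 by (intro mult_left_mono) auto
        finally have "y\<^sup>2 \<le> (\<bar>x - z\<bar> * 2)\<^sup>2" using y by (intro power_mono) auto
        then have y2: "y\<^sup>2 \<le> 4 * (z - x)\<^sup>2" by (simp add: power_mult_distrib power2_commute)
        have "smooth_bump P k w z = poly P (of_real z) * cis (w * z) * of_real (exp (- 1 / y) / y ^ k)"
          using True by (simp only: smooth_bump_def y_def if_True)
        then have "cmod (smooth_bump P k w z) = cmod (poly P (of_real z)) * \<bar>exp (- 1 / y) / y ^ k\<bar>"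
          by (simp only: norm_mult norm_cis norm_of_real mult_1_right)
        also have "\<bar>exp (- 1 / y) / y ^ k\<bar> = exp (- 1 / y) / y ^ k" using y by simp
        also have "cmod (poly P (of_real z)) * (exp (- 1 / y) / y ^ k) \<le> M * (fact (k + 2) * y\<^sup>2)"
          using M[of z] True y M0 by (intro mult_mono exp_minus_inverse_le) (auto simp: abs_less_iff)
        also have "\<dots> \<le> M * (fact (k + 2) * (4 * (z - x)\<^sup>2))" using y2 M0 by (intro mult_left_mono) auto
        finally show ?thesis by (simp only: mult.assoc)
      qed (use M0 in \<open>simp add: smooth_bump_def\<close>)
    qed
    then show ?thesis using 3 by (simp add: smooth_bump_def)
  qed
qed

lemma continuous_smooth_bump: "continuous_on A (smooth_bump P k w)"
  by (intro continuous_at_imp_continuous_on ballI has_vector_derivative_continuous[OF smooth_bump_deriv])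

text \<open>This gives smoothness in the sense of \<open>test_functions\<close> without formulas for
  higher derivatives: it is enough to find a family that contains a derivative of each of its
  members.\<close>

lemma iterated_vector_derivative_differentiable:
  fixes F :: "(real \<Rightarrow> complex) set"
  assumes closed: "\<And>f. f \<in> F \<Longrightarrow> \<exists>f'\<in>F. \<forall>x. (f has_vector_derivative f' x) (at x)" and f: "f \<in> F"
  shows "((\<lambda>h x. vector_derivative h (at x)) ^^ n) f differentiable (at t)"
proof -
  have "((\<lambda>h x. vector_derivative h (at x)) ^^ n) f \<in> F"
  proof (induction n)
    case (Suc n)
    then obtain f' where f': "f' \<in> F" "\<And>x. (((\<lambda>h x. vector_derivative h (at x)) ^^ n) f has_vector_derivative f' x) (at x)"
      using closed by blast
    then have "(\<lambda>x. vector_derivative (((\<lambda>h x. vector_derivative h (at x)) ^^ n) f) (at x)) = f'"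
      using vector_derivative_at by blast
    then show ?case using f' by simp
  qed (use f in simp)
  from closed[OF this] show ?thesis by (auto simp: has_vector_derivative_def differentiable_def)
qed

text \<open>Correlation with a fixed bump. Differentiation in \<open>t\<close> hits the first factor
  only, so the family stays closed; the second factor confines the integral to
  \<open>[-1, 1]\<close>, where the Leibniz rule applies.\<close>

definition bump_corr :: "complex poly \<Rightarrow> nat \<Rightarrow> real \<Rightarrow> real \<Rightarrow> complex" where
  "bump_corr P k w t = integral {-1..1} (\<lambda>s. smooth_bump P k w (t + s) * cnj (smooth_bump 1 0 w s))"

lemma bump_corr_deriv: "\<exists>Q m. \<forall>t. (bump_corr P k w has_vector_derivative bump_corr Q m w t) (at t)"
proof -
  obtain Q where Q: "\<And>x. (smooth_bump P k w has_vector_derivative smooth_bump Q (k + 2) w x) (at x)"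
    using smooth_bump_deriv by blast
  have "(bump_corr P k w has_vector_derivative bump_corr Q (k + 2) w t) (at t within UNIV)" for t
    unfolding bump_corr_def interval_cbox
  proof (rule leibniz_rule_vector_derivative)
    show "((\<lambda>t. smooth_bump P k w (t + s) * cnj (smooth_bump 1 0 w s)) has_vector_derivative
        smooth_bump Q (k + 2) w (t + s) * cnj (smooth_bump 1 0 w s)) (at t within UNIV)" for t s
    proof (rule has_vector_derivative_mult_left)
      have "((\<lambda>t. smooth_bump P k w (t + s)) has_vector_derivative (1 *\<^sub>R smooth_bump Q (k + 2) w (t + s))) (at t)"
        by (rule vector_diff_chain_at[unfolded o_def, OF _ Q]) (auto intro!: derivative_eq_intros)
      then show "((\<lambda>t. smooth_bump P k w (t + s)) has_vector_derivative smooth_bump Q (k + 2) w (t + s)) (at t)" by simp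
    qed
    show "(\<lambda>s. smooth_bump P k w (t + s) * cnj (smooth_bump 1 0 w s)) integrable_on cbox (-1) 1" for t
      by (intro integrable_continuous continuous_intros continuous_on_compose2[OF continuous_smooth_bump[of UNIV]]) auto
    show "continuous_on (UNIV \<times> cbox (-1) 1) (\<lambda>(t, s). smooth_bump Q (k + 2) w (t + s) * cnj (smooth_bump 1 0 w s))"
      unfolding case_prod_beta
      by (intro continuous_intros continuous_on_compose2[OF continuous_smooth_bump[of UNIV]]) auto
  qed auto
  then show ?thesis by auto
qed

lemma test_function_bump_corr:
  fixes e :: real
  shows "((\<lambda>h x. vector_derivative h (at x)) ^^ n) (\<lambda>t. c * bump_corr P k w ((t - t0) / e)) differentiable (at t)"
proof (rule iterated_vector_derivative_differentiable)
  let ?F = "{f. \<exists>c P k. f = (\<lambda>t. c * bump_corr P k w ((t - t0) / e))}"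
  show "(\<lambda>t. c * bump_corr P k w ((t - t0) / e)) \<in> ?F" by blast
  fix f assume "f \<in> ?F"
  then obtain c P k where f: "f = (\<lambda>t. c * bump_corr P k w ((t - t0) / e))" by blast
  obtain Q m where Q: "\<And>t. (bump_corr P k w has_vector_derivative bump_corr Q m w t) (at t)"
    using bump_corr_deriv by blast
  have "(f has_vector_derivative (c * of_real (1 / e)) * bump_corr Q m w ((t - t0) / e)) (at t)" for t
  proof -
    have "((\<lambda>t. bump_corr P k w ((t - t0) / e)) has_vector_derivative ((1 / e) *\<^sub>R bump_corr Q m w ((t - t0) / e))) (at t)"
      by (rule vector_diff_chain_at[unfolded o_def, OF _ Q])
         (unfold has_real_derivative_iff_has_vector_derivative[symmetric] divide_inverse, auto intro!: derivative_eq_intros)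
    then have "(f has_vector_derivative c * ((1 / e) *\<^sub>R bump_corr Q m w ((t - t0) / e))) (at t)"
      unfolding f by (rule has_vector_derivative_mult_right)
    then show ?thesis by (simp add: scaleR_conv_of_real mult_ac)
  qed
  then show "\<exists>f'\<in>?F. \<forall>x. (f has_vector_derivative f' x) (at x)"
    by (intro bexI[of _ "\<lambda>t. (c * of_real (1 / e)) * bump_corr Q m w ((t - t0) / e)"]) blast+
qed

definition real_bump :: "real \<Rightarrow> real" where
  "real_bump s = (if \<bar>s\<bar> < 1 then exp (- 1 / (1 - s\<^sup>2)) else 0)"

lemma smooth_bump_eq: "smooth_bump 1 0 w s = cis (w * s) * of_real (real_bump s)"
  by (simp add: smooth_bump_def real_bump_def)

lemma continuous_real_bump: "continuous_on A real_bump"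
proof -
  have "real_bump = (\<lambda>s. Re (smooth_bump 1 0 0 s))" by (simp add: fun_eq_iff smooth_bump_eq)
  moreover have "continuous_on A (\<lambda>s. Re (smooth_bump 1 0 0 s))" by (intro continuous_intros continuous_smooth_bump)
  ultimately show ?thesis by (simp only:)
qed

lemma measurable_real_bump [measurable]: "real_bump \<in> borel_measurable borel"
  by (intro borel_measurable_continuous_onI continuous_real_bump)

lemma real_bump_bounds: "0 \<le> real_bump s" "real_bump s \<le> 1" "\<bar>s\<bar> \<ge> 1 \<Longrightarrow> real_bump s = 0"
  by (auto simp: real_bump_def abs_square_le_1[THEN iffD2, OF less_imp_le])

lemma integrable_real_bump: "integrable lborel real_bump"
  by (rule integrable_bounded_support[of _ 1 1]) (use real_bump_bounds in auto)

definition bump_autocorr :: "real \<Rightarrow> real" where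
  "bump_autocorr t = (LINT s|lborel. real_bump (t + s) * real_bump s)"

text \<open>The two characters combine to \<open>cis (w * t)\<close>, which leaves a real
  autocorrelation times a pure frequency.\<close>

lemma bump_corr_eq: "bump_corr 1 0 w t = cis (w * t) * of_real (bump_autocorr t)"
proof -
  have cont: "continuous_on A (\<lambda>s. real_bump (t + s) * real_bump s)" for A
    by (intro continuous_intros continuous_real_bump continuous_on_compose2[OF continuous_real_bump[of UNIV]]) auto
  have "set_integrable lborel {-1..1} (\<lambda>s. real_bump (t + s) * real_bump s)"
    by (intro borel_integrable_atLeastAtMost') (rule cont)
  then have "integral {-1..1} (\<lambda>s. real_bump (t + s) * real_bump s) = (LINT s:{-1..1}|lborel. real_bump (t + s) * real_bump s)"
    by (rule set_borel_integral_eq_integral(2)[symmetric])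
  also have "\<dots> = bump_autocorr t"
    unfolding set_lebesgue_integral_def bump_autocorr_def
  proof (intro Bochner_Integration.integral_cong refl)
    fix s :: real
    show "indicator {-1..1} s *\<^sub>R (real_bump (t + s) * real_bump s) = real_bump (t + s) * real_bump s"
      using real_bump_bounds(3)[of s] by (cases "\<bar>s\<bar> \<ge> 1") (auto simp: indicator_def)
  qed
  finally have *: "integral {-1..1} (\<lambda>s. real_bump (t + s) * real_bump s) = bump_autocorr t" .
  have "smooth_bump 1 0 w (t + s) * cnj (smooth_bump 1 0 w s) = cis (w * t) * complex_of_real (real_bump (t + s) * real_bump s)" for s
  proof -
    have "cis (w * (t + s)) * cis (- (w * s)) = cis (w * t)" by (simp add: cis_mult distrib_left)
    then show ?thesis by (simp add: smooth_bump_eq cis_cnj mult_ac)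
  qed
  then have "bump_corr 1 0 w t = integral {-1..1} (\<lambda>s. cis (w * t) * complex_of_real (real_bump (t + s) * real_bump s))"
    by (simp add: bump_corr_def)
  also have "\<dots> = cis (w * t) * integral {-1..1} (\<lambda>s. complex_of_real (real_bump (t + s) * real_bump s))"
    by (rule integral_mult_right)
  also have "integral {-1..1} (\<lambda>s. complex_of_real (real_bump (t + s) * real_bump s)) = of_real (integral {-1..1} (\<lambda>s. real_bump (t + s) * real_bump s))"
    using integral_linear[OF integrable_continuous_interval[OF cont] bounded_linear_of_real, of "-1" 1]
    by (simp add: o_def)
  finally show ?thesis by (simp add: *)
qed

lemma continuous_bump_autocorr: "continuous_on A bump_autocorr"
proof -
  obtain Q m where "\<And>t. (bump_corr 1 0 0 has_vector_derivative bump_corr Q m 0 t) (at t)" using bump_corr_deriv by blast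
  then have "continuous_on A (bump_corr 1 0 0)"
    by (intro continuous_at_imp_continuous_on ballI has_vector_derivative_continuous)
  moreover have "bump_autocorr = (\<lambda>t. Re (bump_corr 1 0 0 t))" by (simp add: bump_corr_eq fun_eq_iff)
  moreover from calculation(1) have "continuous_on A (\<lambda>t. Re (bump_corr 1 0 0 t))" by (intro continuous_intros)
  ultimately show ?thesis by (simp only:)
qed

lemma bump_autocorr_nonneg: "bump_autocorr t \<ge> 0"
  unfolding bump_autocorr_def by (intro Bochner_Integration.integral_nonneg mult_nonneg_nonneg real_bump_bounds)

lemma bump_autocorr_eq_0: "\<bar>t\<bar> \<ge> 2 \<Longrightarrow> bump_autocorr t = 0"
proof -
  assume t: "\<bar>t\<bar> \<ge> 2"
  have "real_bump (t + s) * real_bump s = 0" for s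
    using t real_bump_bounds(3)[of s] real_bump_bounds(3)[of "t + s"] by (cases "\<bar>s\<bar> \<ge> 1") auto
  then show ?thesis by (simp only: bump_autocorr_def Bochner_Integration.integral_zero)
qed

text \<open>After the substitution \<open>t + s\<close> the double integral separates into a
  transform and its conjugate. This is the source of the nonnegative Fourier transform of the
  mollifier.\<close>

lemma fourier_bump_autocorr:
  "(LINT t|lborel. of_real (bump_autocorr t) * cis (- (t * u))) =
     complex_of_real ((cmod (LINT s|lborel. of_real (real_bump s) * cis (- (s * u))))\<^sup>2)"
proof -
  define h where "h = (LINT s|lborel. of_real (real_bump s) * cis (- (s * u)))"
  have "(LINT t|lborel. of_real (bump_autocorr t) * cis (- (t * u))) =
        (LINT t|lborel. LINT s|lborel. of_real (real_bump (t + s) * real_bump s) * cis (- (t * u)))"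
    unfolding bump_autocorr_def by (simp only: integral_complex_of_real[symmetric] integral_mult_left_zero)
  also have "\<dots> = (LINT s|lborel. LINT t|lborel. of_real (real_bump (t + s) * real_bump s) * cis (- (t * u)))"
  proof (rule lborel_pair.fubini_swap_bound)
    show "integrable lborel (\<lambda>t. indicator {-2..2::real} t :: real)" by (intro integrable_real_indicator) auto
    show "integrable lborel real_bump" by (rule integrable_real_bump)
    fix t s
    show "cmod (of_real (real_bump (t + s) * real_bump s) * cis (- (t * u))) \<le> indicator {-2..2} t * real_bump s"
    proof (cases "t \<in> {-2..2}")
      case True
      then show ?thesis using mult_right_mono[OF real_bump_bounds(2)[of "t + s"] real_bump_bounds(1)[of s]] real_bump_bounds(1)
        by (simp add: norm_mult)
    next
      case False
      then have "real_bump (t + s) * real_bump s = 0"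
        using real_bump_bounds(3)[of s] real_bump_bounds(3)[of "t + s"] by (cases "\<bar>s\<bar> \<ge> 1") auto
      then have "cmod (of_real (real_bump (t + s) * real_bump s) * cis (- (t * u))) = 0" by (simp only:) simp
      then show ?thesis using False by (simp only: indicator_simps) simp
    qed
  qed simp
  also have "\<dots> = (LINT s|lborel. cnj (of_real (real_bump s) * cis (- (s * u))) * h)"
  proof (intro Bochner_Integration.integral_cong refl)
    fix s
    have "h = (LINT t|lborel. of_real (real_bump (t + s)) * cis (- ((t + s) * u)))"
      unfolding h_def using lborel_integral_real_affine[of 1 "\<lambda>x. of_real (real_bump x) * cis (- (x * u))" s]
      by (simp add: add.commute)
    then have "cnj (of_real (real_bump s) * cis (- (s * u))) * h =
        (LINT t|lborel. cnj (of_real (real_bump s) * cis (- (s * u))) * (of_real (real_bump (t + s)) * cis (- ((t + s) * u))))"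
      by (simp only: integral_mult_right_zero)
    also have "\<dots> = (LINT t|lborel. of_real (real_bump (t + s) * real_bump s) * cis (- (t * u)))"
    proof (intro Bochner_Integration.integral_cong refl)
      fix t
      have "cis (s * u) * cis (- ((t + s) * u)) = cis (- (t * u))" by (simp add: cis_mult algebra_simps)
      then show "cnj (of_real (real_bump s) * cis (- (s * u))) * (of_real (real_bump (t + s)) * cis (- ((t + s) * u))) =
        of_real (real_bump (t + s) * real_bump s) * cis (- (t * u))"
        by (simp add: cis_cnj mult_ac)
    qed
    finally show "(LINT t|lborel. of_real (real_bump (t + s) * real_bump s) * cis (- (t * u))) = cnj (of_real (real_bump s) * cis (- (s * u))) * h" by simp
  qed
  also have "\<dots> = (LINT s|lborel. cnj (of_real (real_bump s) * cis (- (s * u)))) * h" by (rule integral_mult_left_zero)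
  also have "\<dots> = cnj h * h" unfolding h_def by (subst Bochner_Integration.integral_cnj) (rule refl)
  also have "\<dots> = complex_of_real ((cmod h)\<^sup>2)" by (simp add: complex_norm_square mult.commute del: of_real_power)
  finally show ?thesis by (simp add: h_def)
qed

lemma real_bump_integral_pos: "(LINT s|lborel. real_bump s) > 0"
proof -
  have "(LINT s|lborel. real_bump s) \<ge> 0" by (rule Bochner_Integration.integral_nonneg) (rule real_bump_bounds)
  moreover have "(LINT s|lborel. real_bump s) \<noteq> 0"
  proof
    assume "(LINT s|lborel. real_bump s) = 0"
    then have "AE x in lborel. real_bump x = 0"
      by (subst (asm) integral_nonneg_eq_0_iff_AE) (auto simp: real_bump_bounds integrable_real_bump)
    then have "AE x in lborel. x \<notin> {0<..<1::real}" by (auto elim!: eventually_mono simp: real_bump_def)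
    then have "emeasure lborel {0<..<1::real} = 0"
      by (subst (asm) AE_iff_measurable[where N="{0<..<1}"]) auto
    then show False by simp
  qed
  ultimately show ?thesis by linarith
qed

text \<open>The frequency \<open>w\<close> in \<open>\<rho>_test\<close> moves the window
  \<open>\<psi>\<close> on the transform side from 0 to \<open>w\<close>, so that a measure can be
  tested anywhere on the half-line.\<close>

locale mollifier =
  fixes \<rho> \<psi> :: "real \<Rightarrow> real"
  assumes \<rho>_cont: "continuous_on UNIV \<rho>" and \<rho>_nonneg: "\<And>t. \<rho> t \<ge> 0" and \<rho>_supp: "\<And>t. \<bar>t\<bar> \<ge> 2 \<Longrightarrow> \<rho> t = 0"
    and \<rho>_integral: "(LINT t|lborel. \<rho> t) = 1"
    and \<psi>_nonneg: "\<And>u. \<psi> u \<ge> 0" and \<rho>_fourier: "\<And>u. (LINT t|lborel. of_real (\<rho> t) * cis (- (t * u))) = complex_of_real (\<psi> u)"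
    and \<rho>_test: "\<And>w e t0 U. e > 0 \<Longrightarrow> {t0 - 2 * e..t0 + 2 * e} \<subseteq> U \<Longrightarrow> (\<lambda>t. cis (w * t) * of_real (\<rho> ((t - t0) / e) / e)) \<in> test_functions U"

lemma mollifier_exists: "\<exists>\<rho> \<psi>. mollifier \<rho> \<psi>"
proof -
  \<comment> \<open>The squared transform at frequency 0; dividing by it normalizes the total mass
    to 1.\<close>
  define c where "c = (LINT s|lborel. real_bump s)\<^sup>2"
  have c: "c > 0" using real_bump_integral_pos by (simp add: c_def)
  define \<rho> where "\<rho> = (\<lambda>t. bump_autocorr t / c)"
  define \<psi> where "\<psi> = (\<lambda>u. (cmod (LINT s|lborel. of_real (real_bump s) * cis (- (s * u))))\<^sup>2 / c)"
  have "mollifier \<rho> \<psi>"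
  proof
    show "continuous_on UNIV \<rho>" unfolding \<rho>_def using c by (intro continuous_intros continuous_bump_autocorr) auto
    show "\<rho> t \<ge> 0" for t using c bump_autocorr_nonneg by (simp add: \<rho>_def)
    show r0: "\<rho> t = 0" if "\<bar>t\<bar> \<ge> 2" for t using that by (simp add: \<rho>_def bump_autocorr_eq_0)
    show "\<psi> u \<ge> 0" for u using c by (simp add: \<psi>_def)
    show ft: "(LINT t|lborel. of_real (\<rho> t) * cis (- (t * u))) = complex_of_real (\<psi> u)" for u
      using fourier_bump_autocorr[of u] by (simp add: \<rho>_def \<psi>_def)
    have "complex_of_real (LINT t|lborel. \<rho> t) = of_real (\<psi> 0)" using ft[of 0] by simp
    also have "\<psi> 0 = 1" using c by (simp add: \<psi>_def c_def)
    finally show "(LINT t|lborel. \<rho> t) = 1" using of_real_eq_iff by blast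
    fix w e t0 :: real and U
    assume e: "e > 0" and U: "{t0 - 2 * e..t0 + 2 * e} \<subseteq> U"
    let ?f = "\<lambda>t. cis (w * t) * complex_of_real (\<rho> ((t - t0) / e) / e)"
    have "?f = (\<lambda>t. (cis (w * t0) / of_real (c * e)) * bump_corr 1 0 (w * e) ((t - t0) / e))"
    proof
      fix t
      have "w * e * ((t - t0) / e) = w * t - w * t0" using e by (simp add: field_simps)
      then have "cis (w * t) = cis (w * t0) * cis (w * e * ((t - t0) / e))" by (simp add: cis_mult)
      then show "?f t = (cis (w * t0) / of_real (c * e)) * bump_corr 1 0 (w * e) ((t - t0) / e)"
        by (simp add: bump_corr_eq \<rho>_def)
    qed
    then have sm: "((\<lambda>h x. vector_derivative h (at x)) ^^ n) ?f differentiable (at t)" for n t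
      by (simp only: test_function_bump_corr)
    have "{t. ?f t \<noteq> 0} \<subseteq> {t0 - 2 * e..t0 + 2 * e}"
    proof
      fix t assume "t \<in> {t. ?f t \<noteq> 0}"
      then have "\<not> \<bar>(t - t0) / e\<bar> \<ge> 2" using r0[of "(t - t0) / e"] by auto
      then have "\<bar>t - t0\<bar> < 2 * e" using e by (simp add: abs_divide divide_simps split: if_splits)
      then show "t \<in> {t0 - 2 * e..t0 + 2 * e}" by auto
    qed
    then have cl: "closure {t. ?f t \<noteq> 0} \<subseteq> {t0 - 2 * e..t0 + 2 * e}" by (rule closure_minimal) auto
    then have "compact (closure {t. ?f t \<noteq> 0})" by (meson bounded_closed_interval bounded_subset closed_closure compact_eq_bounded_closed)
    with sm cl U show "?f \<in> test_functions U" unfolding test_functions_def by blast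
  qed
  then show ?thesis by blast
qed

section \<open>Boundary values of Laplace transforms of positive measures\<close>

text \<open>Used with exponent \<open>-1/2\<close> for the logarithm, and with the negative
  exponents among the \<open>\<beta>\<close>, where \<open>\<beta> > -1\<close> makes the
  singularities integrable.\<close>

lemma integrable_abs_powr:
  fixes \<alpha> R :: real
  assumes "\<alpha> > -1" "R \<ge> 0"
  shows "integrable lborel (\<lambda>t. indicator {-R..R} t * \<bar>t\<bar> powr \<alpha>)"
proof -
  have "(\<lambda>x. x powr \<alpha>) absolutely_integrable_on {0..R}"
    using has_integral_powr_from_0[OF assms] by (intro nonnegative_absolutely_integrable_1) (auto simp: integrable_on_def)
  then have "integrable lebesgue (\<lambda>x. indicator {0..R} x * x powr \<alpha>)" by (simp add: set_integrable_def)
  then have i: "integrable lborel (\<lambda>x. indicator {0..R} x * x powr \<alpha>)"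
    by (subst (asm) integrable_completion) auto
  have j: "integrable lborel (\<lambda>x. indicator {0..R} (-x) * (-x) powr \<alpha>)"
    using lborel_integrable_real_affine[OF i, of "-1" 0] by simp
  show ?thesis
  proof (rule Bochner_Integration.integrable_bound[OF Bochner_Integration.integrable_add[OF i j]])
    show "AE t in lborel. norm (indicator {-R..R} t * \<bar>t\<bar> powr \<alpha>)
        \<le> norm (indicator {0..R} t * t powr \<alpha> + indicator {0..R} (-t) * (-t) powr \<alpha>)"
      by (intro AE_I2) (auto simp: indicator_def abs_if)
  qed simp
qed

text \<open>The logarithmic singularity is traded for a power of exponent \<open>-1/2\<close>,
  through the logarithm of the square root; \<open>pi\<close> accounts for the argument.\<close>

lemma norm_Ln_inverse_le:
  assumes z: "z \<noteq> 0"
  shows "cmod (Ln (1 / z)) \<le> cmod z + 2 / sqrt (cmod z) + pi"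
proof -
  define x where "x = cmod z"
  have x: "x > 0" using z by (simp add: x_def)
  have "\<bar>ln x\<bar> \<le> x + 2 / sqrt x"
  proof (cases "x \<ge> 1")
    case True
    then have "\<bar>ln x\<bar> \<le> x" using ln_le_minus_one[of x] by simp
    also have "\<dots> \<le> x + 2 / sqrt x" using x by simp
    finally show ?thesis .
  next
    case False
    have "ln (1 / sqrt x) \<le> 1 / sqrt x - 1" using x by (intro ln_le_minus_one) auto
    then have "- ln x \<le> 2 / sqrt x" using x by (simp add: ln_div ln_sqrt)
    moreover have "ln x < 0" using False x by simp
    ultimately show ?thesis using x by simp
  qed
  moreover have "cmod (Ln (1 / z)) \<le> \<bar>Re (Ln (1 / z))\<bar> + \<bar>Im (Ln (1 / z))\<bar>" by (rule cmod_le)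
  moreover have "\<bar>Re (Ln (1 / z))\<bar> = \<bar>ln x\<bar>" using z by (simp add: norm_divide ln_div x_def)
  moreover have "\<bar>Im (Ln (1 / z))\<bar> \<le> pi" using z mpi_less_Im_Ln[of "1 / z"] Im_Ln_le_pi[of "1 / z"] by simp
  ultimately show ?thesis by (simp add: x_def)
qed

definition log_bound :: "real \<Rightarrow> real \<Rightarrow> real" where
  "log_bound R x = R + 1 + pi + 2 * \<bar>x\<bar> powr (-1/2)"

lemma norm_Ln_inverse_le_log_bound:
  assumes "x \<noteq> 0" "\<bar>x\<bar> \<le> R" "0 \<le> \<delta>" "\<delta> \<le> 1"
  shows "cmod (Ln (1 / Complex \<delta> x)) \<le> log_bound R x"
proof -
  have "Complex \<delta> x \<noteq> 0" using assms by (simp add: complex_eq_iff)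
  then have "cmod (Ln (1 / Complex \<delta> x)) \<le> cmod (Complex \<delta> x) + 2 / sqrt (cmod (Complex \<delta> x)) + pi" by (rule norm_Ln_inverse_le)
  moreover have "cmod (Complex \<delta> x) \<le> R + 1" using cmod_le[of "Complex \<delta> x"] assms by simp
  moreover have "2 / sqrt (cmod (Complex \<delta> x)) \<le> 2 / sqrt \<bar>x\<bar>"
    using assms abs_Im_le_cmod[of "Complex \<delta> x"] by (intro divide_left_mono mult_pos_pos) (auto simp: \<open>Complex \<delta> x \<noteq> 0\<close>)
  moreover have "2 / sqrt \<bar>x\<bar> = 2 * \<bar>x\<bar> powr (-1/2)" using assms by (simp add: powr_minus_divide powr_half_sqrt)
  ultimately show ?thesis by (simp add: log_bound_def)
qed

lemma integrable_log_bound: "R \<ge> 0 \<Longrightarrow> integrable lborel (\<lambda>x. indicator {-R..R} x * log_bound R x)"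
proof -
  assume R: "R \<ge> 0"
  have "integrable lborel (\<lambda>x. (R + 1 + pi) * indicator {-R..R} x + 2 * (indicator {-R..R} x * \<bar>x\<bar> powr (-1/2)))"
    by (intro Bochner_Integration.integrable_add integrable_mult_right integrable_abs_powr R integrable_real_indicator) (auto simp: emeasure_lborel_Icc_eq)
  then show ?thesis by (rule Bochner_Integration.integrable_cong[THEN iffD1, rotated 2]) (auto simp: log_bound_def algebra_simps)
qed

lemma measurable_Complex [measurable]: "(\<lambda>t. Complex c t) \<in> borel_measurable borel"
  unfolding Complex_eq by measurable

text \<open>For \<open>x \<noteq> 0\<close> the point \<open>1 / Complex 0 x\<close> is purely
  imaginary and so off the branch cut, which gives pointwise convergence; \<open>log_bound\<close>
  dominates uniformly in \<open>\<sigma>\<close>.\<close>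

lemma Ln_inverse_boundary_L1:
  assumes R: "R \<ge> 0"
  shows "((\<lambda>\<sigma>. LINT x|lborel. indicator {-R..R} x * cmod (Ln (1 / Complex (\<sigma> - 1) x) - Ln (1 / Complex 0 x))) \<longlongrightarrow> 0) (at_right 1)"
  unfolding tendsto_at_iff_sequentially o_def
proof (intro allI impI)
  fix X :: "nat \<Rightarrow> real" assume X: "\<forall>i. X i \<in> {1<..} - {1}" "X \<longlonglongrightarrow> 1"
  then have "\<forall>\<^sub>F i in sequentially. X i < 2" by (intro order_tendstoD(2)) auto
  then obtain N where N: "\<And>i. i \<ge> N \<Longrightarrow> X i < 2" by (auto simp: eventually_sequentially)
  have "(\<lambda>i. LINT x|lborel. indicator {-R..R} x * cmod (Ln (1 / Complex (X (i + N) - 1) x) - Ln (1 / Complex 0 x))) \<longlonglongrightarrow> (LINT x|(lborel::real measure). 0)"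
  proof (rule integral_dominated_convergence[where w="\<lambda>x. 2 * (indicator {-R..R} x * log_bound R x)"])
    show "integrable lborel (\<lambda>x. 2 * (indicator {-R..R} x * log_bound R x))" using integrable_log_bound[OF R] by simp
    show "AE x in lborel. (\<lambda>i. indicator {-R..R} x * cmod (Ln (1 / Complex (X (i + N) - 1) x) - Ln (1 / Complex 0 x))) \<longlonglongrightarrow> 0"
    proof (rule AE_mp[OF AE_lborel_singleton[of 0]], intro AE_I2 impI tendsto_mult_right_zero)
      fix x :: real assume x: "x \<noteq> 0"
      have "(\<lambda>i. Complex (X (i + N) - 1) x) \<longlonglongrightarrow> Complex (1 - 1) x"
        by (intro tendsto_Complex tendsto_intros LIMSEQ_ignore_initial_segment X)
      moreover have nz: "Complex 0 x \<noteq> 0" using x by (simp add: complex_eq_iff)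
      moreover have "1 / Complex 0 x \<notin> \<real>\<^sub>\<le>\<^sub>0" using x by (auto simp: complex_nonpos_Reals_iff Re_divide Im_divide)
      ultimately have "(\<lambda>i. Ln (1 / Complex (X (i + N) - 1) x)) \<longlonglongrightarrow> Ln (1 / Complex 0 x)"
        by (intro tendsto_Ln tendsto_divide tendsto_const) auto
      then have "(\<lambda>i. Ln (1 / Complex (X (i + N) - 1) x) - Ln (1 / Complex 0 x)) \<longlonglongrightarrow> 0" by (simp add: LIM_zero_iff)
      then show "(\<lambda>i. cmod (Ln (1 / Complex (X (i + N) - 1) x) - Ln (1 / Complex 0 x))) \<longlonglongrightarrow> 0" by (rule tendsto_norm_zero)
    qed
    show "AE x in lborel. norm (indicator {-R..R} x * cmod (Ln (1 / Complex (X (i + N) - 1) x) - Ln (1 / Complex 0 x))) \<le> 2 * (indicator {-R..R} x * log_bound R x)" for i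
    proof (rule AE_mp[OF AE_lborel_singleton[of 0]], intro AE_I2 impI)
      fix x :: real assume x: "x \<noteq> 0"
      show "norm (indicator {-R..R} x * cmod (Ln (1 / Complex (X (i + N) - 1) x) - Ln (1 / Complex 0 x))) \<le> 2 * (indicator {-R..R} x * log_bound R x)"
      proof (cases "x \<in> {-R..R}")
        case True
        then have ax: "\<bar>x\<bar> \<le> R" by auto
        have d: "0 \<le> X (i + N) - 1" "X (i + N) - 1 \<le> 1" using X(1) N[of "i + N"] by (auto simp: less_imp_le)
        have "cmod (Ln (1 / Complex (X (i + N) - 1) x) - Ln (1 / Complex 0 x)) \<le> log_bound R x + log_bound R x"
          by (intro order.trans[OF norm_triangle_ineq4] add_mono norm_Ln_inverse_le_log_bound x ax d) auto
        then show ?thesis using True by simp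
      qed simp
    qed
  qed measurable
  then have "(\<lambda>i. LINT x|lborel. indicator {-R..R} x * cmod (Ln (1 / Complex (X (i + N) - 1) x) - Ln (1 / Complex 0 x))) \<longlonglongrightarrow> 0" by simp
  then show "(\<lambda>i. LINT x|lborel. indicator {-R..R} x * cmod (Ln (1 / Complex (X i - 1) x) - Ln (1 / Complex 0 x))) \<longlonglongrightarrow> 0"
    by (rule LIMSEQ_offset)
qed

section \<open>Rescaled mollifiers\<close>

context mollifier
begin

definition moll :: "real \<Rightarrow> real \<Rightarrow> real" where "moll e t = \<rho> (t / e) / e"

lemma moll_cont: "e > 0 \<Longrightarrow> continuous_on A (moll e)"
  unfolding moll_def by (intro continuous_intros continuous_on_compose2[OF \<rho>_cont]) auto

lemma moll_meas [measurable]: "e > 0 \<Longrightarrow> moll e \<in> borel_measurable borel"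
  by (intro borel_measurable_continuous_onI moll_cont)

lemma \<rho>_meas [measurable]: "\<rho> \<in> borel_measurable borel"
  by (intro borel_measurable_continuous_onI \<rho>_cont)

lemma moll_nonneg: "e > 0 \<Longrightarrow> moll e t \<ge> 0" by (simp add: moll_def \<rho>_nonneg)

lemma moll_supp: "e > 0 \<Longrightarrow> \<bar>t\<bar> \<ge> 2 * e \<Longrightarrow> moll e t = 0"
  by (simp add: moll_def \<rho>_supp abs_divide le_divide_eq)

lemma moll_integral: "e > 0 \<Longrightarrow> (LINT t|lborel. moll e t) = 1"
  using lborel_integral_real_affine[of "1/e" \<rho> 0] \<rho>_integral by (simp add: moll_def)

lemma moll_fourier: "e > 0 \<Longrightarrow> (LINT t|lborel. of_real (moll e t) * cis (- (t * u))) = complex_of_real (\<psi> (e * u))"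
  using lborel_integral_real_affine[of "1/e" "\<lambda>t. complex_of_real (\<rho> t) * cis (- (t * (e * u)))" 0] \<rho>_fourier[of "e * u"]
  by (simp add: moll_def scaleR_conv_of_real)

lemma integrable_moll_mult:
  fixes h :: "real \<Rightarrow> complex"
  assumes e: "e > 0" and h: "continuous_on {-2 * e..2 * e} h"
  shows "integrable lborel (\<lambda>\<tau>. h \<tau> * of_real (moll e \<tau>))"
proof -
  have "continuous_on {-2 * e..2 * e} (\<lambda>\<tau>. h \<tau> * of_real (moll e \<tau>))" by (intro continuous_intros h moll_cont e)
  then have "integrable lborel (\<lambda>\<tau>. indicator {-2 * e..2 * e} \<tau> *\<^sub>R (h \<tau> * of_real (moll e \<tau>)))"
    by (intro borel_integrable_compact) auto
  then show ?thesis
  proof (rule Bochner_Integration.integrable_cong[THEN iffD1, rotated 2])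
    fix t show "indicator {-2 * e..2 * e} t *\<^sub>R (h t * of_real (moll e t)) = h t * of_real (moll e t)"
    proof (cases "t \<in> {-2 * e..2 * e}")
      case False
      then have "\<bar>t\<bar> \<ge> 2 * e" by auto
      then show ?thesis using False by (simp add: moll_supp[OF e])
    qed simp
  qed auto
qed

lemma integrable_moll: "e > 0 \<Longrightarrow> integrable lborel (moll e)"
  using not_integrable_integral_eq[of lborel "moll e"] moll_integral[of e] by force

text \<open>\<open>moll e\<close> is a probability density carried by
  \<open>[-2 * e, 2 * e]\<close>, so an average over it inherits a bound on the deviation from
  \<open>c\<close>. With \<open>c = 0\<close> the lemma serves as a sup bound.\<close>

lemma moll_close:
  fixes h :: "real \<Rightarrow> complex"
  assumes e: "e > 0" and i: "integrable lborel (\<lambda>\<tau>. h \<tau> * of_real (moll e \<tau>))" and k: "\<And>\<tau>. \<bar>\<tau>\<bar> \<le> 2 * e \<Longrightarrow> cmod (h \<tau> - c) \<le> \<kappa>"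
  shows "cmod ((LINT \<tau>|lborel. h \<tau> * of_real (moll e \<tau>)) - c) \<le> \<kappa>"
proof -
  have ic: "integrable lborel (\<lambda>\<tau>. c * of_real (moll e \<tau>))" using integrable_moll[OF e] by simp
  have "(LINT \<tau>|lborel. c * complex_of_real (moll e \<tau>)) = c" using moll_integral[OF e] by simp
  then have "(LINT \<tau>|lborel. h \<tau> * of_real (moll e \<tau>)) - c = (LINT \<tau>|lborel. h \<tau> * of_real (moll e \<tau>) - c * of_real (moll e \<tau>))"
    using i ic by (subst Bochner_Integration.integral_diff) auto
  also have "cmod \<dots> \<le> (LINT \<tau>|lborel. \<kappa> * moll e \<tau>)"
  proof (rule norm_integral_le_AE[OF _ _ AE_I2])
    fix \<tau>
    show "cmod (h \<tau> * of_real (moll e \<tau>) - c * of_real (moll e \<tau>)) \<le> \<kappa> * moll e \<tau>"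
      using k[of \<tau>] moll_nonneg[OF e, of \<tau>] moll_supp[OF e, of \<tau>]
      by (cases "\<bar>\<tau>\<bar> \<le> 2 * e") (auto simp: norm_mult mult_right_mono simp flip: left_diff_distrib)
  qed (use i ic integrable_moll[OF e] in auto)
  finally show ?thesis using moll_integral[OF e] by simp
qed

text \<open>On the support \<open>\<bar>\<tau>\<bar> \<le> 2\<close> the phase is at most 1/2. The
  lower bound lets translates of \<open>\<psi>\<close> cover the half-line in
  \<open>Laplace_growth\<close>.\<close>

lemma \<psi>_ge_half: "\<bar>v\<bar> \<le> 1 / 4 \<Longrightarrow> \<psi> v \<ge> 1 / 2"
proof -
  assume v: "\<bar>v\<bar> \<le> 1 / 4"
  have "cmod ((LINT \<tau>|lborel. cis (- (\<tau> * v)) * of_real (moll 1 \<tau>)) - 1) \<le> 1 / 2"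
  proof (rule moll_close)
    show "integrable lborel (\<lambda>\<tau>. cis (- (\<tau> * v)) * of_real (moll 1 \<tau>))" by (intro integrable_moll_mult continuous_intros) auto
    fix \<tau> :: real assume t: "\<bar>\<tau>\<bar> \<le> 2 * 1"
    have "cmod (cis (- (\<tau> * v)) - cis 0) \<le> \<bar>- (\<tau> * v) - 0\<bar>" by (rule norm_cis_diff_le)
    also have "\<dots> = \<bar>\<tau>\<bar> * \<bar>v\<bar>" by (simp add: abs_mult)
    also have "\<dots> \<le> 2 * (1 / 4)" using t v by (intro mult_mono) auto
    finally show "cmod (cis (- (\<tau> * v)) - 1) \<le> 1 / 2" by simp
  qed simp
  also have "(LINT \<tau>|lborel. cis (- (\<tau> * v)) * of_real (moll 1 \<tau>)) = of_real (\<psi> v)"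
    using moll_fourier[of 1 v] by (simp add: mult.commute)
  finally have "cmod (complex_of_real (\<psi> v - 1)) \<le> 1 / 2" by simp
  then show ?thesis unfolding norm_of_real by linarith
qed

lemma \<psi>_meas [measurable]: "\<psi> \<in> borel_measurable borel"
proof -
  have "\<psi> = (\<lambda>u. Re (LINT t|lborel. of_real (\<rho> t) * cis (- (t * u))))" by (simp add: \<rho>_fourier)
  also have "\<dots> \<in> borel_measurable borel" by measurable
  finally show ?thesis .
qed

lemma \<psi>_le_1: "\<psi> u \<le> 1"
proof -
  have "\<psi> u = cmod (LINT t|lborel. of_real (moll 1 t) * cis (- (t * u)))"
    using moll_fourier[of 1 u] \<psi>_nonneg[of u] by simp
  also have "\<dots> \<le> (LINT t|lborel. moll 1 t)"
  proof (rule norm_integral_le_AE[OF _ _ AE_I2])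
    show "integrable lborel (\<lambda>t. complex_of_real (moll 1 t) * cis (- (t * u)))"
      by (rule Bochner_Integration.integrable_bound[OF integrable_moll[of 1]]) (auto simp: norm_mult)
  qed (use integrable_moll[of 1] moll_nonneg[of 1] in \<open>auto simp: norm_mult\<close>)
  finally show ?thesis using moll_integral[of 1] by simp
qed

end

lemma Re_inverse_pos: "Re s > 1 \<Longrightarrow> 1 / (s - 1) \<notin> \<real>\<^sub>\<le>\<^sub>0"
proof -
  assume s: "Re s > 1"
  then have "s - 1 \<noteq> 0" by auto
  then have "Re (1 / (s - 1)) > 0" using s by (simp add: Re_divide sum_power2_gt_zero_iff complex_eq_iff)
  then show ?thesis by (auto simp: complex_nonpos_Reals_iff)
qed

lemma holomorphic_Ln_inverse: "(\<lambda>s. Ln (1 / (s - 1))) holomorphic_on {s. Re s > 1}"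
  using Re_inverse_pos by (intro holomorphic_intros) auto

lemma continuous_on_vertical:
  assumes "h holomorphic_on {s. Re s > 1}" "\<sigma> > 1"
  shows "continuous_on A (\<lambda>\<tau>. h (Complex \<sigma> (t + \<tau>)))"
proof (rule continuous_on_compose2[OF holomorphic_on_imp_continuous_on[OF assms(1)]])
  show "continuous_on A (\<lambda>\<tau>. Complex \<sigma> (t + \<tau>))" unfolding Complex_eq by (intro continuous_intros)
qed (use assms in auto)

lemma exp_Complex_mult: "exp (- Complex \<sigma> t * of_real v) = of_real (exp (- \<sigma> * v)) * cis (- (t * v))"
  by (simp add: cis_conv_exp exp_of_real[symmetric] Complex_eq algebra_simps flip: exp_add)

text \<open>The positive measure is given by \<open>M\<close> together with positions
  \<open>u\<close>, so that prime powers with their weights and logarithms can be inserted directly.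
  Convergence to \<open>g\<close> is assumed in the sense of distributions only.\<close>

locale laplace_boundary = mollifier \<rho> \<psi> + sigma_finite_measure M
  for \<rho> \<psi> :: "real \<Rightarrow> real" and M :: "'a measure" +
  fixes u :: "'a \<Rightarrow> real" and G g :: "_ \<Rightarrow> complex" and \<eta> :: real
  assumes u_meas [measurable]: "u \<in> borel_measurable M" and u_nonneg: "\<And>x. u x \<ge> 0"
    and int: "\<And>\<sigma>. \<sigma> > 1 \<Longrightarrow> integrable M (\<lambda>x. exp (- \<sigma> * u x))"
    and G_eq: "\<And>s. Re s > 1 \<Longrightarrow> G s = (LINT x|M. exp (- s * of_real (u x))) - Ln (1 / (s - 1))"
    and G_hol: "G holomorphic_on {s. Re s > 1}"
    and g_cont: "continuous_on {-\<eta><..<\<eta>} g" and \<eta>: "\<eta> > 0"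
    and conv: "\<And>\<phi>. \<phi> \<in> test_functions {-\<eta><..<\<eta>} \<Longrightarrow>
        ((\<lambda>\<sigma>. LINT t|lborel. G (Complex \<sigma> t) * \<phi> t) \<longlongrightarrow> (LINT t|lborel. g t * \<phi> t)) (at_right 1)"
begin

definition Lf :: "complex \<Rightarrow> complex" where "Lf s = (LINT x|M. exp (- s * of_real (u x)))"

definition Ln1 :: "complex \<Rightarrow> complex" where "Ln1 s = Ln (1 / (s - 1))"

text \<open>Damped mass in a window of width about \<open>1 / e\<close> around \<open>w\<close>. It
  is the pairing of \<open>Lf\<close> on the line \<open>\<sigma>\<close> with the mollifier of
  frequency \<open>w\<close>, in a form that is visibly nonnegative and nonincreasing in
  \<open>\<sigma>\<close>.\<close>

definition X :: "real \<Rightarrow> real \<Rightarrow> real \<Rightarrow> real" where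
  "X e w \<sigma> = (LINT x|M. exp (- \<sigma> * u x) * \<psi> (e * (u x - w)))"

lemma Lf_eq: "Re s > 1 \<Longrightarrow> Lf s = G s + Ln1 s" by (simp add: Lf_def Ln1_def G_eq)

lemma Ln1_hol: "Ln1 holomorphic_on {s. Re s > 1}"
  unfolding Ln1_def[abs_def] by (rule holomorphic_Ln_inverse)

lemma Ln1_Complex: "Ln1 (Complex \<sigma> x) = Ln (1 / Complex (\<sigma> - 1) x)"
proof -
  have "Complex \<sigma> x - 1 = Complex (\<sigma> - 1) x" by (simp add: complex_eq_iff)
  then show ?thesis by (simp add: Ln1_def)
qed

lemma Lf_hol: "Lf holomorphic_on {s. Re s > 1}"
  by (rule holomorphic_transform[of "\<lambda>s. G s + Ln1 s"]) (auto intro!: holomorphic_intros G_hol Ln1_hol simp: Lf_eq)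

lemma norm_Lf_le: "Re s > 1 \<Longrightarrow> cmod (Lf s) \<le> (LINT x|M. exp (- Re s * u x))"
  unfolding Lf_def
proof (rule norm_integral_le_AE[OF _ _ AE_I2])
  assume s: "Re s > 1"
  show "integrable M (\<lambda>x. exp (- Re s * u x))" by (rule int[OF s])
  show "integrable M (\<lambda>x. exp (- s * complex_of_real (u x)))"
    by (rule Bochner_Integration.integrable_bound[OF int[OF s]]) auto
qed simp

lemma integrable_X: "\<sigma> > 1 \<Longrightarrow> integrable M (\<lambda>x. exp (- \<sigma> * u x) * \<psi> (e * (u x - w)))"
proof (rule Bochner_Integration.integrable_bound[OF int])
  show "AE x in M. norm (exp (- \<sigma> * u x) * \<psi> (e * (u x - w))) \<le> norm (exp (- \<sigma> * u x))"
    using \<psi>_nonneg \<psi>_le_1 by (intro AE_I2) (simp add: abs_mult)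
qed auto

lemma X_nonneg: "X e w \<sigma> \<ge> 0"
  unfolding X_def by (intro Bochner_Integration.integral_nonneg mult_nonneg_nonneg \<psi>_nonneg) auto

lemma X_antimono: "1 < \<sigma> \<Longrightarrow> \<sigma> \<le> \<sigma>' \<Longrightarrow> X e w \<sigma>' \<le> X e w \<sigma>"
  unfolding X_def using u_nonneg \<psi>_nonneg
  by (intro integral_mono integrable_X mult_right_mono) (auto intro: mult_right_mono)

text \<open>Averaging over heights acts on each exponential separately, so it weights the measure by
  the transform of the mollifier, centred at \<open>w\<close> because of the modulation.\<close>

lemma Lf_moll:
  assumes e: "e > 0" and \<sigma>: "\<sigma> > 1"
  shows "(LINT \<tau>|lborel. Lf (Complex \<sigma> (t + \<tau>)) * (cis (w * \<tau>) * of_real (moll e \<tau>))) =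
         (LINT x|M. exp (- Complex \<sigma> t * of_real (u x)) * of_real (\<psi> (e * (u x - w))))"
proof -
  interpret P: pair_sigma_finite lborel M ..
  note [measurable] = moll_meas[OF e]
  have "(LINT \<tau>|lborel. Lf (Complex \<sigma> (t + \<tau>)) * (cis (w * \<tau>) * of_real (moll e \<tau>))) =
     (LINT \<tau>|lborel. LINT x|M. exp (- Complex \<sigma> (t + \<tau>) * of_real (u x)) * (cis (w * \<tau>) * of_real (moll e \<tau>)))"
    unfolding Lf_def by (simp only: integral_mult_left_zero)
  also have "\<dots> = (LINT \<tau>|lborel. LINT x|M. of_real (exp (- \<sigma> * u x)) * cis (- ((t + \<tau>) * u x)) * (cis (w * \<tau>) * of_real (moll e \<tau>)))"
    by (simp only: exp_Complex_mult)
  also have "\<dots> = (LINT x|M. LINT \<tau>|lborel. of_real (exp (- \<sigma> * u x)) * cis (- ((t + \<tau>) * u x)) * (cis (w * \<tau>) * of_real (moll e \<tau>)))"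
    by (rule P.fubini_swap_bound[OF _ integrable_moll[OF e] int[OF \<sigma>]])
       (auto simp: norm_mult moll_nonneg[OF e])
  also have "\<dots> = (LINT x|M. exp (- Complex \<sigma> t * of_real (u x)) * of_real (\<psi> (e * (u x - w))))"
  proof (intro Bochner_Integration.integral_cong refl)
    fix x
    have "cis (- ((t + \<tau>) * u x)) * cis (w * \<tau>) = cis (- (t * u x)) * cis (- (\<tau> * (u x - w)))" for \<tau>
      by (simp add: cis_mult algebra_simps)
    then have "(LINT \<tau>|lborel. of_real (exp (- \<sigma> * u x)) * cis (- ((t + \<tau>) * u x)) * (cis (w * \<tau>) * of_real (moll e \<tau>))) =
       (LINT \<tau>|lborel. (of_real (exp (- \<sigma> * u x)) * cis (- (t * u x))) * (of_real (moll e \<tau>) * cis (- (\<tau> * (u x - w)))))"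
      by (intro Bochner_Integration.integral_cong refl) (simp add: mult_ac)
    then show "(LINT \<tau>|lborel. of_real (exp (- \<sigma> * u x)) * cis (- ((t + \<tau>) * u x)) * (cis (w * \<tau>) * of_real (moll e \<tau>))) =
      exp (- Complex \<sigma> t * of_real (u x)) * of_real (\<psi> (e * (u x - w)))"
      by (simp only: integral_mult_right_zero moll_fourier[OF e] exp_Complex_mult)
  qed
  finally show ?thesis .
qed

lemma integrable_line:
  assumes "h holomorphic_on {s. Re s > 1}" "\<sigma> > 1" "e > 0"
  shows "integrable lborel (\<lambda>\<tau>. h (Complex \<sigma> (t + \<tau>)) * (cis (w * \<tau>) * of_real (moll e \<tau>)))"
proof -
  have "integrable lborel (\<lambda>\<tau>. (h (Complex \<sigma> (t + \<tau>)) * cis (w * \<tau>)) * of_real (moll e \<tau>))"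
    by (intro integrable_moll_mult continuous_intros continuous_on_vertical assms)
  then show ?thesis by (simp add: mult.assoc)
qed

lemma moll_bdd: "e > 0 \<Longrightarrow> \<exists>B\<ge>0. \<forall>t. moll e t \<le> B"
proof -
  assume e: "e > 0"
  have "compact (moll e ` {-2 * e..2 * e})" by (intro compact_continuous_image moll_cont e) auto
  then obtain B where B: "\<And>t. t \<in> {-2 * e..2 * e} \<Longrightarrow> \<bar>moll e t\<bar> \<le> B"
    by (metis bounded_iff compact_imp_bounded imageI real_norm_def)
  have B0: "B \<ge> 0" using B[of 0] e by (simp add: order.trans[OF abs_ge_zero])
  have "moll e t \<le> B" for t
  proof (cases "t \<in> {-2 * e..2 * e}")
    case False
    then have "\<bar>t\<bar> \<ge> 2 * e" by auto
    then show ?thesis using B0 by (simp add: moll_supp[OF e])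
  qed (use B[of t] in auto)
  then show ?thesis using B0 by blast
qed

text \<open>The admissible test function is centred at \<open>t\<close>; passing to the variable
  \<open>\<tau>\<close> leaves the constant phase \<open>cis (w * t)\<close>, which is divided
  out.\<close>

lemma conv_shift:
  assumes e: "e > 0" and t: "\<bar>t\<bar> + 2 * e < \<eta>"
  shows "((\<lambda>\<sigma>. LINT \<tau>|lborel. G (Complex \<sigma> (t + \<tau>)) * (cis (w * \<tau>) * of_real (moll e \<tau>))) \<longlongrightarrow>
     (LINT \<tau>|lborel. g (t + \<tau>) * (cis (w * \<tau>) * of_real (moll e \<tau>)))) (at_right 1)"
proof -
  let ?\<phi> = "\<lambda>x. cis (w * x) * complex_of_real (\<rho> ((x - t) / e) / e)"
  have "?\<phi> \<in> test_functions {-\<eta><..<\<eta>}"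
    using e t by (intro \<rho>_test) auto
  from tendsto_mult_left[OF conv[OF this], of "cis (- (w * t))"]
  have "((\<lambda>\<sigma>. cis (- (w * t)) * (LINT x|lborel. G (Complex \<sigma> x) * ?\<phi> x)) \<longlongrightarrow> cis (- (w * t)) * (LINT x|lborel. g x * ?\<phi> x)) (at_right 1)" .
  moreover have "cis (- (w * t)) * (LINT x|lborel. H x * ?\<phi> x) = (LINT \<tau>|lborel. H (t + \<tau>) * (cis (w * \<tau>) * of_real (moll e \<tau>)))" for H
  proof -
    have "(LINT x|lborel. H x * ?\<phi> x) = (LINT \<tau>|lborel. H (t + \<tau>) * ?\<phi> (t + \<tau>))"
      using lborel_integral_real_affine[of 1 "\<lambda>x. H x * ?\<phi> x" t] by simp
    then have "cis (- (w * t)) * (LINT x|lborel. H x * ?\<phi> x) = (LINT \<tau>|lborel. cis (- (w * t)) * (H (t + \<tau>) * ?\<phi> (t + \<tau>)))"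
      by (simp only: integral_mult_right_zero)
    also have "\<dots> = (LINT \<tau>|lborel. H (t + \<tau>) * (cis (w * \<tau>) * of_real (moll e \<tau>)))"
    proof (intro Bochner_Integration.integral_cong refl)
      fix \<tau>
      have "cis (- (w * t)) * cis (w * (t + \<tau>)) = cis (w * \<tau>)" by (simp add: cis_mult algebra_simps)
      then show "cis (- (w * t)) * (H (t + \<tau>) * ?\<phi> (t + \<tau>)) = H (t + \<tau>) * (cis (w * \<tau>) * of_real (moll e \<tau>))"
        by (simp add: moll_def mult_ac)
    qed
    finally show ?thesis .
  qed
  ultimately show ?thesis by simp
qed

lemma integrable_g_moll:
  assumes e: "e > 0" and t: "\<bar>t\<bar> + 2 * e < \<eta>"
  shows "integrable lborel (\<lambda>\<tau>. g (t + \<tau>) * (cis (w * \<tau>) * of_real (moll e \<tau>)))"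
proof -
  have "integrable lborel (\<lambda>\<tau>. (g (t + \<tau>) * cis (w * \<tau>)) * of_real (moll e \<tau>))"
    by (intro integrable_moll_mult continuous_intros e continuous_on_compose2[OF g_cont]) (use t in auto)
  then show ?thesis by (simp add: mult.assoc)
qed

lemma X_split:
  assumes e: "e > 0" and \<sigma>: "\<sigma> > 1"
  shows "complex_of_real (X e w \<sigma>) = (LINT \<tau>|lborel. G (Complex \<sigma> (0 + \<tau>)) * (cis (w * \<tau>) * of_real (moll e \<tau>)))
      + (LINT \<tau>|lborel. Ln1 (Complex \<sigma> (0 + \<tau>)) * (cis (w * \<tau>) * of_real (moll e \<tau>)))"
proof -
  have "complex_of_real (X e w \<sigma>) = (LINT x|M. exp (- Complex \<sigma> 0 * of_real (u x)) * of_real (\<psi> (e * (u x - w))))"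
    unfolding X_def exp_Complex_mult by (simp flip: integral_complex_of_real)
  also have "\<dots> = (LINT \<tau>|lborel. Lf (Complex \<sigma> (0 + \<tau>)) * (cis (w * \<tau>) * of_real (moll e \<tau>)))"
    by (rule Lf_moll[symmetric, OF e \<sigma>])
  also have "\<dots> = (LINT \<tau>|lborel. G (Complex \<sigma> (0 + \<tau>)) * (cis (w * \<tau>) * of_real (moll e \<tau>)) + Ln1 (Complex \<sigma> (0 + \<tau>)) * (cis (w * \<tau>) * of_real (moll e \<tau>)))"
    using \<sigma> by (simp add: Lf_eq distrib_right)
  finally show ?thesis
    using integrable_line[OF G_hol \<sigma> e, of 0 w] integrable_line[OF Ln1_hol \<sigma> e, of 0 w] by simp
qed

text \<open>For each \<open>w\<close>, boundary convergence yields the bound at some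
  \<open>\<sigma>'\<close> close to 1 that depends on \<open>w\<close>; monotonicity of
  \<open>X\<close> then carries it to all larger \<open>\<sigma>\<close>. The size of the bound is
  independent of \<open>w\<close> because a character of modulus 1 changes neither the estimate of
  \<open>g\<close> nor that of the logarithm.\<close>

lemma X_bounded: "\<exists>C\<ge>0. \<forall>w \<sigma>. \<sigma> > 1 \<longrightarrow> X (\<eta> / 4) w \<sigma> \<le> C"
proof -
  define e where "e = \<eta> / 4"
  have e: "e > 0" "2 * e < \<eta>" using \<eta> by (auto simp: e_def)
  obtain B where B: "B \<ge> 0" "\<And>t. moll e t \<le> B" using moll_bdd[OF e(1)] by blast
  define C2 where "C2 = (LINT x|lborel. B * (indicator {-2*e..2*e} x * log_bound (2 * e) x))"
  have iC2: "integrable lborel (\<lambda>x. B * (indicator {-2*e..2*e} x * log_bound (2 * e) x))"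
    using integrable_log_bound[of "2 * e"] e by simp
  have "compact (g ` {-2*e..2*e})"
    by (intro compact_continuous_image continuous_on_subset[OF g_cont]) (use e in auto)
  then obtain Gm where Gm: "\<And>t. t \<in> {-2*e..2*e} \<Longrightarrow> cmod (g t) \<le> Gm"
    by (metis bounded_iff compact_imp_bounded imageI)
  have lg: "cmod (LINT \<tau>|lborel. Ln1 (Complex \<sigma> (0 + \<tau>)) * (cis (w * \<tau>) * of_real (moll e \<tau>))) \<le> C2" if "1 < \<sigma>" "\<sigma> < 2" for \<sigma> w
    unfolding C2_def
  proof (rule norm_integral_le_AE[OF integrable_line[OF Ln1_hol that(1) e(1)] iC2])
    show "AE \<tau> in lborel. cmod (Ln1 (Complex \<sigma> (0 + \<tau>)) * (cis (w * \<tau>) * of_real (moll e \<tau>))) \<le> B * (indicator {-2*e..2*e} \<tau> * log_bound (2 * e) \<tau>)"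
    proof (rule AE_mp[OF AE_lborel_singleton[of 0]], intro AE_I2 impI)
      fix x :: real assume x: "x \<noteq> 0"
      show "cmod (Ln1 (Complex \<sigma> (0 + x)) * (cis (w * x) * of_real (moll e x))) \<le> B * (indicator {-2*e..2*e} x * log_bound (2 * e) x)"
      proof (cases "x \<in> {-2*e..2*e}")
        case True
        have "cmod (Ln1 (Complex \<sigma> (0 + x))) \<le> log_bound (2 * e) x"
          unfolding Ln1_Complex using norm_Ln_inverse_le_log_bound[OF x, of "2 * e" "\<sigma> - 1"] True that by auto
        then have "cmod (Ln1 (Complex \<sigma> (0 + x))) * moll e x \<le> log_bound (2 * e) x * B"
          using B moll_nonneg[OF e(1)] by (intro mult_mono) (auto intro: order.trans[OF norm_ge_zero])
        then show ?thesis using True moll_nonneg[OF e(1), of x] by (simp add: norm_mult mult.commute)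
      next
        case False
        then have "\<bar>x\<bar> \<ge> 2 * e" by auto
        then show ?thesis using False by (simp add: moll_supp[OF e(1)])
      qed
    qed
  qed
  have gb: "cmod (LINT \<tau>|lborel. g (0 + \<tau>) * (cis (w * \<tau>) * of_real (moll e \<tau>))) \<le> Gm" for w
  proof -
    have "cmod ((LINT \<tau>|lborel. (g (0 + \<tau>) * cis (w * \<tau>)) * of_real (moll e \<tau>)) - 0) \<le> Gm"
    proof (rule moll_close[OF e(1)])
      show "integrable lborel (\<lambda>\<tau>. (g (0 + \<tau>) * cis (w * \<tau>)) * of_real (moll e \<tau>))"
        using integrable_g_moll[OF e(1), of 0 w] e by (simp add: mult.assoc)
      show "cmod (g (0 + \<tau>) * cis (w * \<tau>) - 0) \<le> Gm" if "\<bar>\<tau>\<bar> \<le> 2 * e" for \<tau>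
        using Gm[of \<tau>] that by (simp add: norm_mult abs_le_iff)
    qed
    then show ?thesis by (simp add: mult.assoc)
  qed
  have "X e w \<sigma> \<le> Gm + 1 + C2" if \<sigma>: "\<sigma> > 1" for w \<sigma>
  proof -
    have "((\<lambda>\<sigma>. cmod (LINT \<tau>|lborel. G (Complex \<sigma> (0 + \<tau>)) * (cis (w * \<tau>) * of_real (moll e \<tau>)))) \<longlongrightarrow>
        cmod (LINT \<tau>|lborel. g (0 + \<tau>) * (cis (w * \<tau>) * of_real (moll e \<tau>)))) (at_right 1)"
      by (intro tendsto_norm conv_shift) (use e in auto)
    then have "\<forall>\<^sub>F \<sigma>' in at_right 1. cmod (LINT \<tau>|lborel. G (Complex \<sigma>' (0 + \<tau>)) * (cis (w * \<tau>) * of_real (moll e \<tau>))) < Gm + 1"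
      using gb[of w] by (intro order_tendstoD(2)) auto
    moreover have "\<forall>\<^sub>F \<sigma>' in at_right 1. \<sigma>' \<in> {1<..<min \<sigma> 2}" using \<sigma> by (intro eventually_at_right_real) auto
    ultimately have "\<forall>\<^sub>F \<sigma>' in at_right 1. cmod (LINT \<tau>|lborel. G (Complex \<sigma>' (0 + \<tau>)) * (cis (w * \<tau>) * of_real (moll e \<tau>))) < Gm + 1 \<and> \<sigma>' \<in> {1<..<min \<sigma> 2}"
      by eventually_elim auto
    then obtain \<sigma>' where s': "cmod (LINT \<tau>|lborel. G (Complex \<sigma>' (0 + \<tau>)) * (cis (w * \<tau>) * of_real (moll e \<tau>))) < Gm + 1" "1 < \<sigma>'" "\<sigma>' < \<sigma>" "\<sigma>' < 2"
      using eventually_happens'[OF trivial_limit_at_right_real] by fastforce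
    have "X e w \<sigma> \<le> X e w \<sigma>'" using s' by (intro X_antimono) auto
    also have "\<dots> = cmod (complex_of_real (X e w \<sigma>'))" using X_nonneg[of e w \<sigma>'] by simp
    also have "\<dots> \<le> (Gm + 1) + C2"
      unfolding X_split[OF e(1) s'(2)] using s' lg[OF s'(2,4), of w] by (intro order.trans[OF norm_triangle_ineq]) auto
    finally show ?thesis .
  qed
  then show ?thesis unfolding e_def[symmetric]
    by (intro exI[of _ "Gm + 1 + C2"]) (use order.trans[OF X_nonneg[of e 0 2]] in auto)
qed

text \<open>The half-line is covered by windows starting at \<open>r0 * n\<close>, each of damped
  mass bounded by a multiple of \<open>C\<close>. In the exponent \<open>1 + 2 * \<delta>\<close>,
  the part \<open>1 + \<delta>\<close> is spent on the window bound and the remaining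
  \<open>\<delta>\<close> gives geometric decay in \<open>n\<close>, whose sum is of order
  \<open>1 / \<delta>\<close>.\<close>

lemma Laplace_growth: "\<exists>C\<ge>0. \<forall>\<sigma>. 1 < \<sigma> \<and> \<sigma> \<le> 2 \<longrightarrow> (LINT x|M. exp (- \<sigma> * u x)) \<le> C / (\<sigma> - 1)"
proof -
  obtain C where C: "C \<ge> 0" "\<And>w \<sigma>. \<sigma> > 1 \<Longrightarrow> X (\<eta> / 4) w \<sigma> \<le> C" using X_bounded by blast
  \<comment> \<open>With scale \<open>\<eta> / 4\<close> and window length \<open>1 / \<eta>\<close>
    the argument of \<open>\<psi>\<close> stays in \<open>[0, 1/4]\<close>, as
    \<open>\<psi>_ge_half\<close> requires.\<close>
  define r0 where "r0 = 1 / \<eta>"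
  have r0: "r0 > 0" using \<eta> by (simp add: r0_def)
  have bound: "(LINT x|M. exp (- (1 + 2 * \<delta>) * u x)) \<le> 2 * C * (1 + 1 / (\<delta> * r0))" if \<delta>: "\<delta> > 0" for \<delta>
  proof -
    define a where "a = exp (- (\<delta> * r0))"
    have a: "0 < a" "a < 1" using \<delta> r0 by (auto simp: a_def)
    have "ennreal (LINT x|M. exp (- (1 + 2 * \<delta>) * u x)) = (\<integral>\<^sup>+x. ennreal (exp (- (1 + 2 * \<delta>) * u x)) \<partial>M)"
      using \<delta> by (intro nn_integral_eq_integral[symmetric] int) auto
    also have "\<dots> \<le> (\<integral>\<^sup>+x. (\<Sum>n. ennreal (2 * a ^ n * (exp (- (1 + \<delta>) * u x) * \<psi> (\<eta> / 4 * (u x - r0 * real n))))) \<partial>M)"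
    proof (rule nn_integral_mono)
      fix x
      define n where "n = nat \<lfloor>u x / r0\<rfloor>"
      have "u x / r0 \<ge> 0" using u_nonneg[of x] r0 by simp
      then have n: "real n \<le> u x / r0" "u x / r0 < real n + 1" by (auto simp: n_def)
      have n': "r0 * real n \<le> u x" "u x - r0 * real n \<le> r0" using n r0 by (auto simp: field_simps)
      have "\<bar>\<eta> / 4 * (u x - r0 * real n)\<bar> \<le> \<eta> / 4 * r0" using n' \<eta> by (auto simp: abs_mult)
      also have "\<dots> = 1 / 4" using \<eta> by (simp add: r0_def)
      finally have p: "\<psi> (\<eta> / 4 * (u x - r0 * real n)) \<ge> 1 / 2" by (rule \<psi>_ge_half)
      have "exp (- (1 + 2 * \<delta>) * u x) = exp (- (\<delta> * u x)) * exp (- (1 + \<delta>) * u x) * 1"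
        by (simp add: algebra_simps flip: exp_add)
      also have "\<dots> \<le> a ^ n * exp (- (1 + \<delta>) * u x) * (2 * \<psi> (\<eta> / 4 * (u x - r0 * real n)))"
      proof (intro mult_mono)
        have "exp (- (\<delta> * u x)) \<le> exp (- (\<delta> * (r0 * real n)))" using n' \<delta> by simp
        also have "\<dots> = a ^ n" by (simp add: a_def mult_ac flip: exp_of_nat_mult)
        finally show "exp (- (\<delta> * u x)) \<le> a ^ n" .
      qed (use a p in auto)
      finally have "ennreal (exp (- (1 + 2 * \<delta>) * u x)) \<le> ennreal (2 * a ^ n * (exp (- (1 + \<delta>) * u x) * \<psi> (\<eta> / 4 * (u x - r0 * real n))))"
        by (intro ennreal_leI) (simp add: mult_ac)
      also have "\<dots> \<le> (\<Sum>n. ennreal (2 * a ^ n * (exp (- (1 + \<delta>) * u x) * \<psi> (\<eta> / 4 * (u x - r0 * real n)))))"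
        using sum_le_suminf[of "\<lambda>n. ennreal (2 * a ^ n * (exp (- (1 + \<delta>) * u x) * \<psi> (\<eta> / 4 * (u x - r0 * real n))))" "{n}"] by simp
      finally show "ennreal (exp (- (1 + 2 * \<delta>) * u x)) \<le> (\<Sum>n. ennreal (2 * a ^ n * (exp (- (1 + \<delta>) * u x) * \<psi> (\<eta> / 4 * (u x - r0 * real n)))))" .
    qed
    also have "\<dots> = (\<Sum>n. \<integral>\<^sup>+x. ennreal (2 * a ^ n * (exp (- (1 + \<delta>) * u x) * \<psi> (\<eta> / 4 * (u x - r0 * real n)))) \<partial>M)"
      by (rule nn_integral_suminf) measurable
    also have "\<dots> \<le> (\<Sum>n. ennreal (2 * C * a ^ n))"
    proof (rule suminf_le)
      fix n
      have "(\<integral>\<^sup>+x. ennreal (2 * a ^ n * (exp (- (1 + \<delta>) * u x) * \<psi> (\<eta> / 4 * (u x - r0 * real n)))) \<partial>M) =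
         ennreal (LINT x|M. 2 * a ^ n * (exp (- (1 + \<delta>) * u x) * \<psi> (\<eta> / 4 * (u x - r0 * real n))))"
        using \<delta> a \<psi>_nonneg by (intro nn_integral_eq_integral integrable_mult_right integrable_X) auto
      also have "(LINT x|M. 2 * a ^ n * (exp (- (1 + \<delta>) * u x) * \<psi> (\<eta> / 4 * (u x - r0 * real n)))) = 2 * a ^ n * X (\<eta> / 4) (r0 * real n) (1 + \<delta>)"
        by (simp only: integral_mult_right_zero X_def)
      also have "\<dots> \<le> 2 * a ^ n * C" using a \<delta> by (intro mult_left_mono C) auto
      finally show "(\<integral>\<^sup>+x. ennreal (2 * a ^ n * (exp (- (1 + \<delta>) * u x) * \<psi> (\<eta> / 4 * (u x - r0 * real n)))) \<partial>M) \<le> ennreal (2 * C * a ^ n)"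
        by (simp add: mult_ac ennreal_leI)
    qed auto
    also have "\<dots> = ennreal (\<Sum>n. 2 * C * a ^ n)"
      using a C by (intro suminf_ennreal2 summable_mult summable_geometric) auto
    also have "(\<Sum>n. 2 * C * a ^ n) = 2 * C * (1 / (1 - a))"
      using a by (subst suminf_mult) (auto simp: suminf_geometric summable_geometric)
    finally have "(LINT x|M. exp (- (1 + 2 * \<delta>) * u x)) \<le> 2 * C * (1 / (1 - a))"
      using a C by (subst (asm) ennreal_le_iff) auto
    also have "\<dots> \<le> 2 * C * (1 + 1 / (\<delta> * r0))"
    proof (intro mult_left_mono)
      define y where "y = \<delta> * r0"
      have y: "y > 0" using \<delta> r0 by (simp add: y_def)
      have "(1 + y) * a \<le> 1" using exp_ge_add_one_self[of y] y by (simp add: a_def y_def[symmetric] exp_minus field_simps)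
      then have "y \<le> (1 + y) * (1 - a)" by (simp add: algebra_simps)
      then have "1 / (1 - a) \<le> (1 + y) / y" using y a by (simp add: field_simps)
      then show "1 / (1 - a) \<le> 1 + 1 / (\<delta> * r0)" using y by (simp add: y_def[symmetric] add_divide_distrib)
    qed (use C in auto)
    finally show ?thesis .
  qed
  show ?thesis
  proof (intro exI[of _ "2 * C * (1 + 2 / r0)"] conjI allI impI)
    fix \<sigma> :: real assume s: "1 < \<sigma> \<and> \<sigma> \<le> 2"
    define \<delta> where "\<delta> = (\<sigma> - 1) / 2"
    have "(LINT x|M. exp (- \<sigma> * u x)) \<le> 2 * C * (1 + 1 / (\<delta> * r0))"
    proof -
      have "1 + 2 * \<delta> = \<sigma>" "\<delta> > 0" using s by (auto simp: \<delta>_def field_simps)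
      with bound[of \<delta>] show ?thesis by simp
    qed
    also have "\<dots> = 2 * C * ((\<sigma> - 1) + 2 / r0) / (\<sigma> - 1)"
      using s r0 by (simp add: \<delta>_def field_simps)
    also have "\<dots> \<le> 2 * C * (1 + 2 / r0) / (\<sigma> - 1)"
      using s C by (intro divide_right_mono mult_left_mono) auto
    finally show "(LINT x|M. exp (- \<sigma> * u x)) \<le> 2 * C * (1 + 2 / r0) / (\<sigma> - 1)" .
  qed (use C r0 in auto)
qed

lemma G_growth: "\<exists>C\<ge>0. \<forall>s. 1 < Re s \<and> Re s \<le> 2 \<and> \<bar>Im s\<bar> \<le> \<eta> \<longrightarrow> cmod (G s) \<le> C / (Re s - 1)"
proof -
  obtain C where C: "C \<ge> 0" "\<And>\<sigma>. 1 < \<sigma> \<Longrightarrow> \<sigma> \<le> 2 \<Longrightarrow> (LINT x|M. exp (- \<sigma> * u x)) \<le> C / (\<sigma> - 1)" using Laplace_growth by blast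
  show ?thesis
  proof (intro exI[of _ "C + (1 + \<eta> + pi + 2)"] conjI allI impI)
    fix s assume s: "1 < Re s \<and> Re s \<le> 2 \<and> \<bar>Im s\<bar> \<le> \<eta>"
    define d where "d = Re s - 1"
    have d: "0 < d" "d \<le> 1" using s by (auto simp: d_def)
    have "G s = Lf s - Ln1 s" using s by (simp add: Lf_eq)
    then have "cmod (G s) \<le> cmod (Lf s) + cmod (Ln1 s)" by (simp add: norm_triangle_ineq4)
    also have "cmod (Lf s) \<le> C / d" unfolding d_def using s by (intro order.trans[OF norm_Lf_le] C) auto
    also have "cmod (Ln1 s) \<le> (1 + \<eta> + pi + 2) / d"
    proof -
      have z: "s - 1 \<noteq> 0" using s by auto
      have "cmod (Ln1 s) \<le> cmod (s - 1) + 2 / sqrt (cmod (s - 1)) + pi" unfolding Ln1_def by (rule norm_Ln_inverse_le[OF z])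
      moreover have "cmod (s - 1) \<le> 1 + \<eta>" using cmod_le[of "s - 1"] s by simp
      moreover have "2 / sqrt (cmod (s - 1)) \<le> 2 / d"
      proof (rule divide_left_mono)
        have "d \<le> sqrt d" using d by (simp add: real_le_rsqrt power2_eq_square mult_left_le)
        also have "sqrt d \<le> sqrt (cmod (s - 1))" using abs_Re_le_cmod[of "s - 1"] by (simp add: d_def)
        finally show "d \<le> sqrt (cmod (s - 1))" .
      qed (use d z in auto)
      moreover have "1 + \<eta> + pi \<le> (1 + \<eta> + pi) / d" using d \<eta> by (simp add: le_divide_eq mult_left_le)
      ultimately show ?thesis by (simp add: add_divide_distrib)
    qed
    finally show "cmod (G s) \<le> (C + (1 + \<eta> + pi + 2)) / (Re s - 1)" by (simp add: d_def add_divide_distrib)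
  qed (use C \<eta> in auto)
qed

end

section \<open>Mollified functions up to the boundary line\<close>

context laplace_boundary
begin

definition F :: "real \<Rightarrow> complex \<Rightarrow> complex" where
  "F e s = (LINT \<tau>|lborel. G (s + \<i> * of_real \<tau>) * of_real (moll e \<tau>))"

definition F0 :: "real \<Rightarrow> real \<Rightarrow> complex" where
  "F0 e t = (LINT \<tau>|lborel. g (t + \<tau>) * of_real (moll e \<tau>))"

definition Y :: "real \<Rightarrow> real" where
  "Y \<sigma> = (LINT x|lborel. indicator {-\<eta>..\<eta>} x * cmod (Ln (1 / Complex (\<sigma> - 1) x) - Ln (1 / Complex 0 x)))"

lemma F_Complex: "F e (Complex \<sigma> t) = (LINT \<tau>|lborel. G (Complex \<sigma> (t + \<tau>)) * of_real (moll e \<tau>))"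
proof -
  have "Complex \<sigma> t + \<i> * complex_of_real \<tau> = Complex \<sigma> (t + \<tau>)" for \<tau> by (simp add: complex_eq_iff)
  then show ?thesis by (simp only: F_def)
qed

lemma integrable_F:
  assumes "e > 0" "Re s > 1" shows "integrable lborel (\<lambda>\<tau>. G (s + \<i> * of_real \<tau>) * of_real (moll e \<tau>))"
  by (intro integrable_moll_mult assms continuous_on_compose2[OF holomorphic_on_imp_continuous_on[OF G_hol]] continuous_intros)
     (use assms in auto)

text \<open>The logarithm is unbounded near height 0, so it converges in mean rather than uniformly;
  a bounded mollifier converts the mean distance \<open>Y\<close> into a bound uniform in
  \<open>t\<close>.\<close>

lemma Ln_moll_diff:
  assumes e: "e > 0" and t: "\<bar>t\<bar> + 2 * e < \<eta>" and B: "\<And>x. moll e x \<le> B" and \<sigma>: "1 < \<sigma>" "\<sigma> < 2"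
  shows "cmod ((LINT \<tau>|lborel. Ln1 (Complex \<sigma> (t + \<tau>)) * of_real (moll e \<tau>)) -
               (LINT \<tau>|lborel. Ln (1 / Complex 0 (t + \<tau>)) * of_real (moll e \<tau>))) \<le> B * Y \<sigma>"
proof -
  note [measurable] = moll_meas[OF e]
  have B0: "B \<ge> 0" using B[of "2 * e"] e by (simp add: moll_supp)
  have ib: "integrable lborel (\<lambda>x. indicator {-\<eta>..\<eta>} x * log_bound \<eta> x)" using integrable_log_bound[of \<eta>] \<eta> by simp
  have lb: "AE \<tau> in lborel. \<bar>t + \<tau>\<bar> \<le> \<eta> \<longrightarrow> cmod (Ln (1 / Complex \<delta> (t + \<tau>))) \<le> log_bound \<eta> (t + \<tau>)" if "0 \<le> \<delta>" "\<delta> \<le> 1" for \<delta>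
    by (rule AE_mp[OF AE_lborel_singleton[of "-t"]]) (use that norm_Ln_inverse_le_log_bound in \<open>auto simp: add_eq_0_iff\<close>)
  have ibt: "integrable lborel (\<lambda>\<tau>. B * (indicator {-\<eta>..\<eta>} (t + \<tau>) * log_bound \<eta> (t + \<tau>)))"
    using lborel_integrable_real_affine[OF ib, of 1 t] by simp
  have ins: "\<bar>t + \<tau>\<bar> \<le> \<eta>" if "\<bar>\<tau>\<bar> \<le> 2 * e" for \<tau> using t that by linarith
  have il: "integrable lborel (\<lambda>\<tau>. Ln (1 / Complex \<delta> (t + \<tau>)) * of_real (moll e \<tau>))" if d: "0 \<le> \<delta>" "\<delta> \<le> 1" for \<delta>
  proof (rule Bochner_Integration.integrable_bound[OF ibt])
    show "AE \<tau> in lborel. norm (Ln (1 / Complex \<delta> (t + \<tau>)) * of_real (moll e \<tau>)) \<le> norm (B * (indicator {-\<eta>..\<eta>} (t + \<tau>) * log_bound \<eta> (t + \<tau>)))"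
      using lb[OF d]
    proof eventually_elim
      case (elim \<tau>)
      show ?case
      proof (cases "\<bar>\<tau>\<bar> \<le> 2 * e")
        case True
        then have l: "cmod (Ln (1 / Complex \<delta> (t + \<tau>))) \<le> log_bound \<eta> (t + \<tau>)" and i: "t + \<tau> \<in> {-\<eta>..\<eta>}"
          using elim ins[OF True] by (auto simp: abs_le_iff)
        have "cmod (Ln (1 / Complex \<delta> (t + \<tau>))) * moll e \<tau> \<le> log_bound \<eta> (t + \<tau>) * B"
          using l B moll_nonneg[OF e] by (intro mult_mono) (auto intro: order.trans[OF norm_ge_zero])
        then show ?thesis using i moll_nonneg[OF e, of \<tau>] by (simp add: norm_mult mult.commute)
      qed (simp add: moll_supp[OF e])
    qed
  qed measurable
  have iY: "integrable lborel (\<lambda>x. indicator {-\<eta>..\<eta>} x * cmod (Ln (1 / Complex (\<sigma> - 1) x) - Ln (1 / Complex 0 x)))"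
  proof (rule Bochner_Integration.integrable_bound[OF integrable_mult_right[OF ib, of 2]])
    show "AE x in lborel. norm (indicator {-\<eta>..\<eta>} x * cmod (Ln (1 / Complex (\<sigma> - 1) x) - Ln (1 / Complex 0 x))) \<le> norm (2 * (indicator {-\<eta>..\<eta>} x * log_bound \<eta> x))"
    proof (rule AE_mp[OF AE_lborel_singleton[of 0]], intro AE_I2 impI)
      fix x :: real assume x: "x \<noteq> 0"
      show "norm (indicator {-\<eta>..\<eta>} x * cmod (Ln (1 / Complex (\<sigma> - 1) x) - Ln (1 / Complex 0 x))) \<le> norm (2 * (indicator {-\<eta>..\<eta>} x * log_bound \<eta> x))"
      proof (cases "x \<in> {-\<eta>..\<eta>}")
        case True
        then have ax: "\<bar>x\<bar> \<le> \<eta>" by auto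
        have "cmod (Ln (1 / Complex (\<sigma> - 1) x) - Ln (1 / Complex 0 x)) \<le> log_bound \<eta> x + log_bound \<eta> x"
          by (intro order.trans[OF norm_triangle_ineq4] add_mono norm_Ln_inverse_le_log_bound x ax) (use \<sigma> in auto)
        then show ?thesis using True by simp
      qed simp
    qed
  qed measurable
  have iYt: "integrable lborel (\<lambda>\<tau>. B * (indicator {-\<eta>..\<eta>} (t + \<tau>) * cmod (Ln (1 / Complex (\<sigma> - 1) (t + \<tau>)) - Ln (1 / Complex 0 (t + \<tau>)))))"
    using lborel_integrable_real_affine[OF iY, of 1 t] by simp
  have eq: "(LINT \<tau>|lborel. Ln1 (Complex \<sigma> (t + \<tau>)) * of_real (moll e \<tau>)) - (LINT \<tau>|lborel. Ln (1 / Complex 0 (t + \<tau>)) * of_real (moll e \<tau>))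
     = (LINT \<tau>|lborel. (Ln (1 / Complex (\<sigma> - 1) (t + \<tau>)) - Ln (1 / Complex 0 (t + \<tau>))) * of_real (moll e \<tau>))"
    using il[of "\<sigma> - 1"] il[of 0] \<sigma> by (simp add: Ln1_Complex left_diff_distrib)
  have le: "cmod (LINT \<tau>|lborel. (Ln (1 / Complex (\<sigma> - 1) (t + \<tau>)) - Ln (1 / Complex 0 (t + \<tau>))) * of_real (moll e \<tau>)) \<le> (LINT \<tau>|lborel. B * (indicator {-\<eta>..\<eta>} (t + \<tau>) * cmod (Ln (1 / Complex (\<sigma> - 1) (t + \<tau>)) - Ln (1 / Complex 0 (t + \<tau>)))))"
  proof (rule norm_integral_le_AE[OF _ iYt AE_I2])
    show "integrable lborel (\<lambda>\<tau>. (Ln (1 / Complex (\<sigma> - 1) (t + \<tau>)) - Ln (1 / Complex 0 (t + \<tau>))) * of_real (moll e \<tau>))"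
      using il[of "\<sigma> - 1"] il[of 0] \<sigma> by (simp add: left_diff_distrib)
    fix \<tau>
    show "cmod ((Ln (1 / Complex (\<sigma> - 1) (t + \<tau>)) - Ln (1 / Complex 0 (t + \<tau>))) * of_real (moll e \<tau>))
        \<le> B * (indicator {-\<eta>..\<eta>} (t + \<tau>) * cmod (Ln (1 / Complex (\<sigma> - 1) (t + \<tau>)) - Ln (1 / Complex 0 (t + \<tau>))))"
    proof (cases "\<bar>\<tau>\<bar> \<le> 2 * e")
      case True
      then have i: "t + \<tau> \<in> {-\<eta>..\<eta>}" using ins[OF True] by (auto simp: abs_le_iff)
      show ?thesis using i moll_nonneg[OF e, of \<tau>] B[of \<tau>]
        by (simp add: norm_mult mult.commute mult_right_mono)
    qed (use B0 in \<open>simp add: moll_supp[OF e]\<close>)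
  qed
  have ey: "(LINT \<tau>|lborel. B * (indicator {-\<eta>..\<eta>} (t + \<tau>) * cmod (Ln (1 / Complex (\<sigma> - 1) (t + \<tau>)) - Ln (1 / Complex 0 (t + \<tau>))))) = B * Y \<sigma>"
  proof -
    have "Y \<sigma> = \<bar>1\<bar> *\<^sub>R (LINT \<tau>|lborel. indicator {-\<eta>..\<eta>} (t + 1 * \<tau>) * cmod (Ln (1 / Complex (\<sigma> - 1) (t + 1 * \<tau>)) - Ln (1 / Complex 0 (t + 1 * \<tau>))))"
      unfolding Y_def by (rule lborel_integral_real_affine[where c=1 and t=t]) simp
    then show ?thesis by (simp only: integral_mult_right_zero abs_one scaleR_one mult_1)
  qed
  show ?thesis unfolding eq using le unfolding ey .
qed

lemma Y_lim: "(Y \<longlongrightarrow> 0) (at_right 1)"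
  unfolding Y_def[abs_def] by (rule Ln_inverse_boundary_L1) (use \<eta> in auto)

text \<open>\<open>X\<close> at frequency 0 splits into the mollified \<open>G\<close>, which
  converges because the mollifier is a test function, and the mollified logarithm, which converges
  by \<open>Ln_moll_diff\<close>.\<close>

lemma X_convergent:
  assumes e: "e > 0" "2 * e < \<eta>"
  shows "\<exists>l. (X e 0 \<longlongrightarrow> l) (at_right 1)"
proof -
  obtain B where B: "\<And>t. moll e t \<le> B" using moll_bdd[OF e(1)] by blast
  define l0 where "l0 = (LINT \<tau>|lborel. Ln (1 / Complex 0 (0 + \<tau>)) * of_real (moll e \<tau>))"
  have ev: "\<forall>\<^sub>F \<sigma> in at_right 1. \<sigma> \<in> {1<..<2::real}" by (rule eventually_at_right_real) simp
  have "((\<lambda>\<sigma>. (LINT \<tau>|lborel. Ln1 (Complex \<sigma> (0 + \<tau>)) * of_real (moll e \<tau>)) - l0) \<longlongrightarrow> 0) (at_right 1)"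
  proof (rule Lim_null_comparison)
    show "\<forall>\<^sub>F \<sigma> in at_right 1. norm ((LINT \<tau>|lborel. Ln1 (Complex \<sigma> (0 + \<tau>)) * of_real (moll e \<tau>)) - l0) \<le> B * Y \<sigma>"
      using ev by eventually_elim (use Ln_moll_diff[OF e(1) _ B, of 0] e in \<open>auto simp: l0_def\<close>)
    show "((\<lambda>\<sigma>. B * Y \<sigma>) \<longlongrightarrow> 0) (at_right 1)" by (rule tendsto_mult_right_zero[OF Y_lim])
  qed
  then have "((\<lambda>\<sigma>. LINT \<tau>|lborel. Ln1 (Complex \<sigma> (0 + \<tau>)) * of_real (moll e \<tau>)) \<longlongrightarrow> l0) (at_right 1)"
    by (simp add: LIM_zero_iff)
  from tendsto_add[OF conv_shift[OF e(1), of 0 0] this]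
  have "((\<lambda>\<sigma>. (LINT \<tau>|lborel. G (Complex \<sigma> (0 + \<tau>)) * (cis (0 * \<tau>) * of_real (moll e \<tau>))) + (LINT \<tau>|lborel. Ln1 (Complex \<sigma> (0 + \<tau>)) * of_real (moll e \<tau>)))
     \<longlongrightarrow> (LINT \<tau>|lborel. g (0 + \<tau>) * (cis (0 * \<tau>) * of_real (moll e \<tau>))) + l0) (at_right 1)" using e by simp
  then have "((\<lambda>\<sigma>. complex_of_real (X e 0 \<sigma>)) \<longlongrightarrow> (LINT \<tau>|lborel. g (0 + \<tau>) * (cis (0 * \<tau>) * of_real (moll e \<tau>))) + l0) (at_right 1)"
  proof (rule Lim_transform_eventually)
    show "\<forall>\<^sub>F \<sigma> in at_right 1. (LINT \<tau>|lborel. G (Complex \<sigma> (0 + \<tau>)) * (cis (0 * \<tau>) * of_real (moll e \<tau>))) + (LINT \<tau>|lborel. Ln1 (Complex \<sigma> (0 + \<tau>)) * of_real (moll e \<tau>)) = complex_of_real (X e 0 \<sigma>)"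
      using ev by eventually_elim (simp add: X_split[OF e(1)])
  qed
  from tendsto_Re[OF this] show ?thesis by auto
qed

text \<open>Positivity makes height 0 the worst case: for \<open>a \<le> b\<close> the integrands of
  \<open>L a\<close> and \<open>L b\<close> differ by a nonnegative function times a factor of
  modulus 1, so the difference at any height is bounded by the difference of \<open>X\<close>. The
  logarithmic part costs the terms with \<open>Y\<close>.\<close>

lemma F_Cauchy:
  assumes e: "e > 0" and t: "\<bar>t\<bar> + 2 * e < \<eta>" and B: "\<And>x. moll e x \<le> B" and \<sigma>: "1 < \<sigma>" "\<sigma> < 2" "1 < \<sigma>'" "\<sigma>' < 2"
  shows "cmod (F e (Complex \<sigma> t) - F e (Complex \<sigma>' t)) \<le> \<bar>X e 0 \<sigma> - X e 0 \<sigma>'\<bar> + B * (Y \<sigma> + Y \<sigma>')"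
proof -
  define l0 where "l0 = (LINT \<tau>|lborel. Ln (1 / Complex 0 (t + \<tau>)) * of_real (moll e \<tau>))"
  define l where "l = (\<lambda>\<sigma>. LINT \<tau>|lborel. Ln1 (Complex \<sigma> (t + \<tau>)) * of_real (moll e \<tau>))"
  define L where "L = (\<lambda>\<sigma>. LINT x|M. exp (- Complex \<sigma> t * of_real (u x)) * of_real (\<psi> (e * (u x - 0))))"
  have Fe: "F e (Complex \<sigma> t) = L \<sigma> - l \<sigma>" if s: "1 < \<sigma>" for \<sigma>
  proof -
    have "L \<sigma> - l \<sigma> = (LINT \<tau>|lborel. Lf (Complex \<sigma> (t + \<tau>)) * of_real (moll e \<tau>) - Ln1 (Complex \<sigma> (t + \<tau>)) * of_real (moll e \<tau>))"
      using Lf_moll[OF e s, of t 0] integrable_line[OF Lf_hol s e, of t 0] integrable_line[OF Ln1_hol s e, of t 0] by (simp add: L_def l_def)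
    then show ?thesis unfolding F_Complex using s by (simp add: Lf_eq flip: left_diff_distrib)
  qed
  have iL: "integrable M (\<lambda>x. exp (- Complex \<sigma> t * of_real (u x)) * of_real (\<psi> (e * (u x - 0))))" if "\<sigma> > 1" for \<sigma>
    by (rule Bochner_Integration.integrable_bound[OF integrable_X[OF that, of e 0]]) (auto simp: norm_mult)
  have key: "cmod (L a - L b) \<le> X e 0 a - X e 0 b" if ab: "1 < a" "a \<le> b" for a b
  proof -
    have b1: "1 < b" using ab by simp
    have eq: "L a - L b = (LINT x|M. exp (- Complex a t * of_real (u x)) * of_real (\<psi> (e * (u x - 0))) - exp (- Complex b t * of_real (u x)) * of_real (\<psi> (e * (u x - 0))))"
      unfolding L_def using iL[OF ab(1)] iL[OF b1] by simp
    have le: "cmod (LINT x|M. exp (- Complex a t * of_real (u x)) * of_real (\<psi> (e * (u x - 0))) - exp (- Complex b t * of_real (u x)) * of_real (\<psi> (e * (u x - 0)))) \<le> (LINT x|M. exp (- a * u x) * \<psi> (e * (u x - 0)) - exp (- b * u x) * \<psi> (e * (u x - 0)))"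
    proof (rule norm_integral_le_AE[OF _ _ AE_I2])
      show "integrable M (\<lambda>x. exp (- Complex a t * of_real (u x)) * of_real (\<psi> (e * (u x - 0))) - exp (- Complex b t * of_real (u x)) * of_real (\<psi> (e * (u x - 0))))"
        using iL[OF ab(1)] iL[OF b1] by simp
      show "integrable M (\<lambda>x. exp (- a * u x) * \<psi> (e * (u x - 0)) - exp (- b * u x) * \<psi> (e * (u x - 0)))"
        by (intro Bochner_Integration.integrable_diff integrable_X ab b1)
      fix x
      have "exp (- b * u x) \<le> exp (- a * u x)" using ab u_nonneg[of x] by (simp add: mult_right_mono)
      then have "cmod (complex_of_real (exp (- a * u x) - exp (- b * u x)) * (cis (- (t * u x)) * of_real (\<psi> (e * (u x - 0)))))
         = (exp (- a * u x) - exp (- b * u x)) * \<psi> (e * (u x - 0))"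
        unfolding norm_mult norm_of_real using \<psi>_nonneg by simp
      moreover have "exp (- Complex a t * of_real (u x)) * of_real (\<psi> (e * (u x - 0))) - exp (- Complex b t * of_real (u x)) * of_real (\<psi> (e * (u x - 0)))
         = complex_of_real (exp (- a * u x) - exp (- b * u x)) * (cis (- (t * u x)) * of_real (\<psi> (e * (u x - 0))))"
        by (simp only: exp_Complex_mult of_real_diff left_diff_distrib mult.assoc)
      ultimately show "cmod (exp (- Complex a t * of_real (u x)) * of_real (\<psi> (e * (u x - 0))) - exp (- Complex b t * of_real (u x)) * of_real (\<psi> (e * (u x - 0))))
         \<le> exp (- a * u x) * \<psi> (e * (u x - 0)) - exp (- b * u x) * \<psi> (e * (u x - 0))"
        by (simp only: left_diff_distrib order.refl)
    qed
    have ey: "(LINT x|M. exp (- a * u x) * \<psi> (e * (u x - 0)) - exp (- b * u x) * \<psi> (e * (u x - 0))) = X e 0 a - X e 0 b"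
      unfolding X_def by (intro Bochner_Integration.integral_diff integrable_X ab b1)
    show ?thesis unfolding eq using le unfolding ey .
  qed
  have "cmod (L \<sigma> - L \<sigma>') \<le> \<bar>X e 0 \<sigma> - X e 0 \<sigma>'\<bar>"
    using key[of \<sigma> \<sigma>'] key[of \<sigma>' \<sigma>] \<sigma> norm_minus_commute[of "L \<sigma>" "L \<sigma>'"] by linarith
  moreover have "cmod (l \<sigma> - l0) \<le> B * Y \<sigma>" "cmod (l \<sigma>' - l0) \<le> B * Y \<sigma>'"
    unfolding l_def l0_def using \<sigma> by (intro Ln_moll_diff[OF e t B]; simp)+
  moreover have "cmod (F e (Complex \<sigma> t) - F e (Complex \<sigma>' t)) \<le> cmod (L \<sigma> - L \<sigma>') + (cmod (l \<sigma> - l0) + cmod (l \<sigma>' - l0))"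
  proof -
    have eq: "F e (Complex \<sigma> t) - F e (Complex \<sigma>' t) = (L \<sigma> - L \<sigma>') - ((l \<sigma> - l0) - (l \<sigma>' - l0))"
      using \<sigma> by (simp add: Fe)
    show ?thesis unfolding eq by (intro order.trans[OF norm_triangle_ineq4] add_mono order.refl norm_triangle_ineq4)
  qed
  ultimately show ?thesis using distrib_left[of B "Y \<sigma>" "Y \<sigma>'"] by linarith
qed

text \<open>The Cauchy estimate does not involve \<open>t\<close>. Letting \<open>\<sigma>'\<close>
  tend to 1 in it brings in \<open>F0\<close>, the limit at each \<open>t\<close> given by the
  distributional convergence.\<close>

lemma F_uniform:
  assumes e: "e > 0" and r: "0 \<le> r" "r + 2 * e < \<eta>" and k: "\<kappa> > 0"
  shows "\<exists>\<delta>>0. \<forall>\<sigma> t. 1 < \<sigma> \<and> \<sigma> < 1 + \<delta> \<and> \<bar>t\<bar> \<le> r \<longrightarrow> cmod (F e (Complex \<sigma> t) - F0 e t) \<le> \<kappa>"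
proof -
  obtain B where B: "B \<ge> 0" "\<And>t. moll e t \<le> B" using moll_bdd[OF e(1)] by blast
  obtain l where l: "(X e 0 \<longlongrightarrow> l) (at_right 1)" using X_convergent[OF e] r by auto
  have "\<forall>\<^sub>F \<sigma> in at_right 1. dist (X e 0 \<sigma>) l < \<kappa> / 4" using l k by (intro tendstoD) auto
  moreover have "((\<lambda>\<sigma>. B * Y \<sigma>) \<longlongrightarrow> 0) (at_right 1)" by (rule tendsto_mult_right_zero[OF Y_lim])
  then have "\<forall>\<^sub>F \<sigma> in at_right 1. B * Y \<sigma> < \<kappa> / 4" using k by (intro order_tendstoD) auto
  moreover have "\<forall>\<^sub>F \<sigma> in at_right 1. \<sigma> \<in> {1<..<2::real}" by (rule eventually_at_right_real) simp
  ultimately have ev: "\<forall>\<^sub>F \<sigma> in at_right 1. \<bar>X e 0 \<sigma> - l\<bar> < \<kappa> / 4 \<and> B * Y \<sigma> < \<kappa> / 4 \<and> 1 < \<sigma> \<and> \<sigma> < 2"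
    by eventually_elim (auto simp: dist_real_def)
  then obtain b where b: "b > 1" "\<And>\<sigma>. 1 < \<sigma> \<Longrightarrow> \<sigma> < b \<Longrightarrow> \<bar>X e 0 \<sigma> - l\<bar> < \<kappa> / 4 \<and> B * Y \<sigma> < \<kappa> / 4 \<and> 1 < \<sigma> \<and> \<sigma> < 2"
    unfolding eventually_at_right_field by blast
  show ?thesis
  proof (intro exI[of _ "b - 1"] conjI allI impI)
    fix \<sigma> t assume s: "1 < \<sigma> \<and> \<sigma> < 1 + (b - 1) \<and> \<bar>t\<bar> \<le> r"
    have t: "\<bar>t\<bar> + 2 * e < \<eta>" using s r by linarith
    have "((\<lambda>\<sigma>'. cmod (F e (Complex \<sigma> t) - F e (Complex \<sigma>' t))) \<longlongrightarrow> cmod (F e (Complex \<sigma> t) - F0 e t)) (at_right 1)"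
      using conv_shift[OF e t, of 0] by (intro tendsto_intros) (simp add: F_Complex F0_def)
    moreover have "\<forall>\<^sub>F \<sigma>' in at_right 1. cmod (F e (Complex \<sigma> t) - F e (Complex \<sigma>' t)) \<le> \<kappa>"
      using ev
    proof eventually_elim
      case (elim \<sigma>')
      have bs: "\<bar>X e 0 \<sigma> - l\<bar> < \<kappa> / 4 \<and> B * Y \<sigma> < \<kappa> / 4 \<and> 1 < \<sigma> \<and> \<sigma> < 2" using s by (intro b) auto
      have "cmod (F e (Complex \<sigma> t) - F e (Complex \<sigma>' t)) \<le> \<bar>X e 0 \<sigma> - X e 0 \<sigma>'\<bar> + B * (Y \<sigma> + Y \<sigma>')"
        using bs elim by (intro F_Cauchy[OF e t B(2)]) auto
      then show ?case using bs elim distrib_left[of B "Y \<sigma>" "Y \<sigma>'"] by linarith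
    qed
    ultimately show "cmod (F e (Complex \<sigma> t) - F0 e t) \<le> \<kappa>"
      by (rule tendsto_upperbound) simp
  qed (use b in auto)
qed

lemma F_hol:
  assumes e: "e > 0"
  shows "F e holomorphic_on {s. Re s > 1}"
proof -
  have o: "open {s. Re s > 1}" by (rule open_halfspace_Re_gt)
  have "(\<lambda>s. integral (cbox (-2*e) (2*e)) (\<lambda>\<tau>. G (s + \<i> * of_real \<tau>) * of_real (moll e \<tau>))) holomorphic_on {s. Re s > 1}"
  proof (rule leibniz_rule_holomorphic[where fx="\<lambda>s \<tau>. deriv G (s + \<i> * of_real \<tau>) * of_real (moll e \<tau>)"])
    show "((\<lambda>s. G (s + \<i> * of_real \<tau>) * of_real (moll e \<tau>)) has_field_derivative deriv G (s + \<i> * of_real \<tau>) * of_real (moll e \<tau>)) (at s within {s. Re s > 1})"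
      if "s \<in> {s. Re s > 1}" for s \<tau>
    proof -
      have "(G has_field_derivative deriv G (s + \<i> * of_real \<tau>)) (at (s + \<i> * of_real \<tau>))"
        using that by (intro holomorphic_derivI[OF G_hol o]) auto
      moreover have "((\<lambda>s. s + \<i> * of_real \<tau>) has_field_derivative 1) (at s)" by (auto intro!: derivative_eq_intros)
      ultimately have "((\<lambda>s. G (s + \<i> * of_real \<tau>)) has_field_derivative deriv G (s + \<i> * of_real \<tau>) * 1) (at s)"
        by (rule DERIV_chain'[where g=G and f="\<lambda>s. s + \<i> * of_real \<tau>", rotated])
      then have "((\<lambda>s. G (s + \<i> * of_real \<tau>)) has_field_derivative deriv G (s + \<i> * of_real \<tau>)) (at s)" by (simp only: mult_1_right)
      from has_field_derivative_at_within[OF this] show ?thesis by (rule DERIV_cmult_right)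
    qed
    show "(\<lambda>\<tau>. G (s + \<i> * of_real \<tau>) * of_real (moll e \<tau>)) integrable_on cbox (-2*e) (2*e)" if "s \<in> {s. Re s > 1}" for s
      by (intro integrable_continuous continuous_intros moll_cont e continuous_on_compose2[OF holomorphic_on_imp_continuous_on[OF G_hol]])
         (use that in auto)
    have "deriv G holomorphic_on {s. Re s > 1}" by (rule holomorphic_deriv[OF G_hol o])
    then show "continuous_on ({s. Re s > 1} \<times> cbox (-2*e) (2*e)) (\<lambda>(s, \<tau>). deriv G (s + \<i> * of_real \<tau>) * of_real (moll e \<tau>))"
      unfolding case_prod_beta
      by (intro continuous_intros continuous_on_compose2[OF moll_cont[OF e, of UNIV]] continuous_on_compose2[OF holomorphic_on_imp_continuous_on[of "deriv G"]]) auto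
    show "convex {s. Re s > 1}" by (rule convex_halfspace_Re_gt)
  qed
  then show ?thesis
  proof (rule holomorphic_transform)
    fix s assume s: "s \<in> {s. Re s > 1}"
    have c: "continuous_on {-2*e..2*e} (\<lambda>\<tau>. G (s + \<i> * of_real \<tau>) * of_real (moll e \<tau>))"
      by (intro continuous_intros moll_cont e continuous_on_compose2[OF holomorphic_on_imp_continuous_on[OF G_hol]])
         (use s in auto)
    have "integral {-2*e..2*e} (\<lambda>\<tau>. G (s + \<i> * of_real \<tau>) * of_real (moll e \<tau>)) = (LINT \<tau>:{-2*e..2*e}|lborel. G (s + \<i> * of_real \<tau>) * of_real (moll e \<tau>))"
      by (rule set_borel_integral_eq_integral(2)[symmetric]) (rule borel_integrable_atLeastAtMost'[OF c])
    also have "\<dots> = F e s" unfolding set_lebesgue_integral_def F_def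
    proof (intro Bochner_Integration.integral_cong refl)
      fix x show "indicator {-2*e..2*e} x *\<^sub>R (G (s + \<i> * of_real x) * of_real (moll e x)) = G (s + \<i> * of_real x) * of_real (moll e x)"
      proof (cases "x \<in> {-2*e..2*e}")
        case False
        then have "\<bar>x\<bar> \<ge> 2 * e" by auto
        then show ?thesis by (simp add: moll_supp[OF e])
      qed simp
    qed
    finally show "integral (cbox (-2*e) (2*e)) (\<lambda>\<tau>. G (s + \<i> * of_real \<tau>) * of_real (moll e \<tau>)) = F e s" by simp
  qed
qed

end

section \<open>Removal of the mollification by the maximum principle\<close>

context laplace_boundary
begin

lemma G_modulus:
  assumes x: "x > 0" and r: "r \<ge> 0" and k: "\<kappa> > 0"
  shows "\<exists>e0>0. \<forall>e s. 0 < e \<and> e < e0 \<and> 1 + x \<le> Re s \<and> Re s \<le> 2 \<and> \<bar>Im s\<bar> \<le> r \<longrightarrow> cmod (F e s - G s) \<le> \<kappa>"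
proof -
  \<comment> \<open>The rectangle is taller by 2 because the mollifier reaches up to
    \<open>2 * e\<close> with \<open>e < 1\<close>.\<close>
  define Q where "Q = cbox (Complex (1 + x) (- (r + 2))) (Complex 2 (r + 2))"
  have "Q \<subseteq> {s. Re s > 1}" using x by (auto simp: Q_def in_cbox_complex_iff)
  then have "continuous_on Q G" by (rule holomorphic_on_imp_continuous_on[OF holomorphic_on_subset[OF G_hol]])
  then have "uniformly_continuous_on Q G" by (intro compact_uniformly_continuous) (auto simp: Q_def compact_cbox)
  then obtain d where d: "d > 0" "\<And>z z'. z \<in> Q \<Longrightarrow> z' \<in> Q \<Longrightarrow> dist z' z < d \<Longrightarrow> dist (G z') (G z) < \<kappa>"
    using k unfolding uniformly_continuous_on_def by blast
  show ?thesis
  proof (intro exI[of _ "min (d / 2) 1"] conjI allI impI)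
    fix e s assume a: "0 < e \<and> e < min (d / 2) 1 \<and> 1 + x \<le> Re s \<and> Re s \<le> 2 \<and> \<bar>Im s\<bar> \<le> r"
    show "cmod (F e s - G s) \<le> \<kappa>"
      unfolding F_def
    proof (rule moll_close)
      show "integrable lborel (\<lambda>\<tau>. G (s + \<i> * of_real \<tau>) * of_real (moll e \<tau>))" using a x by (intro integrable_F) auto
      fix \<tau> assume t: "\<bar>\<tau>\<bar> \<le> 2 * e"
      have "s \<in> Q" "s + \<i> * of_real \<tau> \<in> Q" using a t by (auto simp: Q_def in_cbox_complex_iff)
      moreover have "dist (s + \<i> * of_real \<tau>) s < d" using a t by (simp add: dist_norm norm_mult)
      ultimately show "cmod (G (s + \<i> * of_real \<tau>) - G s) \<le> \<kappa>" using d(2)[of s "s + \<i> * of_real \<tau>"] by (simp add: dist_norm)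
    qed (use a in auto)
  qed (use d in auto)
qed

lemma g_modulus:
  assumes r: "0 \<le> r" "r < \<eta>" and k: "\<kappa> > 0"
  shows "\<exists>e0>0. \<forall>e t. 0 < e \<and> e < e0 \<and> \<bar>t\<bar> \<le> r \<longrightarrow> cmod (F0 e t - g t) \<le> \<kappa>"
proof -
  define r1 where "r1 = (r + \<eta>) / 2"
  have r1: "r < r1" "r1 < \<eta>" using r by (auto simp: r1_def)
  have "continuous_on {-r1..r1} g" by (rule continuous_on_subset[OF g_cont]) (use r1 in auto)
  then have "uniformly_continuous_on {-r1..r1} g" by (intro compact_uniformly_continuous) auto
  then obtain d where d: "d > 0" "\<And>z z'. z \<in> {-r1..r1} \<Longrightarrow> z' \<in> {-r1..r1} \<Longrightarrow> dist z' z < d \<Longrightarrow> dist (g z') (g z) < \<kappa>"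
    using k unfolding uniformly_continuous_on_def by blast
  show ?thesis
  proof (intro exI[of _ "min (d / 2) ((r1 - r) / 2)"] conjI allI impI)
    fix e t assume a: "0 < e \<and> e < min (d / 2) ((r1 - r) / 2) \<and> \<bar>t\<bar> \<le> r"
    show "cmod (F0 e t - g t) \<le> \<kappa>"
      unfolding F0_def
    proof (rule moll_close)
      show "integrable lborel (\<lambda>\<tau>. g (t + \<tau>) * of_real (moll e \<tau>))"
        using integrable_g_moll[of e t 0] a r1 by simp
      fix \<tau> assume t: "\<bar>\<tau>\<bar> \<le> 2 * e"
      then have "t \<in> {-r1..r1}" "t + \<tau> \<in> {-r1..r1}" "dist (t + \<tau>) t < d" using a r1 by (auto simp: dist_norm)
      then show "cmod (g (t + \<tau>) - g t) \<le> \<kappa>" using d(2)[of t "t + \<tau>"] by (simp add: dist_norm)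
    qed (use a in auto)
  qed (use d r1 in auto)
qed

lemma F_growth:
  obtains C where "C \<ge> 0" "\<And>e s. 0 < e \<Longrightarrow> 1 < Re s \<Longrightarrow> Re s \<le> 2 \<Longrightarrow> \<bar>Im s\<bar> + 2 * e \<le> \<eta> \<Longrightarrow> cmod (F e s) \<le> C / (Re s - 1)"
proof -
  obtain C where C: "C \<ge> 0" "\<And>s. 1 < Re s \<Longrightarrow> Re s \<le> 2 \<Longrightarrow> \<bar>Im s\<bar> \<le> \<eta> \<Longrightarrow> cmod (G s) \<le> C / (Re s - 1)"
    using G_growth by blast
  show ?thesis
  proof (rule that[OF C(1)])
    fix e s assume a: "0 < e" "1 < Re s" "Re s \<le> 2" "\<bar>Im s\<bar> + 2 * e \<le> \<eta>"
    have "cmod (F e s - 0) \<le> C / (Re s - 1)" unfolding F_def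
    proof (rule moll_close[OF a(1) integrable_F[OF a(1,2)]])
      fix \<tau> assume "\<bar>\<tau>\<bar> \<le> 2 * e"
      then show "cmod (G (s + \<i> * of_real \<tau>) - 0) \<le> C / (Re s - 1)" using C(2)[of "s + \<i> * of_real \<tau>"] a by simp
    qed
    then show "cmod (F e s) \<le> C / (Re s - 1)" by simp
  qed
qed

text \<open>The factor vanishes to second order at the two corners on the critical line, which beats the
  first-order growth of the mollified functions along the horizontal sides.\<close>

lemma F_diff_small:
  assumes r: "0 < r" "r < r'" "r' < \<eta>" and k: "\<kappa> > 0"
  shows "\<exists>e0>0. \<forall>e e' s. 0 < e \<and> e < e0 \<and> 0 < e' \<and> e' < e0 \<and> 1 < Re s \<and> Re s < 2 \<and> \<bar>Im s\<bar> \<le> r \<longrightarrow>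
      cmod (F e s - F e' s) \<le> \<kappa>"
proof -
  define W where "W = (1 + 2 * r')"
  have W: "W > 1" using r by (simp add: W_def)
  define c1 where "c1 = Complex 1 r'"
  define c2 where "c2 = Complex 1 (- r')"
  \<comment> \<open>Points with \<open>\<bar>Im s\<bar> \<le> r\<close> have distance at least
    \<open>r' - r\<close> from both corners, so the factor is at least \<open>(r' - r) ^ 4\<close>
    there; the target on the frontier is scaled accordingly.\<close>
  define k0 where "k0 = \<kappa> * (r' - r) ^ 4"
  have k0: "k0 > 0" using k r by (simp add: k0_def)
  obtain C where C: "C \<ge> 0" "\<And>e s. 0 < e \<Longrightarrow> 1 < Re s \<Longrightarrow> Re s \<le> 2 \<Longrightarrow> \<bar>Im s\<bar> + 2 * e \<le> \<eta> \<Longrightarrow> cmod (F e s) \<le> C / (Re s - 1)"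
    using F_growth by blast
  \<comment> \<open>On the horizontal sides, at distance \<open>y < x\<close> from the critical
    line, the growth bound \<open>2 * C / y\<close> times \<open>y\<^sup>2 * W\<^sup>2\<close> must
    not exceed \<open>k0\<close>. The added 1 keeps the denominator positive when
    \<open>C = 0\<close>.\<close>
  define x where "x = k0 / ((2 * C + 1) * W\<^sup>2)"
  have CW: "(2 * C + 1) * W\<^sup>2 > 0" using C W by (intro mult_pos_pos) auto
  have x: "x > 0" using k0 CW by (simp add: x_def)
  have x2: "2 * C * x * W\<^sup>2 \<le> k0"
  proof -
    have "2 * C * W\<^sup>2 * x \<le> (2 * C + 1) * W\<^sup>2 * x" using x W by (intro mult_right_mono) auto
    also have "\<dots> = k0" unfolding x_def times_divide_eq_right
      by (rule nonzero_mult_div_cancel_left[OF less_imp_neq[OF CW, symmetric]])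
    finally show ?thesis by (simp add: mult_ac)
  qed
  \<comment> \<open>On the rest of the frontier the difference is at most \<open>4 * k1\<close>, two
    approximation errors for each of the two scales, and the factor is at most
    \<open>W ^ 4\<close>.\<close>
  define k1 where "k1 = k0 / (4 * W ^ 4)"
  have k1: "k1 > 0" using k0 W by (simp add: k1_def)
  have k1W: "4 * k1 * W ^ 4 = k0" using W by (simp add: k1_def)
  obtain eG where eG: "eG > 0" "\<And>e s. 0 < e \<Longrightarrow> e < eG \<Longrightarrow> 1 + x \<le> Re s \<Longrightarrow> Re s \<le> 2 \<Longrightarrow> \<bar>Im s\<bar> \<le> r' \<Longrightarrow> cmod (F e s - G s) \<le> k1"
    using G_modulus[OF x, of r' k1] k1 r by auto
  obtain e3 where e3: "e3 > 0" "\<And>e s. 0 < e \<Longrightarrow> e < e3 \<Longrightarrow> Re s = 2 \<Longrightarrow> \<bar>Im s\<bar> \<le> r' \<Longrightarrow> cmod (F e s - G s) \<le> k1"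
    using G_modulus[of 1 r' k1] k1 r by auto
  obtain eg where eg: "eg > 0" "\<And>e t. 0 < e \<Longrightarrow> e < eg \<Longrightarrow> \<bar>t\<bar> \<le> r' \<Longrightarrow> cmod (F0 e t - g t) \<le> k1"
    using g_modulus[of r' k1] k1 r by auto
  define e0 where "e0 = min (min eG e3) (min eg ((\<eta> - r') / 2))"
  show ?thesis
  proof (intro exI[of _ e0] conjI allI impI)
    show "e0 > 0" using eG eg e3 r by (simp add: e0_def)
    fix e e' s assume a: "0 < e \<and> e < e0 \<and> 0 < e' \<and> e' < e0 \<and> 1 < Re s \<and> Re s < 2 \<and> \<bar>Im s\<bar> \<le> r"
    have ee: "0 < e" "e < eG" "e < e3" "e < eg" "r' + 2 * e < \<eta>" "0 < e'" "e' < eG" "e' < e3" "e' < eg" "r' + 2 * e' < \<eta>"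
      using a by (auto simp: e0_def)
    obtain d1 where d1: "d1 > 0" "\<And>\<sigma> t. 1 < \<sigma> \<Longrightarrow> \<sigma> < 1 + d1 \<Longrightarrow> \<bar>t\<bar> \<le> r' \<Longrightarrow> cmod (F e (Complex \<sigma> t) - F0 e t) \<le> k1"
      using F_uniform[of e r' k1] ee r k1 by auto
    obtain d2 where d2: "d2 > 0" "\<And>\<sigma> t. 1 < \<sigma> \<Longrightarrow> \<sigma> < 1 + d2 \<Longrightarrow> \<bar>t\<bar> \<le> r' \<Longrightarrow> cmod (F e' (Complex \<sigma> t) - F0 e' t) \<le> k1"
      using F_uniform[of e' r' k1] ee r k1 by auto
    \<comment> \<open>The left side of the rectangle may depend on \<open>e\<close>,
      \<open>e'\<close> and \<open>s\<close>, since the widths \<open>d1\<close> and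
      \<open>d2\<close> come without any uniformity in the scale; only \<open>e0\<close> has to be
      chosen beforehand.\<close>
    define \<sigma> where "\<sigma> = 1 + min (min d1 d2) (Re s - 1) / 2"
    have \<sigma>: "1 < \<sigma>" "\<sigma> < 1 + d1" "\<sigma> < 1 + d2" "\<sigma> < Re s" "\<sigma> < 2"
      using d1(1) d2(1) a by (auto simp: \<sigma>_def min_def field_simps)
    define P where "P = (\<lambda>z. (z - c1)\<^sup>2 * (z - c2)\<^sup>2)"
    define Q where "Q = cbox (Complex \<sigma> (- r')) (Complex 2 r')"
    have Q: "z \<in> Q \<longleftrightarrow> \<sigma> \<le> Re z \<and> Re z \<le> 2 \<and> \<bar>Im z\<bar> \<le> r'" for z by (auto simp: Q_def in_cbox_complex_iff)
    have Q1: "Q \<subseteq> {s. Re s > 1}" using \<sigma> by (auto simp: Q)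
    have sQ: "s \<in> Q" using a \<sigma> r by (auto simp: Q)
    have hol: "(\<lambda>z. (F e z - F e' z) * P z) holomorphic_on {s. Re s > 1}"
      unfolding P_def using ee by (intro holomorphic_intros F_hol) auto
    have Pb: "cmod (z - c1) \<le> W" "cmod (z - c2) \<le> W" if "z \<in> Q" for z
    proof -
      have "\<bar>Re z - 1\<bar> \<le> 1" "\<bar>Im z - r'\<bar> \<le> 2 * r'" "\<bar>Im z + r'\<bar> \<le> 2 * r'"
        using that \<sigma> by (auto simp: Q abs_le_iff)
      then show "cmod (z - c1) \<le> W" "cmod (z - c2) \<le> W"
        using cmod_le[of "z - c1"] cmod_le[of "z - c2"] by (auto simp: c1_def c2_def W_def)
    qed
    have PW: "cmod (P z) \<le> W ^ 4" if "z \<in> Q" for z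
    proof -
      have "cmod (P z) \<le> W\<^sup>2 * W\<^sup>2" unfolding P_def norm_mult norm_power
        by (intro mult_mono power_mono Pb that) auto
      then show ?thesis by (simp flip: power_add)
    qed
    have fr: "cmod ((F e z - F e' z) * P z) \<le> k0" if z: "z \<in> frontier Q" for z
    proof -
      have zQ: "z \<in> Q" using z by (simp add: Q_def frontier_cbox)
      have zb: "\<sigma> \<le> Re z" "Re z \<le> 2" "\<bar>Im z\<bar> \<le> r'" using zQ by (auto simp: Q)
      have small: "cmod ((F e z - F e' z) * P z) \<le> k0" if le: "cmod (F e z - F e' z) \<le> 4 * k1"
      proof -
        have "cmod ((F e z - F e' z) * P z) \<le> 4 * k1 * W ^ 4"
          unfolding norm_mult using le PW[OF zQ] k1 by (intro mult_mono) auto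
        then show ?thesis by (simp add: k1W)
      qed
      from z have "z \<notin> box (Complex \<sigma> (- r')) (Complex 2 r')" by (simp add: Q_def frontier_cbox)
      \<comment> \<open>Left side, right side, and the horizontal sides away from and close to the
        critical line.\<close>
      then consider "Re z = \<sigma>" | "Re z = 2" | "\<bar>Im z\<bar> = r'" "1 + x \<le> Re z" | "\<bar>Im z\<bar> = r'" "Re z < 1 + x"
        using zb by (force simp: in_box_complex_iff)
      then show ?thesis
      proof cases
        case 1
        then have zC: "z = Complex \<sigma> (Im z)" by (simp add: complex_eq_iff)
        have "cmod (F e z - F0 e (Im z)) \<le> k1" "cmod (F e' z - F0 e' (Im z)) \<le> k1"
          using d1(2)[of \<sigma> "Im z"] d2(2)[of \<sigma> "Im z"] \<sigma> zb zC by auto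
        moreover have "cmod (F0 e (Im z) - g (Im z)) \<le> k1" "cmod (F0 e' (Im z) - g (Im z)) \<le> k1"
          using eg(2) ee zb by auto
        moreover have "cmod (F e z - F e' z) \<le> (cmod (F e z - F0 e (Im z)) + cmod (F0 e (Im z) - g (Im z))) +
            (cmod (F e' z - F0 e' (Im z)) + cmod (F0 e' (Im z) - g (Im z)))"
        proof -
          have eq: "F e z - F e' z = ((F e z - F0 e (Im z)) + (F0 e (Im z) - g (Im z))) - ((F e' z - F0 e' (Im z)) + (F0 e' (Im z) - g (Im z)))" by simp
          show ?thesis unfolding eq by (intro order.trans[OF norm_triangle_ineq4] add_mono norm_triangle_ineq)
        qed
        ultimately show ?thesis by (intro small) linarith
      next
        case 2
        have "cmod (F e z - G z) \<le> k1" "cmod (F e' z - G z) \<le> k1" using e3(2) ee zb 2 by auto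
        moreover have "cmod (F e z - F e' z) \<le> cmod (F e z - G z) + cmod (F e' z - G z)"
          using norm_triangle_ineq4[of "F e z - G z" "F e' z - G z"] by simp
        ultimately show ?thesis using k1 by (intro small) linarith
      next
        case 3
        have "cmod (F e z - G z) \<le> k1" "cmod (F e' z - G z) \<le> k1" using eG(2) ee zb 3 by auto
        moreover have "cmod (F e z - F e' z) \<le> cmod (F e z - G z) + cmod (F e' z - G z)"
          using norm_triangle_ineq4[of "F e z - G z" "F e' z - G z"] by simp
        ultimately show ?thesis using k1 by (intro small) linarith
      next
        case 4
        define y where "y = Re z - 1"
        have y: "0 < y" "y < x" using 4 zb \<sigma> by (auto simp: y_def)
        have "cmod (F e z) \<le> C / y" "cmod (F e' z) \<le> C / y" using C(2)[of _ z] ee zb \<sigma> by (auto simp: y_def)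
        then have F2: "cmod (F e z - F e' z) \<le> 2 * C / y" using norm_triangle_ineq4[of "F e z" "F e' z"] by simp
        have P2: "cmod (P z) \<le> y\<^sup>2 * W\<^sup>2"
        proof (cases "Im z = r'")
          case True
          then have "z - c1 = of_real y" by (simp add: c1_def y_def complex_eq_iff)
          then have "cmod (P z) = y\<^sup>2 * (cmod (z - c2))\<^sup>2" by (simp add: P_def norm_mult norm_power)
          also have "\<dots> \<le> y\<^sup>2 * W\<^sup>2" by (intro mult_left_mono power_mono Pb zQ) auto
          finally show ?thesis .
        next
          case False
          then have "z - c2 = of_real y" using 4 by (auto simp: c2_def y_def complex_eq_iff abs_if split: if_splits)
          then have "cmod (P z) = (cmod (z - c1))\<^sup>2 * y\<^sup>2" by (simp add: P_def norm_mult norm_power)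
          also have "\<dots> \<le> W\<^sup>2 * y\<^sup>2" by (intro mult_right_mono power_mono Pb zQ) auto
          finally show ?thesis by (simp add: mult.commute)
        qed
        have "cmod ((F e z - F e' z) * P z) \<le> 2 * C / y * (y\<^sup>2 * W\<^sup>2)"
          unfolding norm_mult using F2 P2 y C by (intro mult_mono) auto
        also have "\<dots> = 2 * C * y * W\<^sup>2" using y by (simp add: power2_eq_square)
        also have "\<dots> \<le> 2 * C * x * W\<^sup>2" using y C by (intro mult_right_mono mult_left_mono) auto
        also note x2
        finally show ?thesis .
      qed
    qed
    have "cmod ((F e s - F e' s) * P s) \<le> k0"
    proof (rule maximum_modulus_frontier[of "\<lambda>z. (F e z - F e' z) * P z" Q])
      show "(\<lambda>z. (F e z - F e' z) * P z) holomorphic_on interior Q"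
        using hol Q1 interior_subset by (meson holomorphic_on_subset)
      show "continuous_on (closure Q) (\<lambda>z. (F e z - F e' z) * P z)"
        using holomorphic_on_imp_continuous_on[OF holomorphic_on_subset[OF hol Q1]] by (simp add: Q_def)
      show "bounded Q" by (simp add: Q_def)
    qed (use fr sQ in auto)
    moreover have "(r' - r) ^ 4 \<le> cmod (P s)"
    proof -
      have "\<bar>Im s\<bar> \<le> r" using a by simp
      then have im: "r' - r \<le> \<bar>Im s - r'\<bar>" "r' - r \<le> \<bar>Im s + r'\<bar>" using r by linarith+
      have "r' - r \<le> cmod (s - c1)" using im(1) abs_Im_le_cmod[of "s - c1"] by (simp add: c1_def)
      moreover have "r' - r \<le> cmod (s - c2)" using im(2) abs_Im_le_cmod[of "s - c2"] by (simp add: c2_def)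
      ultimately have "(r' - r)\<^sup>2 * (r' - r)\<^sup>2 \<le> cmod (P s)" unfolding P_def norm_mult norm_power
        using r by (intro mult_mono power_mono) auto
      then show ?thesis by (simp only: power4_eq_xxxx power2_eq_square mult.assoc)
    qed
    then have "cmod (F e s - F e' s) * (r' - r) ^ 4 \<le> cmod ((F e s - F e' s) * P s)"
      unfolding norm_mult by (intro mult_left_mono) auto
    ultimately have "cmod (F e s - F e' s) * (r' - r) ^ 4 \<le> \<kappa> * (r' - r) ^ 4" by (simp add: k0_def)
    then show "cmod (F e s - F e' s) \<le> \<kappa>" using r by (simp add: mult_le_cancel_right)
  qed
qed

text \<open>At a fixed \<open>s\<close> the second scale in \<open>F_diff_small\<close> can be taken
  so small that \<open>F e'\<close> is nearly \<open>G\<close>, at a cost independent of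
  \<open>s\<close>. Thus one scale \<open>e\<close> approximates \<open>G\<close> up to the
  boundary, and \<open>F_uniform\<close> is needed for this scale only.\<close>

lemma boundary_uniform:
  assumes r: "0 < r" "r < \<eta>" and k: "\<kappa> > 0"
  shows "\<exists>\<delta>>0. \<forall>\<sigma> t. 1 < \<sigma> \<and> \<sigma> < 1 + \<delta> \<and> \<bar>t\<bar> \<le> r \<longrightarrow> cmod (G (Complex \<sigma> t) - g t) \<le> \<kappa>"
proof -
  define r' where "r' = (r + \<eta>) / 2"
  have r': "r < r'" "r' < \<eta>" using r by (auto simp: r'_def)
  define k4 where "k4 = \<kappa> / 4"
  have k4: "k4 > 0" using k by (simp add: k4_def)
  obtain e0 where e0: "e0 > 0" "\<And>e e' s. 0 < e \<Longrightarrow> e < e0 \<Longrightarrow> 0 < e' \<Longrightarrow> e' < e0 \<Longrightarrow> 1 < Re s \<Longrightarrow> Re s < 2 \<Longrightarrow> \<bar>Im s\<bar> \<le> r \<Longrightarrow> cmod (F e s - F e' s) \<le> k4"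
    using F_diff_small[OF r(1) r' k4] by auto
  obtain eg where eg: "eg > 0" "\<And>e t. 0 < e \<Longrightarrow> e < eg \<Longrightarrow> \<bar>t\<bar> \<le> r \<Longrightarrow> cmod (F0 e t - g t) \<le> k4"
    using g_modulus[of r k4] k4 r by auto
  define e where "e = min (min e0 eg) ((\<eta> - r) / 2) / 2"
  have e: "0 < e" "e < e0" "e < eg" "r + 2 * e < \<eta>" using e0(1) eg(1) r by (auto simp: e_def min_def field_simps)
  obtain d where d: "d > 0" "\<And>\<sigma> t. 1 < \<sigma> \<Longrightarrow> \<sigma> < 1 + d \<Longrightarrow> \<bar>t\<bar> \<le> r \<Longrightarrow> cmod (F e (Complex \<sigma> t) - F0 e t) \<le> k4"
    using F_uniform[of e r k4] e r k4 by auto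
  have FG: "cmod (F e s - G s) \<le> 2 * k4" if s: "1 < Re s" "Re s < 2" "\<bar>Im s\<bar> \<le> r" for s
  proof -
    obtain e1 where e1: "e1 > 0" "\<And>e. 0 < e \<Longrightarrow> e < e1 \<Longrightarrow> cmod (F e s - G s) \<le> k4"
      using G_modulus[of "Re s - 1" r k4] s r k4 by auto
    define e' where "e' = min e1 e0 / 2"
    have e': "0 < e'" "e' < e1" "e' < e0" using e1(1) e0(1) by (auto simp: e'_def)
    have "cmod (F e s - F e' s) \<le> k4" using e0(2) e e' s by auto
    moreover have "cmod (F e' s - G s) \<le> k4" using e1(2) e' by auto
    ultimately show ?thesis using norm_triangle_ineq[of "F e s - F e' s" "F e' s - G s"] by simp
  qed
  show ?thesis
  proof (intro exI[of _ "min d 1"] conjI allI impI)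
    fix \<sigma> t assume a: "1 < \<sigma> \<and> \<sigma> < 1 + min d 1 \<and> \<bar>t\<bar> \<le> r"
    have "cmod (F e (Complex \<sigma> t) - G (Complex \<sigma> t)) \<le> 2 * k4" using a by (intro FG) auto
    moreover have "cmod (F e (Complex \<sigma> t) - F0 e t) \<le> k4" using a by (intro d) auto
    moreover have "cmod (F0 e t - g t) \<le> k4" using a e by (intro eg) auto
    moreover have "cmod (G (Complex \<sigma> t) - g t) \<le> (cmod (F e (Complex \<sigma> t) - F0 e t) + cmod (F0 e t - g t)) + cmod (F e (Complex \<sigma> t) - G (Complex \<sigma> t))"
    proof -
      have eq: "G (Complex \<sigma> t) - g t = ((F e (Complex \<sigma> t) - F0 e t) + (F0 e t - g t)) - (F e (Complex \<sigma> t) - G (Complex \<sigma> t))" by simp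
      show ?thesis unfolding eq by (intro order.trans[OF norm_triangle_ineq4] add_mono norm_triangle_ineq order.refl)
    qed
    ultimately show "cmod (G (Complex \<sigma> t) - g t) \<le> \<kappa>" by (simp add: k4_def)
  qed (use d in auto)
qed

end

section \<open>Euler products and Stieltjes measures of step functions\<close>

text \<open>Both measures agree on half-open intervals. Indexing by \<open>i\<close> rather than by
  position keeps multiplicities, as different indices may share the same \<open>n i\<close>.\<close>

lemma interval_measure_weighted:
  fixes n :: "'i \<Rightarrow> real" and c :: "'i \<Rightarrow> real"
  assumes c: "\<And>i. c i \<ge> 0" and fin: "\<And>x. finite {i. n i \<le> x}"
    and F: "\<And>x. F x = (\<Sum>i | n i \<le> x. c i)"
  shows "interval_measure F = distr (density (count_space UNIV) (\<lambda>i. ennreal (c i))) borel n"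
proof -
  let ?N = "distr (density (count_space UNIV) (\<lambda>i. ennreal (c i))) borel n"
  let ?E = "range (\<lambda>(a, b). {a<..b::real})"
  have mono: "F x \<le> F y" if "x \<le> y" for x y
    unfolding F by (rule sum_mono2[OF fin]) (use that c in auto)
  have cont: "continuous (at_right a) F" for a
  proof -
    \<comment> \<open>Right continuity: only finitely many jumps lie in \<open>(a, a + 1]\<close>,
      so the step function is constant just after \<open>a\<close>.\<close>
    have "finite (n ` {i. n i \<le> a + 1} \<inter> {a<..})" using fin by auto
    then obtain b where b: "b > a" "\<And>i. n i \<le> a + 1 \<Longrightarrow> n i > a \<Longrightarrow> b \<le> n i"
    proof (cases "n ` {i. n i \<le> a + 1} \<inter> {a<..} = {}")
      case False
      define b where "b = Min (n ` {i. n i \<le> a + 1} \<inter> {a<..})"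
      have "b \<in> n ` {i. n i \<le> a + 1} \<inter> {a<..}" unfolding b_def using False fin by (intro Min_in) auto
      moreover have "b \<le> n i" if "n i \<le> a + 1" "n i > a" for i
        unfolding b_def using that fin by (intro Min_le) auto
      ultimately show ?thesis using that[of b] by auto
    qed (use that[of "a + 1"] in auto)
    have "\<forall>\<^sub>F y in at_right a. y \<in> {a<..<min b (a + 1)}" using b by (intro eventually_at_right_real) auto
    then have "\<forall>\<^sub>F y in at_right a. F y = F a"
    proof eventually_elim
      case (elim y)
      have "{i. n i \<le> y} = {i. n i \<le> a}"
      proof (intro Collect_cong iffI)
        fix i assume "n i \<le> y"
        then show "n i \<le> a" using b(2)[of i] elim by force
      qed (use elim in auto)
      then show ?case by (simp add: F)
    qed
    then show ?thesis unfolding continuous_within by (rule tendsto_eventually)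
  qed
  have eq: "emeasure (interval_measure F) {a<..b} = emeasure ?N {a<..b}" for a b
  proof (cases "a \<le> b")
    case True
    have fb: "finite {i. a < n i \<and> n i \<le> b}" by (rule finite_subset[OF _ fin[of b]]) auto
    have "emeasure ?N {a<..b} = emeasure (density (count_space UNIV) (\<lambda>i. ennreal (c i))) {i. a < n i \<and> n i \<le> b}"
      by (subst emeasure_distr) (auto simp: vimage_def)
    also have "\<dots> = (\<integral>\<^sup>+i. ennreal (c i) * indicator {i. a < n i \<and> n i \<le> b} i \<partial>count_space UNIV)"
      by (rule emeasure_density) auto
    also have "\<dots> = (\<Sum>i | a < n i \<and> n i \<le> b. ennreal (c i) * indicator {i. a < n i \<and> n i \<le> b} i)"
      by (rule nn_integral_count_space'[OF fb]) auto
    also have "\<dots> = (\<Sum>i | a < n i \<and> n i \<le> b. ennreal (c i))" by (intro sum.cong) auto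
    also have "\<dots> = ennreal (\<Sum>i | a < n i \<and> n i \<le> b. c i)" by (rule sum_ennreal) (rule c)
    also have "(\<Sum>i | a < n i \<and> n i \<le> b. c i) = F b - F a"
    proof -
      have "{i. n i \<le> b} = {i. a < n i \<and> n i \<le> b} \<union> {i. n i \<le> a}" using True by auto
      then have "F b = (\<Sum>i | a < n i \<and> n i \<le> b. c i) + F a"
        unfolding F by (subst sum.union_disjoint[symmetric]) (use fb fin in auto)
      then show ?thesis by simp
    qed
    finally show ?thesis using emeasure_interval_measure_Ioc[OF True mono cont] by simp
  qed simp
  show ?thesis
  proof (rule measure_eqI_generator_eq[where E="?E" and \<Omega>=UNIV and A="\<lambda>i::nat. {- real i<..real i}"])
    show "Int_stable ?E" by (auto simp: Int_stable_def Int_greaterThanAtMost)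
    show "sets (interval_measure F) = sigma_sets UNIV ?E" "sets ?N = sigma_sets UNIV ?E"
      by (simp_all add: borel_sigma_sets_Ioc)
    show "(\<Union>i::nat. {- real i<..real i}) = UNIV"
    proof (rule UNIV_eq_I[symmetric])
      fix x :: real
      obtain i :: nat where "\<bar>x\<bar> < real i" using reals_Archimedean2 by blast
      then show "x \<in> (\<Union>i::nat. {- real i<..real i})" by (intro UN_I[of i]) auto
    qed
    show "emeasure (interval_measure F) {- real i<..real i} \<noteq> \<infinity>" for i
      by (subst emeasure_interval_measure_Ioc[OF _ mono cont]) auto
  qed (use eq in auto)
qed

text \<open>Applied with weight 1 on multisets and with weights \<open>pwt\<close> on prime powers,
  this turns the two Stieltjes integrals of the definitions into sums over indices.\<close>

lemma set_integral_weighted: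
  fixes n :: "'i \<Rightarrow> real" and c :: "'i \<Rightarrow> real" and f :: "real \<Rightarrow> complex"
  assumes c: "\<And>i. c i \<ge> 0" and fin: "\<And>x. finite {i. n i \<le> x}"
    and F: "\<And>x. F x = (\<Sum>i | n i \<le> x. c i)"
    and A: "\<And>i. n i \<in> A" "A \<in> sets borel" and f [measurable]: "f \<in> borel_measurable borel"
  shows "set_integrable (interval_measure F) A f \<longleftrightarrow> integrable (count_space UNIV) (\<lambda>i. c i *\<^sub>R f (n i))"
    and "(LINT x:A|interval_measure F. f x) = (LINT i|count_space UNIV. c i *\<^sub>R f (n i))"
proof -
  have [measurable]: "(\<lambda>x. indicator A x *\<^sub>R f x) \<in> borel_measurable borel" using A by measurable
  show "set_integrable (interval_measure F) A f \<longleftrightarrow> integrable (count_space UNIV) (\<lambda>i. c i *\<^sub>R f (n i))"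
    unfolding set_integrable_def interval_measure_weighted[OF c fin F]
    by (subst integrable_distr_eq) (use A c in \<open>auto simp: integrable_density\<close>)
  show "(LINT x:A|interval_measure F. f x) = (LINT i|count_space UNIV. c i *\<^sub>R f (n i))"
    unfolding set_lebesgue_integral_def interval_measure_weighted[OF c fin F]
    by (subst integral_distr) (use A c in \<open>auto simp: integral_density\<close>)
qed

lemma exp_neg_Ln_geometric:
  fixes z :: complex
  assumes z: "cmod z < 1"
  shows "exp (\<Sum>j. z ^ Suc j / of_nat (Suc j)) = 1 / (1 - z)" and "summable (\<lambda>j. cmod (z ^ Suc j / of_nat (Suc j)))"
proof -
  have "(\<lambda>n. - ((- (- z)) ^ n) / of_nat n) sums Ln (1 + - z)" by (rule Ln_series') (use z in simp)
  \<comment> \<open>The term of index 0 is a division by zero, hence 0, so the series may start at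
    1.\<close>
  then have "(\<lambda>n. - (z ^ Suc n) / of_nat (Suc n)) sums (Ln (1 - z))"
    by (subst sums_Suc_iff) simp
  then have "(\<lambda>n. - (- (z ^ Suc n) / of_nat (Suc n))) sums (- Ln (1 - z))" by (rule sums_minus)
  then have "(\<Sum>j. z ^ Suc j / of_nat (Suc j)) = - Ln (1 - z)" by (simp add: sums_iff)
  moreover have "1 - z \<noteq> 0" using z by auto
  ultimately show "exp (\<Sum>j. z ^ Suc j / of_nat (Suc j)) = 1 / (1 - z)" by (simp add: exp_minus inverse_eq_divide)
  show "summable (\<lambda>j. cmod (z ^ Suc j / of_nat (Suc j)))"
  proof (rule summable_comparison_test')
    show "summable (\<lambda>j. cmod z ^ j)" using z by (intro summable_geometric) auto
    fix j :: nat
    have "cmod (z ^ Suc j / of_nat (Suc j)) = cmod z ^ Suc j / real (Suc j)" by (simp only: norm_divide norm_power norm_of_nat)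
    also have "\<dots> \<le> cmod z ^ j / 1" using z by (intro frac_le power_decreasing) auto
    finally show "norm (cmod (z ^ Suc j / of_nat (Suc j))) \<le> cmod z ^ j" by simp
  qed
qed

lemma countable_multisets: "countable (A :: nat multiset set)"
proof -
  have "countable (mset ` (UNIV :: nat list set))" by (rule countable_image) simp
  then show ?thesis by (rule countable_subset[rotated]) (simp only: surj_mset subset_UNIV)
qed

text \<open>Splitting off the multiplicity of \<open>m\<close> is the combinatorial content of
  multiplying a finite Euler product by the geometric series of one more prime.\<close>

lemma bij_betw_add_replicate:
  fixes m :: nat
  shows "bij_betw (\<lambda>(M, j). M + replicate_mset j m) ({M. set_mset M \<subseteq> {..<m}} \<times> UNIV) {M. set_mset M \<subseteq> {..<Suc m}}"
proof (rule bij_betw_byWitness[where f'="\<lambda>M. (filter_mset (\<lambda>k. k \<noteq> m) M, count M m)"])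
  show "\<forall>a\<in>{M. set_mset M \<subseteq> {..<m}} \<times> UNIV. (filter_mset (\<lambda>k. k \<noteq> m) (case a of (M, j) \<Rightarrow> M + replicate_mset j m), count (case a of (M, j) \<Rightarrow> M + replicate_mset j m) m) = a"
  proof clarify
    fix M :: "nat multiset" and j assume M: "set_mset M \<subseteq> {..<m}"
    have "filter_mset (\<lambda>k. k \<noteq> m) M = M" using M by (intro filter_mset_eq_conv[THEN iffD2]) auto
    moreover have "filter_mset (\<lambda>k. k \<noteq> m) (replicate_mset j m) = {#}" by (simp add: multiset_eq_iff)
    moreover have "count M m = 0" using M by (auto simp: count_eq_zero_iff)
    ultimately show "filter_mset (\<lambda>k. k \<noteq> m) (M + replicate_mset j m) = M \<and> count (M + replicate_mset j m) m = j" by simp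
  qed
  show "\<forall>M\<in>{M. set_mset M \<subseteq> {..<Suc m}}. (case (filter_mset (\<lambda>k. k \<noteq> m) M, count M m) of (M, j) \<Rightarrow> M + replicate_mset j m) = M"
    by (auto simp: multiset_eq_iff)
  show "(\<lambda>(M, j). M + replicate_mset j m) ` ({M. set_mset M \<subseteq> {..<m}} \<times> UNIV) \<subseteq> {M. set_mset M \<subseteq> {..<Suc m}}"
    by (force simp: set_mset_replicate_mset_subset split: if_splits)
  show "(\<lambda>M. (filter_mset (\<lambda>k. k \<noteq> m) M, count M m)) ` {M. set_mset M \<subseteq> {..<Suc m}} \<subseteq> {M. set_mset M \<subseteq> {..<m}} \<times> UNIV"
    by (force simp: less_Suc_eq)
qed

text \<open>Finite products are handled by induction, and dominated convergence extends the identity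
  along exhausting index sets. Stating it with the exponential of a sum keeps infinite products and
  branches of the logarithm out.\<close>

lemma euler_product_exp:
  fixes f :: "nat \<Rightarrow> complex"
  assumes f1: "\<And>k. cmod (f k) < 1"
    and sM: "Infinite_Set_Sum.abs_summable_on (\<lambda>M. \<Prod>k\<in>#M. f k) (UNIV :: nat multiset set)"
    and sL: "Infinite_Set_Sum.abs_summable_on (\<lambda>(k, j). f k ^ Suc j / of_nat (Suc j)) (UNIV :: (nat \<times> nat) set)"
  shows "infsetsum (\<lambda>M. \<Prod>k\<in>#M. f k) UNIV = exp (infsetsum (\<lambda>(k, j). f k ^ Suc j / of_nat (Suc j)) UNIV)"
proof -
  define P where "P = (\<lambda>M. \<Prod>k\<in>#M. f k)"
  define L where "L = (\<lambda>(k, j). f k ^ Suc j / of_nat (Suc j) :: complex)"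
  define A where "A = (\<lambda>m::nat. {M :: nat multiset. set_mset M \<subseteq> {..<m}})"
  define D where "D = (\<lambda>m::nat. {..<m} \<times> (UNIV :: nat set))"
  have sP: "Infinite_Set_Sum.abs_summable_on P S" for S using abs_summable_on_subset[OF sM] by (simp add: P_def)
  have sL': "Infinite_Set_Sum.abs_summable_on L S" for S using abs_summable_on_subset[OF sL] by (simp add: L_def)
  have fin: "infsetsum P (A m) = exp (infsetsum L (D m))" for m
  proof (induction m)
    case 0
    have "A 0 = {{#}}" by (auto simp: A_def)
    then show ?case by (simp add: D_def P_def)
  next
    case (Suc m)
    have sg: "Infinite_Set_Sum.abs_summable_on (\<lambda>j. f m ^ j) UNIV"
      unfolding abs_summable_on_nat_iff' using f1[of m] by (simp add: norm_power summable_geometric)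
    have "infsetsum P (A (Suc m)) = infsetsum (\<lambda>x. P (case x of (M, j) \<Rightarrow> M + replicate_mset j m)) (A m \<times> UNIV)"
      unfolding A_def by (rule infsetsum_reindex_bij_betw[symmetric, OF bij_betw_add_replicate])
    also have "\<dots> = infsetsum (\<lambda>(M, j). P M * f m ^ j) (A m \<times> UNIV)"
      by (intro infsetsum_cong refl) (auto simp: P_def)
    also have "\<dots> = infsetsum P (A m) * infsetsum (\<lambda>j. f m ^ j) UNIV"
      by (intro infsetsum_product sP sg countable_multisets) auto
    also have "infsetsum (\<lambda>j. f m ^ j) UNIV = 1 / (1 - f m)"
      using infsetsum_nat'[OF sg] suminf_geometric[OF f1[of m]] by simp
    also have "1 / (1 - f m) = exp (infsetsum L ({m} \<times> UNIV))"
    proof -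
      have "infsetsum L ({m} \<times> UNIV) = infsetsum (\<lambda>j. L (m, j)) UNIV"
        by (rule infsetsum_reindex_bij_betw[symmetric]) (auto simp: bij_betw_def inj_on_def)
      also have "\<dots> = (\<Sum>j. f m ^ Suc j / of_nat (Suc j))"
        unfolding L_def using exp_neg_Ln_geometric(2)[OF f1[of m]]
        by (subst infsetsum_nat') (simp_all add: abs_summable_on_nat_iff' del: power_Suc of_nat_Suc)
      finally show ?thesis using exp_neg_Ln_geometric(1)[OF f1[of m]] by simp
    qed
    also have "infsetsum P (A m) * exp (infsetsum L ({m} \<times> UNIV)) = exp (infsetsum L (D m) + infsetsum L ({m} \<times> UNIV))"
      by (simp add: Suc exp_add)
    also have "infsetsum L (D m) + infsetsum L ({m} \<times> UNIV) = infsetsum L (D m \<union> {m} \<times> UNIV)"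
      by (rule infsetsum_Un_disjoint[symmetric, OF sL' sL']) (auto simp: D_def)
    also have "D m \<union> {m} \<times> UNIV = D (Suc m)" by (auto simp: D_def less_Suc_eq)
    finally show ?case .
  qed
  have lim: "(\<lambda>m. infsetsum h (S m)) \<longlonglongrightarrow> infsetsum h UNIV"
    if h: "Infinite_Set_Sum.abs_summable_on h UNIV" and S: "\<And>x. \<exists>m0. \<forall>m\<ge>m0. x \<in> S m" for h :: "'x \<Rightarrow> complex" and S :: "nat \<Rightarrow> 'x set"
    unfolding infsetsum_altdef set_lebesgue_integral_def
  proof (rule integral_dominated_convergence[where w="\<lambda>x. cmod (h x)"])
    show "integrable (count_space UNIV) (\<lambda>x. cmod (h x))" using h by (simp add: abs_summable_on_def)
    show "AE x in count_space UNIV. (\<lambda>m. indicator (S m) x *\<^sub>R h x) \<longlonglongrightarrow> indicator UNIV x *\<^sub>R h x"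
    proof (intro AE_I2 tendsto_eventually)
      fix x
      obtain m0 where "\<forall>m\<ge>m0. x \<in> S m" using S by blast
      then show "\<forall>\<^sub>F m in sequentially. indicator (S m) x *\<^sub>R h x = indicator UNIV x *\<^sub>R h x"
        unfolding eventually_sequentially by (intro exI[of _ m0]) auto
    qed
    show "AE x in count_space UNIV. norm (indicator (S m) x *\<^sub>R h x) \<le> cmod (h x)" for m
      by (intro AE_I2) (simp add: indicator_def)
  qed auto
  have limP: "(\<lambda>m. infsetsum P (A m)) \<longlonglongrightarrow> infsetsum P UNIV"
  proof (rule lim[OF sP])
    fix M :: "nat multiset"
    obtain m0 where "set_mset M \<subseteq> {..<m0}" using finite_nat_iff_bounded[of "set_mset M"] by auto
    then show "\<exists>m0. \<forall>m\<ge>m0. M \<in> A m" by (intro exI[of _ m0]) (auto simp: A_def)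
  qed
  have limL: "(\<lambda>m. exp (infsetsum L (D m))) \<longlonglongrightarrow> exp (infsetsum L UNIV)"
  proof (intro tendsto_exp lim[OF sL'])
    fix x :: "nat \<times> nat"
    show "\<exists>m0. \<forall>m\<ge>m0. x \<in> D m" by (intro exI[of _ "Suc (fst x)"]) (auto simp: D_def mem_Times_iff)
  qed
  from LIMSEQ_unique[OF limP limL[folded fin]] show ?thesis by (simp only: P_def L_def)
qed

section \<open>Generalized integers and prime powers of a Beurling system\<close>

lemma complex_of_real_powr: "n > 0 \<Longrightarrow> complex_of_real n powr (- s) = exp (- s * of_real (ln n))"
  by (simp add: powr_def Ln_of_real)

lemma measurable_complex_powr [measurable]: "(\<lambda>x. complex_of_real x powr (- s)) \<in> borel_measurable borel"
  unfolding powr_def by measurable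

locale beurling =
  fixes p :: "nat \<Rightarrow> real"
  assumes primes: "beurling_primes p"
begin

lemma prime_gt_1: "p k > 1"
  using primes monoD[of p 0 k] by (auto simp: beurling_primes_def)

lemma finite_primes: "finite {k. p k \<le> x}"
proof -
  obtain K where "p K > x" using primes by (auto simp: beurling_primes_def bdd_above_def not_le)
  then have "{k. p k \<le> x} \<subseteq> {..<K}"
    using primes monoD[of p K] by (fastforce simp: beurling_primes_def not_le[symmetric])
  then show ?thesis using finite_subset by blast
qed

definition val :: "nat multiset \<Rightarrow> real" where "val M = (\<Prod>k\<in>#M. p k)"

lemma val_simps [simp]: "val {#} = 1" "val (add_mset k M) = p k * val M" "val (M + N) = val M * val N"
  by (simp_all add: val_def)

lemma val_ge_1: "val M \<ge> 1"
proof (induction M)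
  case (add k M)
  then show ?case using prime_gt_1[of k] mult_mono[of 1 "p k" 1 "val M"] by simp
qed simp

lemma prime_le_val: "k \<in># M \<Longrightarrow> p k \<le> val M"
proof -
  assume "k \<in># M"
  then obtain N where "M = add_mset k N" by (blast dest: multi_member_split)
  then show ?thesis using prime_gt_1[of k] val_ge_1[of N] mult_left_mono[of 1 "val N" "p k"] by simp
qed

text \<open>\<open>p 0\<close> is the least prime and exceeds 1, so a bound on the value bounds the
  number of factors; with \<open>finite_primes\<close> this gives \<open>finite_val\<close>.\<close>

lemma power_size_le_val: "p 0 ^ size M \<le> val M"
proof (induction M)
  case (add k M)
  have "p 0 * p 0 ^ size M \<le> p k * val M"
    using primes monoD[of p 0 k] add prime_gt_1[of 0] prime_gt_1[of k] by (intro mult_mono) (auto simp: beurling_primes_def)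
  then show ?case by simp
qed simp

lemma power_eventually_gt: "\<exists>m. \<forall>j. p 0 ^ j \<le> x \<longrightarrow> j < m"
proof -
  obtain m where m: "p 0 ^ m > x" using prime_gt_1[of 0] real_arch_pow by blast
  show ?thesis
  proof (intro exI[of _ m] allI impI)
    fix j assume "p 0 ^ j \<le> x"
    show "j < m"
    proof (rule ccontr)
      assume "\<not> j < m"
      then have "p 0 ^ m \<le> p 0 ^ j" using prime_gt_1[of 0] by (intro power_increasing) auto
      with m \<open>p 0 ^ j \<le> x\<close> show False by linarith
    qed
  qed
qed

lemma finite_val: "finite {M. val M \<le> x}"
proof -
  obtain m where m: "\<And>j. p 0 ^ j \<le> x \<Longrightarrow> j < m" using power_eventually_gt by blast
  have "{M. val M \<le> x} \<subseteq> mset ` {xs. set xs \<subseteq> {k. p k \<le> x} \<and> length xs \<le> m}"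
  proof
    fix M assume "M \<in> {M. val M \<le> x}"
    then have M: "val M \<le> x" by simp
    obtain xs where xs: "mset xs = M" using ex_mset by blast
    have "set xs \<subseteq> {k. p k \<le> x}"
    proof
      fix k assume "k \<in> set xs"
      then have "p k \<le> val M" using xs by (intro prime_le_val) auto
      then show "k \<in> {k. p k \<le> x}" using M by simp
    qed
    moreover have "length xs \<le> m"
      using m[of "size M"] power_size_le_val[of M] M xs by auto
    ultimately show "M \<in> mset ` {xs. set xs \<subseteq> {k. p k \<le> x} \<and> length xs \<le> m}" using xs by blast
  qed
  then show ?thesis by (rule finite_subset) (intro finite_imageI finite_lists_length_le finite_primes)
qed

lemma integer_count_eq: "integer_count p x = (\<Sum>M | val M \<le> x. 1)"
  by (simp add: integer_count_def val_def)

lemma zeta_converges_iff: "beurling_zeta_converges p s \<longleftrightarrow> integrable (count_space UNIV) (\<lambda>M. exp (- s * of_real (ln (val M))))"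
proof -
  have "beurling_zeta_converges p s \<longleftrightarrow> integrable (count_space UNIV) (\<lambda>M. (1::real) *\<^sub>R (complex_of_real (val M) powr (- s)))"
    unfolding beurling_zeta_converges_def
    by (rule set_integral_weighted(1)[OF _ finite_val integer_count_eq]) (auto simp: val_ge_1)
  also have "\<dots> \<longleftrightarrow> integrable (count_space UNIV) (\<lambda>M. exp (- s * of_real (ln (val M))))"
    using less_le_trans[OF zero_less_one val_ge_1] by (intro Bochner_Integration.integrable_cong refl) (simp add: complex_of_real_powr)
  finally show ?thesis .
qed

lemma zeta_eq: "beurling_zeta p s = (LINT M|count_space UNIV. exp (- s * of_real (ln (val M))))"
proof -
  have "beurling_zeta p s = (LINT M|count_space UNIV. (1::real) *\<^sub>R (complex_of_real (val M) powr (- s)))"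
    unfolding beurling_zeta_def
    by (rule set_integral_weighted(2)[OF _ finite_val integer_count_eq]) (auto simp: val_ge_1)
  also have "\<dots> = (LINT M|count_space UNIV. exp (- s * of_real (ln (val M))))"
    using less_le_trans[OF zero_less_one val_ge_1] by (intro Bochner_Integration.integral_cong refl) (simp add: complex_of_real_powr)
  finally show ?thesis .
qed

text \<open>Prime powers indexed by pairs, \<open>j\<close> standing for the exponent
  \<open>j + 1\<close> as in \<open>riemann_prime_count\<close>.\<close>

definition pval :: "nat \<times> nat \<Rightarrow> real" where "pval = (\<lambda>(k, j). p k ^ Suc j)"

definition pwt :: "nat \<times> nat \<Rightarrow> real" where "pwt = (\<lambda>(k, j). 1 / real (Suc j))"

lemma pval_gt_1: "pval x > 1"
  using prime_gt_1[of "fst x"] one_less_power[of "p (fst x)" "Suc (snd x)"] by (simp add: pval_def case_prod_beta del: power_Suc)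

lemma pwt_bounds: "0 \<le> pwt x" "pwt x \<le> 1"
  by (auto simp: pwt_def case_prod_beta)

lemma finite_pval: "finite {x. pval x \<le> y}"
proof -
  obtain m where m: "\<And>j. p 0 ^ j \<le> y \<Longrightarrow> j < m" using power_eventually_gt by blast
  have "{x. pval x \<le> y} \<subseteq> {k. p k \<le> y} \<times> {..<m}"
  proof clarify
    fix k j assume "pval (k, j) \<le> y"
    then have y: "p k ^ Suc j \<le> y" by (simp add: pval_def)
    have "p k ^ 1 \<le> p k ^ Suc j" using prime_gt_1[of k] by (intro power_increasing) auto
    moreover have "p 0 ^ Suc j \<le> p k ^ Suc j"
      using primes monoD[of p 0 k] prime_gt_1[of 0] by (intro power_mono) (auto simp: beurling_primes_def)
    ultimately have "p k \<le> y" "p 0 ^ Suc j \<le> y" using y by simp_all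
    then show "k \<in> {k. p k \<le> y} \<and> j \<in> {..<m}" using m[of "Suc j"] by simp
  qed
  then show ?thesis by (rule finite_subset) (simp add: finite_primes)
qed

text \<open>Prime powers are grouped by exponent; exponents outside the finite set \<open>J\<close>
  contribute empty counts, so the series is a finite sum.\<close>

lemma riemann_prime_count_eq: "riemann_prime_count p y = (\<Sum>x | pval x \<le> y. pwt x)"
proof -
  have root: "p k \<le> root (Suc j) y \<longleftrightarrow> p k ^ Suc j \<le> y" for k j
  proof -
    have "p k = root (Suc j) (p k ^ Suc j)" using prime_gt_1[of k] by (intro real_root_power_cancel[symmetric]) auto
    then show ?thesis by (metis real_root_le_iff zero_less_Suc)
  qed
  define A where "A = {x. pval x \<le> y}"
  define J where "J = snd ` A"
  have fA: "finite A" "finite J" using finite_pval by (auto simp: A_def J_def)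
  have "(\<Sum>x\<in>A. pwt x) = (\<Sum>j\<in>J. \<Sum>x\<in>{x \<in> A. snd x = j}. pwt x)"
    by (rule sum.group[symmetric, OF fA]) (auto simp: J_def)
  also have "\<dots> = (\<Sum>j\<in>J. prime_count p (root (Suc j) y) / real (Suc j))"
  proof (intro sum.cong refl)
    fix j
    have "(\<Sum>x\<in>{x \<in> A. snd x = j}. pwt x) = (\<Sum>x\<in>{x \<in> A. snd x = j}. 1 / real (Suc j))"
      by (intro sum.cong refl) (auto simp: pwt_def)
    also have "\<dots> = real (card {x \<in> A. snd x = j}) / real (Suc j)" by simp
    also have "card {x \<in> A. snd x = j} = card {k. p k \<le> root (Suc j) y}"
    proof (rule bij_betw_same_card)
      show "bij_betw fst {x \<in> A. snd x = j} {k. p k \<le> root (Suc j) y}"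
        by (rule bij_betw_byWitness[where f'="\<lambda>k. (k, j)"]) (auto simp: A_def pval_def root simp del: power_Suc)
    qed
    finally show "(\<Sum>x\<in>{x \<in> A. snd x = j}. pwt x) = prime_count p (root (Suc j) y) / real (Suc j)"
      by (simp add: prime_count_def)
  qed
  also have "\<dots> = riemann_prime_count p y"
    unfolding riemann_prime_count_def
  proof (rule suminf_finite[symmetric, OF fA(2)])
    fix j assume j: "j \<notin> J"
    have "{k. p k \<le> root (Suc j) y} = {}"
    proof (rule ccontr)
      assume "{k. p k \<le> root (Suc j) y} \<noteq> {}"
      then obtain k where "p k ^ Suc j \<le> y" using root by blast
      then have "(k, j) \<in> A" by (simp add: A_def pval_def)
      then show False using j by (force simp: J_def)
    qed
    then show "prime_count p (root (Suc j) y) / real (Suc j) = 0" by (simp add: prime_count_def)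
  qed
  finally show ?thesis by (simp add: A_def)
qed

lemma log_zeta_eq: "log_beurling_zeta p s = (LINT x|count_space UNIV. pwt x *\<^sub>R exp (- s * of_real (ln (pval x))))"
proof -
  have "log_beurling_zeta p s = (LINT x|count_space UNIV. pwt x *\<^sub>R (complex_of_real (pval x) powr (- s)))"
    unfolding log_beurling_zeta_def
    by (rule set_integral_weighted(2)[OF pwt_bounds(1) finite_pval riemann_prime_count_eq]) (auto simp: pval_gt_1)
  also have "\<dots> = (LINT x|count_space UNIV. pwt x *\<^sub>R exp (- s * of_real (ln (pval x))))"
    using less_trans[OF zero_less_one pval_gt_1] by (intro Bochner_Integration.integral_cong refl) (simp add: complex_of_real_powr)
  finally show ?thesis .
qed

definition fac :: "complex \<Rightarrow> nat \<Rightarrow> complex" where "fac s k = exp (- s * of_real (ln (p k)))"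

lemma fac_prod: "(\<Prod>k\<in>#M. fac s k) = exp (- s * of_real (ln (val M)))"
proof (induction M)
  case (add k M)
  have "ln (val (add_mset k M)) = ln (p k) + ln (val M)"
    using prime_gt_1[of k] val_ge_1[of M] by (simp add: ln_mult)
  then show ?case using add by (simp add: fac_def algebra_simps flip: exp_add)
qed simp

lemma fac_power: "fac s k ^ Suc j = exp (- s * of_real (ln (pval (k, j))))"
proof -
  have "ln (p k ^ Suc j) = real (Suc j) * ln (p k)" using prime_gt_1[of k] by (simp only: ln_realpow)
  then have "exp (- s * of_real (ln (pval (k, j)))) = exp (of_nat (Suc j) * (- s * of_real (ln (p k))))"
    by (simp add: pval_def algebra_simps)
  also have "\<dots> = fac s k ^ Suc j" unfolding fac_def by (rule exp_of_nat_mult)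
  finally show ?thesis by simp
qed

lemma norm_fac: "Re s > 0 \<Longrightarrow> cmod (fac s k) < 1"
  using prime_gt_1[of k] by (simp add: fac_def)

text \<open>Prime powers embed into multisets as those with one repeated element, so absolute
  convergence is inherited from the sum over all multisets. Exponents start at 1, which makes the
  embedding injective.\<close>

lemma pval_summable:
  assumes "beurling_zeta_converges p s"
  shows "integrable (count_space UNIV) (\<lambda>x. exp (- s * of_real (ln (pval x))))"
proof -
  define h where "h = (\<lambda>M. exp (- s * of_real (ln (val M))))"
  define g where "g = (\<lambda>(k, j). replicate_mset (Suc j) k :: nat multiset)"
  have inj: "inj g"
  proof (rule injI)
    fix x y assume "g x = g y"
    then have "\<And>k. count (g x) k = count (g y) k" by simp
    from this[of "fst x"] this[of "fst y"] show "x = y"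
      by (cases x; cases y) (auto simp: g_def split: if_splits)
  qed
  have "Infinite_Set_Sum.abs_summable_on h UNIV" using assms by (simp add: zeta_converges_iff h_def abs_summable_on_def)
  then have "Infinite_Set_Sum.abs_summable_on h (range g)" by (rule abs_summable_on_subset) auto
  then have "Infinite_Set_Sum.abs_summable_on (\<lambda>x. h (g x)) UNIV" using abs_summable_on_reindex_iff[OF inj] by blast
  moreover have "val (g x) = pval x" for x
    by (cases x) (simp add: g_def pval_def val_def)
  ultimately show ?thesis by (simp only: h_def abs_summable_on_def)
qed

lemma pval_weighted_summable:
  assumes "beurling_zeta_converges p s"
  shows "integrable (count_space UNIV) (\<lambda>x. pwt x *\<^sub>R exp (- s * of_real (ln (pval x))))"
proof (rule Bochner_Integration.integrable_bound[OF pval_summable[OF assms]])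
  show "AE x in count_space UNIV. norm (pwt x *\<^sub>R exp (- s * of_real (ln (pval x)))) \<le> norm (exp (- s * of_real (ln (pval x))))"
    using pwt_bounds by (intro AE_I2) (auto simp: mult_left_le_one_le)
qed simp

lemma zeta_exp:
  assumes s: "Re s > 0" and conv: "beurling_zeta_converges p s"
  shows "beurling_zeta p s = exp (log_beurling_zeta p s)"
proof -
  have eq: "(\<lambda>(k, j). fac s k ^ Suc j / of_nat (Suc j)) = (\<lambda>x. pwt x *\<^sub>R exp (- s * of_real (ln (pval x))))"
  proof
    fix x :: "nat \<times> nat"
    obtain k j where x: "x = (k, j)" by (cases x)
    show "(case x of (k, j) \<Rightarrow> fac s k ^ Suc j / of_nat (Suc j)) = pwt x *\<^sub>R exp (- s * of_real (ln (pval x)))"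
      unfolding x prod.case fac_power by (simp add: pwt_def scaleR_conv_of_real)
  qed
  have "infsetsum (\<lambda>M. \<Prod>k\<in>#M. fac s k) UNIV = exp (infsetsum (\<lambda>(k, j). fac s k ^ Suc j / of_nat (Suc j)) UNIV)"
  proof (rule euler_product_exp)
    show "cmod (fac s k) < 1" for k by (rule norm_fac[OF s])
    show "Infinite_Set_Sum.abs_summable_on (\<lambda>M. \<Prod>k\<in>#M. fac s k) UNIV"
      using conv by (simp add: fac_prod zeta_converges_iff abs_summable_on_def)
    show "Infinite_Set_Sum.abs_summable_on (\<lambda>(k, j). fac s k ^ Suc j / of_nat (Suc j)) UNIV"
      unfolding eq abs_summable_on_def by (rule pval_weighted_summable[OF conv])
  qed
  then show ?thesis unfolding eq fac_prod zeta_eq log_zeta_eq infsetsum_def .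
qed

section \<open>The normalized integer count and its Laplace transform\<close>

definition B :: "real \<Rightarrow> real" where "B u = exp (- u) * integer_count p (exp u)"

lemma integer_count_mono: "x \<le> y \<Longrightarrow> integer_count p x \<le> integer_count p y"
  unfolding integer_count_eq by (rule sum_mono2[OF finite_val]) auto

lemma B_mono: "u \<le> v \<Longrightarrow> exp u * B u \<le> exp v * B v"
  using integer_count_mono[of "exp u" "exp v"] by (simp add: B_def mult.assoc[symmetric] flip: exp_add)

lemma B_nonneg: "B u \<ge> 0" by (simp add: B_def integer_count_def)

lemma B_neg: "u < 0 \<Longrightarrow> B u = 0"
proof -
  assume "u < 0"
  then have "val M > exp u" for M using val_ge_1[of M] less_le_trans[of "exp u" 1 "val M"] by simp
  then have "{M. val M \<le> exp u} = {}" by (simp add: not_le)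
  then show ?thesis by (simp only: B_def integer_count_eq) simp
qed

lemma B_meas [measurable]: "B \<in> borel_measurable borel"
proof -
  have [measurable]: "integer_count p \<in> borel_measurable borel" by (intro borel_measurable_mono monoI integer_count_mono)
  show ?thesis unfolding B_def[abs_def] by measurable
qed

text \<open>Each multiset \<open>M\<close> contributes the indicator of the half-line from
  \<open>ln (val M)\<close> to the count, and its Laplace integral is
  \<open>exp (- s * ln (val M)) / s\<close>. Absolute convergence of the zeta sum justifies the
  exchange.\<close>

lemma laplace_B:
  assumes \<delta>: "\<delta> > 0" and conv: "\<And>s. Re s > 1 \<Longrightarrow> beurling_zeta_converges p s"
  shows "integrable lborel (\<lambda>u. exp (- (\<delta> * u)) * B u)"
    and "laplace_line B \<delta> t = beurling_zeta p (Complex (1 + \<delta>) t) / Complex (1 + \<delta>) t"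
proof -
  interpret C: sigma_finite_measure "count_space (UNIV :: nat multiset set)"
    by (rule sigma_finite_measure_count_space_countable[OF countable_multisets])
  interpret P: pair_sigma_finite "count_space (UNIV :: nat multiset set)" lborel ..
  have gen: "integrable lborel (\<lambda>u. of_real (integer_count p (exp u)) * exp (- s * of_real u)) \<and>
      (LINT u|lborel. of_real (integer_count p (exp u)) * exp (- s * of_real u)) = beurling_zeta p s / s" if s: "Re s > 1" for s
  proof -
    define h where "h = (\<lambda>M u. indicator {ln (val M)..} u *\<^sub>R exp (- s * complex_of_real u))"
    have s0: "Re s > 0" using s by simp
    have ih: "integrable lborel (h M)" and Ih: "(LINT u|lborel. h M u) = exp (- s * of_real (ln (val M))) / s" for M
      unfolding h_def by (rule exp_integral_atLeast[OF s0])+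
    have nh: "(LINT u|lborel. cmod (h M u)) = cmod (exp (- s * of_real (ln (val M)))) / Re s" for M
    proof -
      have "complex_of_real (LINT u|lborel. cmod (h M u)) = (LINT u|lborel. complex_of_real (cmod (h M u)))"
        by (rule integral_complex_of_real[symmetric])
      also have "\<dots> = (LINT u|lborel. indicator {ln (val M)..} u *\<^sub>R exp (- complex_of_real (Re s) * of_real u))"
        by (intro Bochner_Integration.integral_cong refl) (auto simp: h_def indicator_def exp_of_real[symmetric])
      also have "\<dots> = exp (- complex_of_real (Re s) * of_real (ln (val M))) / of_real (Re s)"
        by (rule exp_integral_atLeast(2)) (use s in simp)
      also have "\<dots> = complex_of_real (cmod (exp (- s * of_real (ln (val M)))) / Re s)"
        by (simp add: exp_of_real[symmetric])
      finally show ?thesis using of_real_eq_iff by blast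
    qed
    have hm: "(\<lambda>(M, u). h M u) \<in> borel_measurable (count_space UNIV \<Otimes>\<^sub>M lborel)"
    proof -
      have m1: "(\<lambda>x::nat multiset \<times> real. exp (- s * complex_of_real (snd x))) \<in> borel_measurable (count_space UNIV \<Otimes>\<^sub>M lborel)"
        by (rule measurable_compose[OF measurable_snd])
           (auto intro!: borel_measurable_continuous_onI continuous_intros simp: measurable_lborel1)
      have m2: "(\<lambda>x::nat multiset \<times> real. ln (val (fst x))) \<in> borel_measurable (count_space UNIV \<Otimes>\<^sub>M lborel)"
        by (rule measurable_compose[OF measurable_fst]) simp
      have "(\<lambda>x. if ln (val (fst x)) \<le> snd x then exp (- s * complex_of_real (snd x)) else 0) \<in> borel_measurable (count_space UNIV \<Otimes>\<^sub>M lborel)"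
        using m1 m2 by measurable
      also have "(\<lambda>x. if ln (val (fst x)) \<le> snd x then exp (- s * complex_of_real (snd x)) else 0) = (\<lambda>(M, u). h M u)"
        by (auto simp: fun_eq_iff h_def indicator_def)
      finally show ?thesis .
    qed
    have I: "integrable (count_space UNIV \<Otimes>\<^sub>M lborel) (\<lambda>(M, u). h M u)"
    proof (rule P.Fubini_integrable[OF hm])
      have "integrable (count_space UNIV) (\<lambda>M. cmod (exp (- s * of_real (ln (val M)))))"
        using conv[OF s] by (intro integrable_norm) (simp add: zeta_converges_iff)
      then show "integrable (count_space UNIV) (\<lambda>M. LINT u|lborel. norm (case (M, u) of (M, u) \<Rightarrow> h M u))"
        by (simp only: prod.case nh) simp
    qed (use ih in auto)
    have inner: "(LINT M|count_space UNIV. h M u) = of_real (integer_count p (exp u)) * exp (- s * of_real u)" for u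
    proof -
      have set: "{M. ln (val M) \<le> u} = {M. val M \<le> exp u}"
      proof (intro Collect_cong)
        fix M show "ln (val M) \<le> u \<longleftrightarrow> val M \<le> exp u"
          using exp_le_cancel_iff[of "ln (val M)" u] exp_ln[of "val M"] val_ge_1[of M] by simp
      qed
      have "(LINT M|count_space UNIV. h M u) = (LINT M|count_space UNIV. indicator {M. val M \<le> exp u} M *\<^sub>R exp (- s * of_real u))"
        unfolding set[symmetric] by (intro Bochner_Integration.integral_cong refl) (simp add: h_def indicator_def)
      also have "\<dots> = infsetsum (\<lambda>_. exp (- s * of_real u)) {M. val M \<le> exp u}"
        by (simp add: infsetsum_altdef set_lebesgue_integral_def)
      also have "\<dots> = of_real (integer_count p (exp u)) * exp (- s * of_real u)"
        using finite_val[of "exp u"] by (simp add: integer_count_eq)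
      finally show ?thesis .
    qed
    have "integrable lborel (\<lambda>u. LINT M|count_space UNIV. h M u)" using P.integrable_snd[OF I] by simp
    moreover have "(LINT u|lborel. LINT M|count_space UNIV. h M u) = (LINT M|count_space UNIV. LINT u|lborel. h M u)"
      by (rule P.Fubini_integral[OF I])
    ultimately show ?thesis unfolding inner Ih by (simp add: zeta_eq)
  qed
  have e: "of_real (integer_count p (exp u)) * exp (- Complex (1 + \<delta>) t * of_real u) = of_real (exp (- (\<delta> * u)) * B u) * cis (- (t * u))" for u t
  proof -
    have "exp (- Complex (1 + \<delta>) t * of_real u) = of_real (exp (- (\<delta> * u)) * exp (- u)) * cis (- (t * u))"
      by (simp add: cis_conv_exp exp_of_real[symmetric] Complex_eq algebra_simps flip: exp_add)
    then show ?thesis by (simp add: B_def mult_ac)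
  qed
  have s: "Re (Complex (1 + \<delta>) t) > 1" for t using \<delta> by simp
  have "integrable lborel (\<lambda>u. complex_of_real (exp (- (\<delta> * u)) * B u))"
    using gen[OF s[of 0]] unfolding e by simp
  then show "integrable lborel (\<lambda>u. exp (- (\<delta> * u)) * B u)" by (simp only: complex_of_real_integrable_eq)
  show "laplace_line B \<delta> t = beurling_zeta p (Complex (1 + \<delta>) t) / Complex (1 + \<delta>) t"
    using gen[OF s[of t]] unfolding e laplace_line_def by simp
qed

end

section \<open>Asymptotic density\<close>

text \<open>Finitely many points are separated, so at any \<open>t\<close> at most one factor is
  large: away from \<open>b\<close> its factor is bounded, near \<open>b\<close> all the others are.
  A product of singularities is thus controlled by their sum, whose integrability is
  immediate.\<close>

lemma prod_powr_le_sum: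
  fixes \<gamma> :: "real \<Rightarrow> real"
  assumes "finite A" "\<And>\<tau>. \<tau> \<in> A \<Longrightarrow> \<gamma> \<tau> \<le> 0"
  shows "\<exists>C\<ge>0. \<forall>t. t \<notin> A \<longrightarrow> (\<Prod>\<tau>\<in>A. \<bar>t - \<tau>\<bar> powr \<gamma> \<tau>) \<le> C * (1 + (\<Sum>\<tau>\<in>A. \<bar>t - \<tau>\<bar> powr \<gamma> \<tau>))"
  using assms
proof (induction A rule: finite_induct)
  case empty
  then show ?case by (intro exI[of _ 1]) simp
next
  case (insert b A)
  then obtain C where C: "C \<ge> 0" "\<And>t. t \<notin> A \<Longrightarrow> (\<Prod>\<tau>\<in>A. \<bar>t - \<tau>\<bar> powr \<gamma> \<tau>) \<le> C * (1 + (\<Sum>\<tau>\<in>A. \<bar>t - \<tau>\<bar> powr \<gamma> \<tau>))" by auto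
  obtain d0 where d0: "d0 > 0" "\<And>\<tau>. \<tau> \<in> A \<Longrightarrow> \<tau> \<noteq> b \<Longrightarrow> d0 \<le> dist b \<tau>" using finite_set_avoid[OF insert.hyps(1), of b] by auto
  \<comment> \<open>Within \<open>d\<close> of \<open>b\<close> the distance to every other point of
    \<open>A\<close> is at least \<open>d\<close>.\<close>
  define d where "d = d0 / 2"
  have d: "d > 0" using d0 by (simp add: d_def)
  define c2 where "c2 = (\<Prod>\<tau>\<in>A. d powr \<gamma> \<tau>)"
  have c2: "c2 \<ge> 0" by (simp add: c2_def prod_nonneg)
  show ?case
  proof (intro exI[of _ "C * (d powr \<gamma> b) + c2"] conjI allI impI)
    show "C * (d powr \<gamma> b) + c2 \<ge> 0" using C c2 by simp
    fix t assume t: "t \<notin> insert b A"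
    define y where "y = \<bar>t - b\<bar> powr \<gamma> b"
    define S where "S = (\<Sum>\<tau>\<in>A. \<bar>t - \<tau>\<bar> powr \<gamma> \<tau>)"
    define P where "P = (\<Prod>\<tau>\<in>A. \<bar>t - \<tau>\<bar> powr \<gamma> \<tau>)"
    have nn: "y \<ge> 0" "S \<ge> 0" "P \<ge> 0" by (auto simp: y_def S_def P_def sum_nonneg prod_nonneg)
    have PC: "P \<le> C * (1 + S)" using C(2)[of t] t by (simp add: P_def S_def)
    have "P * y \<le> (C * (d powr \<gamma> b) + c2) * (1 + (y + S))"
    proof (cases "\<bar>t - b\<bar> \<ge> d")
      case True
      then have "y \<le> d powr \<gamma> b" unfolding y_def using d insert.prems by (intro powr_mono2') auto
      then have "P * y \<le> (C * (1 + S)) * (d powr \<gamma> b)" using PC nn C by (intro mult_mono) auto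
      also have "\<dots> = (C * (d powr \<gamma> b)) * (1 + S)" by simp
      also have "\<dots> \<le> (C * (d powr \<gamma> b) + c2) * (1 + (y + S))" using nn c2 C by (intro mult_mono) auto
      finally show ?thesis .
    next
      case False
      have "P \<le> c2" unfolding P_def c2_def
      proof (intro prod_mono conjI powr_mono2')
        fix \<tau> assume \<tau>: "\<tau> \<in> A"
        then have "2 * d \<le> \<bar>b - \<tau>\<bar>" using d0(2)[of \<tau>] insert.hyps(2) by (auto simp: d_def dist_real_def)
        then show "d \<le> \<bar>t - \<tau>\<bar>" using False by linarith
        show "\<gamma> \<tau> \<le> 0" using insert.prems \<tau> by auto
      qed (use d in auto)
      then have "P * y \<le> c2 * y" using nn by (intro mult_right_mono)
      also have "\<dots> \<le> (C * (d powr \<gamma> b) + c2) * (1 + (y + S))" using nn c2 C by (intro mult_mono) auto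
      finally show ?thesis .
    qed
    then show "(\<Prod>\<tau>\<in>insert b A. \<bar>t - \<tau>\<bar> powr \<gamma> \<tau>) \<le> (C * (d powr \<gamma> b) + c2) * (1 + (\<Sum>\<tau>\<in>insert b A. \<bar>t - \<tau>\<bar> powr \<gamma> \<tau>))"
      using insert.hyps by (simp add: P_def S_def y_def mult.commute)
  qed
qed

lemma prod_powr_dominated:
  fixes \<gamma> :: "real \<Rightarrow> real" and R :: real
  assumes fin: "finite A" and \<gamma>: "\<And>\<tau>. \<tau> \<in> A \<Longrightarrow> \<gamma> \<tau> \<le> 0" "\<And>\<tau>. \<tau> \<in> A \<Longrightarrow> \<gamma> \<tau> > -1" and R: "R \<ge> 0"
  shows "\<exists>h. integrable lborel h \<and> (\<forall>t. h t \<ge> 0) \<and> (\<forall>t. \<bar>t\<bar> \<le> R \<and> t \<notin> A \<longrightarrow> (\<Prod>\<tau>\<in>A. \<bar>t - \<tau>\<bar> powr \<gamma> \<tau>) \<le> h t)"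
proof -
  obtain C where C: "C \<ge> 0" "\<And>t. t \<notin> A \<Longrightarrow> (\<Prod>\<tau>\<in>A. \<bar>t - \<tau>\<bar> powr \<gamma> \<tau>) \<le> C * (1 + (\<Sum>\<tau>\<in>A. \<bar>t - \<tau>\<bar> powr \<gamma> \<tau>))"
    using prod_powr_le_sum[OF fin, of \<gamma>] \<gamma>(1) by auto
  \<comment> \<open>The window is centred at the singularity and wide enough to contain
    \<open>t - \<tau>\<close> whenever \<open>\<bar>t\<bar> \<le> R\<close>.\<close>
  define k where "k = (\<lambda>\<tau> t. indicator {-(R + \<bar>\<tau>\<bar>)..R + \<bar>\<tau>\<bar>} (t - \<tau>) * \<bar>t - \<tau>\<bar> powr \<gamma> \<tau>)"
  define h where "h = (\<lambda>t. C * (indicator {-R..R} t + (\<Sum>\<tau>\<in>A. k \<tau> t)))"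
  have ik: "integrable lborel (k \<tau>)" if "\<tau> \<in> A" for \<tau>
    unfolding k_def using lborel_integrable_real_affine[OF integrable_abs_powr[of "\<gamma> \<tau>" "R + \<bar>\<tau>\<bar>"], of 1 "-\<tau>"] \<gamma>(2)[OF that] R by simp
  have k0: "k \<tau> t \<ge> 0" for \<tau> t by (simp add: k_def)
  show ?thesis
  proof (intro exI[of _ h] conjI allI impI)
    show "integrable lborel h" unfolding h_def
      by (intro integrable_mult_right Bochner_Integration.integrable_add Bochner_Integration.integrable_sum ik integrable_real_indicator)
         (auto simp: emeasure_lborel_Icc_eq)
    show "h t \<ge> 0" for t unfolding h_def using C k0 by (intro mult_nonneg_nonneg add_nonneg_nonneg sum_nonneg) auto
    fix t assume t: "\<bar>t\<bar> \<le> R \<and> t \<notin> A"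
    have "k \<tau> t = \<bar>t - \<tau>\<bar> powr \<gamma> \<tau>" for \<tau>
    proof -
      have "t - \<tau> \<in> {-(R + \<bar>\<tau>\<bar>)..R + \<bar>\<tau>\<bar>}" using t by auto
      then show ?thesis by (simp only: k_def indicator_simps mult_1)
    qed
    moreover have "t \<in> {-R..R}" using t by auto
    ultimately show "(\<Prod>\<tau>\<in>A. \<bar>t - \<tau>\<bar> powr \<gamma> \<tau>) \<le> h t" using C(2)[of t] t by (simp add: h_def)
  qed
qed

text \<open>\<open>B\<close> is real, so reflection in \<open>t\<close> is conjugation. Hypothesis
  (b) speaks of positive \<open>t\<close> only, and this carries its consequences to negative
  ones.\<close>

lemma cmod_laplace_line_minus: "cmod (laplace_line B \<delta> (- t)) = cmod (laplace_line B \<delta> t)"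
proof -
  have "laplace_line B \<delta> (- t) = (LINT u|lborel. cnj (of_real (exp (- (\<delta> * u)) * B u) * cis (- (t * u))))"
    unfolding laplace_line_def by (intro Bochner_Integration.integral_cong refl) (simp add: cis_cnj)
  also have "\<dots> = cnj (laplace_line B \<delta> t)" unfolding laplace_line_def by (rule Bochner_Integration.integral_cnj)
  finally show ?thesis by simp
qed

text \<open>A nonnegative exponent gives a bounded factor, a negative one is largest at
  \<open>\<delta> = 0\<close>; writing \<open>min b 0\<close> gives both cases one form, uniform in
  \<open>\<delta>\<close>.\<close>

lemma powr_distance_le:
  assumes d: "0 < \<delta>" "\<delta> < 1" and t: "t \<noteq> \<tau>" "\<bar>t - \<tau>\<bar> \<le> Q"
  shows "cmod (Complex \<delta> (t - \<tau>)) powr b \<le> max 1 ((1 + Q) powr b) * \<bar>t - \<tau>\<bar> powr (min b 0)"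
proof (cases "b \<ge> 0")
  case True
  have "cmod (Complex \<delta> (t - \<tau>)) \<le> 1 + Q" using cmod_le[of "Complex \<delta> (t - \<tau>)"] d t by simp
  then have "cmod (Complex \<delta> (t - \<tau>)) powr b \<le> (1 + Q) powr b" using True by (intro powr_mono2) auto
  then show ?thesis using True t by simp
next
  case False
  have "cmod (Complex \<delta> (t - \<tau>)) powr b \<le> \<bar>t - \<tau>\<bar> powr b"
    using abs_Im_le_cmod[of "Complex \<delta> (t - \<tau>)"] t False by (intro powr_mono2') auto
  also have "\<dots> = 1 * \<bar>t - \<tau>\<bar> powr b" by simp
  also have "\<dots> \<le> max 1 ((1 + Q) powr b) * \<bar>t - \<tau>\<bar> powr b" by (intro mult_right_mono) auto
  finally show ?thesis using False by (simp add: min_def)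
qed

theorem theorem4p1:
  fixes p :: "nat \<Rightarrow> real" and \<eta> :: real and S :: "real set" and \<beta> :: "real \<Rightarrow> real"
  assumes primes: "beurling_primes p"
    and zeta_conv: "\<And>s. Re s > 1 \<Longrightarrow> beurling_zeta_converges p s"
    and eta_pos: "0 < \<eta>"
    and points_gt: "\<And>\<tau>. \<tau> \<in> S \<Longrightarrow> \<eta> < \<tau>"
    and points_discrete: "\<And>x. \<not> x islimpt S"
    and beta_gt: "\<And>\<tau>. \<tau> \<in> S \<Longrightarrow> \<beta> \<tau> > -1"
    and log_zeta_boundary:
      "A_loc_boundary_behavior (\<lambda>s. log_beurling_zeta p s - Ln (1 / (s - 1))) {-\<eta><..<\<eta>}"
    and zeta_bound:
      "\<And>T. T > 0 \<Longrightarrow> \<exists>K>0. \<forall>t \<sigma>. \<eta> / 2 < t \<and> t < T \<and> 1 < \<sigma> \<and> \<sigma> < 2 \<longrightarrow>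
         ln (cmod (beurling_zeta p (Complex \<sigma> t)))
           \<le> K + (\<Sum>\<tau>\<in>{\<tau>\<in>S. 0 < \<tau> \<and> \<tau> < T}. \<beta> \<tau> * ln (cmod (Complex (\<sigma> - 1) (t - \<tau>))))"
  shows "\<exists>a>0. integer_count p \<sim>[at_top] (\<lambda>x. a * x)"
proof -
  interpret beurling p by unfold_locales (rule primes)
  define G where "G = (\<lambda>s. log_beurling_zeta p s - Ln (1 / (s - 1)))"
  obtain g where gA: "g \<in> A_loc {-\<eta><..<\<eta>}" and G_an: "G analytic_on {s. Re s > 1}"
    and conv: "\<And>\<phi>. \<phi> \<in> test_functions {-\<eta><..<\<eta>} \<Longrightarrow>
        ((\<lambda>\<sigma>. LINT t|lborel. G (Complex \<sigma> t) * \<phi> t) \<longlongrightarrow> (LINT t|lborel. g t * \<phi> t)) (at_right 1)"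
    using log_zeta_boundary unfolding A_loc_boundary_behavior_def G_def by blast
  obtain \<rho> \<psi> where moll: "mollifier \<rho> \<psi>" using mollifier_exists by blast
  \<comment> \<open>Prime powers with weights \<open>pwt\<close>, located at their logarithms: the
    Laplace transform of this measure is \<open>log_beurling_zeta\<close>.\<close>
  define M where "M = density (count_space UNIV) (\<lambda>x. ennreal (pwt x))"
  define u where "u = (\<lambda>x. ln (pval x))"
  interpret mollifier \<rho> \<psi> by (rule moll)
  interpret C: sigma_finite_measure "count_space (UNIV :: (nat \<times> nat) set)" by (rule sigma_finite_measure_count_space)
  interpret LM: sigma_finite_measure M
    unfolding M_def by (subst C.sigma_finite_iff_density_finite) auto
  interpret LB: laplace_boundary \<rho> \<psi> M u G g \<eta>
  proof
    show "u \<in> borel_measurable M" by (simp add: M_def)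
    show "u x \<ge> 0" for x using pval_gt_1[of x] by (simp add: u_def)
    show "integrable M (\<lambda>x. exp (- \<sigma> * u x))" if "\<sigma> > 1" for \<sigma>
    proof -
      have "integrable (count_space UNIV) (\<lambda>x. norm (pwt x *\<^sub>R exp (- complex_of_real \<sigma> * of_real (ln (pval x)))))"
        by (intro integrable_norm pval_weighted_summable zeta_conv) (use that in simp)
      then have "integrable (count_space UNIV) (\<lambda>x. pwt x *\<^sub>R exp (- \<sigma> * u x))"
        using pwt_bounds by (simp add: u_def abs_of_nonneg)
      then show ?thesis unfolding M_def using pwt_bounds by (subst integrable_density) auto
    qed
    show "G s = (LINT x|M. exp (- s * of_real (u x))) - Ln (1 / (s - 1))" if "Re s > 1" for s
      unfolding G_def log_zeta_eq M_def u_def using pwt_bounds by (subst integral_density) auto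
    show "G holomorphic_on {s. Re s > 1}" using G_an by (rule analytic_imp_holomorphic)
    show "continuous_on {-\<eta><..<\<eta>} g" using gA by (simp add: A_loc_def)
  qed (use eta_pos conv in auto)
  have g_cont: "continuous_on {-\<eta><..<\<eta>} g" using gA by (simp add: A_loc_def)
  \<comment> \<open>Exponentiating \<open>G\<close> removes the branch of the logarithm and gives
    \<open>(s - 1) * \<zeta> s\<close>; the division by \<open>s\<close> is the one built into
    \<open>laplace_line B\<close>.\<close>
  have LE: "Complex \<delta> t * laplace_line B \<delta> t = exp (G (Complex (1 + \<delta>) t)) / Complex (1 + \<delta>) t" if "\<delta> > 0" for \<delta> t :: real
  proof -
    define s where "s = Complex (1 + \<delta>) t"
    have s: "Re s > 1" "s - 1 = Complex \<delta> t" "s - 1 \<noteq> 0" using that by (auto simp: s_def complex_eq_iff)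
    have "beurling_zeta p s = exp (G s + Ln (1 / (s - 1)))" using zeta_exp[of s] zeta_conv[of s] s by (simp add: G_def)
    also have "\<dots> = exp (G s) / (s - 1)" using s by (simp add: exp_add)
    finally have "(s - 1) * beurling_zeta p s = exp (G s)" using s by simp
    then show ?thesis using laplace_B(2)[OF that zeta_conv, of t] s by (simp add: s_def)
  qed
  \<comment> \<open>Close to the line the bound comes from uniform convergence to \<open>g\<close>,
    which is bounded on \<open>[-r, r]\<close>; farther away it comes from compactness.\<close>
  have bound: "\<exists>C\<ge>0. \<forall>\<delta> t. 0 < \<delta> \<and> \<delta> \<le> 1 \<and> \<bar>t\<bar> \<le> r \<longrightarrow> cmod (Complex \<delta> t * laplace_line B \<delta> t) \<le> C" if r: "0 < r" "r < \<eta>" for r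
  proof -
    obtain d where d: "d > 0" "\<And>\<sigma> t. 1 < \<sigma> \<Longrightarrow> \<sigma> < 1 + d \<Longrightarrow> \<bar>t\<bar> \<le> r \<Longrightarrow> cmod (G (Complex \<sigma> t) - g t) \<le> 1"
      using LB.boundary_uniform[OF r, of 1] by auto
    have "compact (g ` {-r..r})" by (intro compact_continuous_image continuous_on_subset[OF g_cont]) (use r in auto)
    then obtain b1 where b1: "\<And>t. t \<in> {-r..r} \<Longrightarrow> cmod (g t) \<le> b1" by (metis bounded_iff compact_imp_bounded imageI)
    define Q where "Q = cbox (Complex (1 + d) (- r)) (Complex 2 r)"
    have "Q \<subseteq> {s. Re s > 1}" using d by (auto simp: Q_def in_cbox_complex_iff)
    then have "continuous_on Q G"
      by (rule holomorphic_on_imp_continuous_on[OF holomorphic_on_subset[OF analytic_imp_holomorphic[OF G_an]]])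
    then have "compact (G ` Q)" by (intro compact_continuous_image) (auto simp: Q_def compact_cbox)
    then obtain b2 where b2: "\<And>z. z \<in> Q \<Longrightarrow> cmod (G z) \<le> b2" by (metis bounded_iff compact_imp_bounded imageI)
    define b where "b = max (b1 + 1) b2"
    have Gb: "cmod (G (Complex (1 + \<delta>) t)) \<le> b" if "0 < \<delta>" "\<delta> \<le> 1" "\<bar>t\<bar> \<le> r" for \<delta> t :: real
    proof (cases "\<delta> < d")
      case True
      have "cmod (G (Complex (1 + \<delta>) t) - g t) \<le> 1" using that True by (intro d) auto
      moreover have "cmod (g t) \<le> b1" using that by (intro b1) auto
      ultimately have "cmod (G (Complex (1 + \<delta>) t)) \<le> b1 + 1" using norm_triangle_ineq2[of "G (Complex (1 + \<delta>) t)" "g t"] by linarith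
      then show ?thesis by (simp add: b_def)
    next
      case False
      then have "Complex (1 + \<delta>) t \<in> Q" using that by (auto simp: Q_def in_cbox_complex_iff)
      then show ?thesis using b2 by (force simp: b_def)
    qed
    show ?thesis
    proof (intro exI[of _ "exp b"] conjI allI impI)
      fix \<delta> t :: real assume a: "0 < \<delta> \<and> \<delta> \<le> 1 \<and> \<bar>t\<bar> \<le> r"
      have "cmod (exp (G (Complex (1 + \<delta>) t))) \<le> exp b"
        using Gb[of \<delta> t] a complex_Re_le_cmod[of "G (Complex (1 + \<delta>) t)"] by simp
      moreover have "cmod (Complex (1 + \<delta>) t) \<ge> 1" using abs_Re_le_cmod[of "Complex (1 + \<delta>) t"] a by simp
      ultimately have "cmod (exp (G (Complex (1 + \<delta>) t))) / cmod (Complex (1 + \<delta>) t) \<le> exp b / 1" by (intro frac_le) auto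
      then show "cmod (Complex \<delta> t * laplace_line B \<delta> t) \<le> exp b" using LE[of \<delta> t] a by (simp add: norm_divide)
    qed simp
  qed
  obtain V f where V: "open V" "0 \<in> V" "V \<subseteq> {-\<eta><..<\<eta>}" and f: "integrable lborel f"
    and gf: "\<And>t. t \<in> V \<Longrightarrow> g t = fourier_transform f t"
  proof -
    have "\<forall>t\<^sub>0\<in>{-\<eta><..<\<eta>}. \<exists>V f. open V \<and> t\<^sub>0 \<in> V \<and> V \<subseteq> {-\<eta><..<\<eta>} \<and> integrable lborel f \<and> (\<forall>t\<in>V. g t = fourier_transform f t)"
      by (rule conjunct2[OF CollectD[OF gA[unfolded A_loc_def]]])
    moreover have "0 \<in> {-\<eta><..<\<eta>}" using eta_pos by simp
    ultimately show ?thesis using that by blast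
  qed
  obtain e0 where e0: "e0 > 0" "cball 0 e0 \<subseteq> V" using V open_contains_cball by blast
  \<comment> \<open>Small enough for \<open>g\<close> to be the transform of \<open>f\<close> on
    \<open>[-e, e]\<close>, and below \<open>\<eta>\<close> so that the boundary convergence covers
    that interval.\<close>
  define e where "e = min e0 (\<eta> / 2)"
  have e: "e > 0" "e < \<eta>" using e0 eta_pos by (auto simp: e_def)
  have eV: "t \<in> V" if "\<bar>t\<bar> \<le> e" for t using that e0(2) by (auto simp: e_def dist_norm)
  obtain C1 where C1: "C1 \<ge> 0" "\<And>\<delta> t. 0 < \<delta> \<Longrightarrow> \<delta> \<le> 1 \<Longrightarrow> \<bar>t\<bar> \<le> e \<Longrightarrow> cmod (Complex \<delta> t * laplace_line B \<delta> t) \<le> C1"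
    using bound[OF e] by blast
  note Bint = laplace_B(1)[OF _ zeta_conv]
  \<comment> \<open>At \<open>t = 0\<close> the bound on
    \<open>Complex \<delta> t * laplace_line B \<delta> t\<close> is the Abel-mean bound that the
    Fejer lemmas ask for.\<close>
  have BC: "\<delta> * (LINT v|lborel. exp (- (\<delta> * v)) * B v) \<le> C1" if "0 < \<delta>" "\<delta> \<le> 1" for \<delta> :: real
  proof -
    have "laplace_line B \<delta> 0 = of_real (LINT v|lborel. exp (- (\<delta> * v)) * B v)"
      unfolding laplace_line_def by (simp only: mult_zero_left minus_zero cis_zero mult_1_right integral_complex_of_real)
    moreover have "Complex \<delta> 0 = of_real \<delta>" by (simp add: complex_eq_iff)
    ultimately have "Complex \<delta> 0 * laplace_line B \<delta> 0 = of_real (\<delta> * (LINT v|lborel. exp (- (\<delta> * v)) * B v))"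
      by (simp only: of_real_mult)
    then show ?thesis using C1(2)[OF that, of 0] e by (simp only: norm_of_real abs_zero) auto
  qed
  have lim: "(\<lambda>n. Complex (approach_seq n) t * laplace_line B (approach_seq n) t) \<longlonglongrightarrow> exp (fourier_transform f t) / Complex 1 t"
    if t: "\<bar>t\<bar> \<le> e" for t
  proof -
    have "(\<lambda>n. G (Complex (1 + approach_seq n) t)) \<longlonglongrightarrow> g t"
    proof (rule LIMSEQ_I)
      fix \<kappa> :: real assume k: "\<kappa> > 0"
      obtain d where d: "d > 0" "\<And>\<sigma> t. 1 < \<sigma> \<Longrightarrow> \<sigma> < 1 + d \<Longrightarrow> \<bar>t\<bar> \<le> e \<Longrightarrow> cmod (G (Complex \<sigma> t) - g t) \<le> \<kappa> / 2"
        using LB.boundary_uniform[OF e, of "\<kappa> / 2"] k by auto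
      have "\<forall>\<^sub>F n in sequentially. approach_seq n < d" using approach_seq(3) d(1) by (intro order_tendstoD(2)) auto
      then obtain N where N: "\<And>n. n \<ge> N \<Longrightarrow> approach_seq n < d" by (auto simp: eventually_sequentially)
      show "\<exists>no. \<forall>n\<ge>no. norm (G (Complex (1 + approach_seq n) t) - g t) < \<kappa>"
      proof (intro exI[of _ N] allI impI)
        fix n assume "n \<ge> N"
        then have "cmod (G (Complex (1 + approach_seq n) t) - g t) \<le> \<kappa> / 2"
          using N[of n] approach_seq(1)[of n] t by (intro d) auto
        then show "norm (G (Complex (1 + approach_seq n) t) - g t) < \<kappa>" using k by linarith
      qed
    qed
    moreover have "(\<lambda>n. Complex (1 + approach_seq n) t) \<longlonglongrightarrow> Complex (1 + 0) t"
      by (intro tendsto_Complex tendsto_add tendsto_const approach_seq)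
    moreover have "Complex (1 + 0) t \<noteq> 0" by (simp add: complex_eq_iff)
    ultimately have "(\<lambda>n. exp (G (Complex (1 + approach_seq n) t)) / Complex (1 + approach_seq n) t) \<longlonglongrightarrow> exp (g t) / Complex (1 + 0) t"
      by (intro tendsto_divide tendsto_exp)
    then show ?thesis using LE[OF approach_seq(1)] gf[OF eV[OF t]] by simp
  qed
  have dom: "\<exists>h. integrable lborel h \<and> (\<forall>\<delta>. 0 < \<delta> \<longrightarrow> \<delta> < 1 \<longrightarrow> (AE t in lborel. \<bar>t\<bar> \<le> T \<longrightarrow> \<bar>t\<bar> * cmod (laplace_line B \<delta> t) \<le> h t))"
    if T: "T > 0" for T
  proof -
    \<comment> \<open>Any value strictly between \<open>\<eta> / 2\<close> and \<open>\<eta>\<close>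
      works: (a) handles \<open>\<bar>t\<bar> \<le> r\<close>, and (b) together with reflection
      handles the rest.\<close>
    define r where "r = 3 * \<eta> / 4"
    have r: "0 < r" "r < \<eta>" "\<eta> / 2 < r" using eta_pos by (auto simp: r_def)
    obtain C where C: "C \<ge> 0" "\<And>\<delta> t. 0 < \<delta> \<Longrightarrow> \<delta> \<le> 1 \<Longrightarrow> \<bar>t\<bar> \<le> r \<Longrightarrow> cmod (Complex \<delta> t * laplace_line B \<delta> t) \<le> C"
      using bound[OF r(1,2)] by blast
    \<comment> \<open>The cutoff is \<open>T + 1\<close> because (b) requires \<open>t\<close>
      strictly below the cutoff, while \<open>t = T\<close> has to be included.\<close>
    define A where "A = {\<tau>\<in>S. 0 < \<tau> \<and> \<tau> < T + 1}"
    have finA: "finite A"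
    proof (rule ccontr)
      assume inf: "infinite A"
      have "A \<subseteq> {0..T + 1}" by (auto simp: A_def)
      then obtain x where "x islimpt A"
        using Heine_Borel_imp_Bolzano_Weierstrass[OF compact_Icc inf] by blast
      then have "x islimpt S" by (rule islimpt_subset) (auto simp: A_def)
      then show False using points_discrete by blast
    qed
    obtain K where K: "\<And>t \<sigma>. \<eta> / 2 < t \<Longrightarrow> t < T + 1 \<Longrightarrow> 1 < \<sigma> \<Longrightarrow> \<sigma> < 2 \<Longrightarrow>
         ln (cmod (beurling_zeta p (Complex \<sigma> t))) \<le> K + (\<Sum>\<tau>\<in>A. \<beta> \<tau> * ln (cmod (Complex (\<sigma> - 1) (t - \<tau>))))"
      using zeta_bound[of "T + 1"] T unfolding A_def by fastforce
    \<comment> \<open>A crude bound for \<open>\<bar>t - \<tau>\<bar>\<close> with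
      \<open>0 < t \<le> T\<close> and \<open>0 < \<tau> < T + 1\<close>.\<close>
    define Q where "Q = 2 * T + 1"
    define D where "D = (\<lambda>\<tau>. max 1 ((1 + Q) powr \<beta> \<tau>))"
    obtain h1 where h1: "integrable lborel h1" "\<And>t. h1 t \<ge> 0"
      "\<And>t. \<bar>t\<bar> \<le> T \<Longrightarrow> t \<notin> A \<Longrightarrow> (\<Prod>\<tau>\<in>A. \<bar>t - \<tau>\<bar> powr (min (\<beta> \<tau>) 0)) \<le> h1 t"
      using prod_powr_dominated[OF finA, of "\<lambda>\<tau>. min (\<beta> \<tau>) 0" T] beta_gt T by (auto simp: A_def)
    define c where "c = exp K * (\<Prod>\<tau>\<in>A. D \<tau>)"
    have c0: "c \<ge> 0" unfolding c_def D_def by (intro mult_nonneg_nonneg prod_nonneg) auto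
    have pos: "cmod (laplace_line B \<delta> t) \<le> c * h1 t" if d: "0 < \<delta>" "\<delta> < 1" and t: "r < t" "t \<le> T" "t \<notin> A" for \<delta> t :: real
    proof -
      define s where "s = Complex (1 + \<delta>) t"
      have "cmod (beurling_zeta p s) \<le> exp K * (\<Prod>\<tau>\<in>A. cmod (Complex \<delta> (t - \<tau>)) powr \<beta> \<tau>)"
      \<comment> \<open>\<open>ln 0\<close> is 0, so exponentiating the logarithmic bound recovers
        the modulus only at a nonzero value.\<close>
      proof (cases "beurling_zeta p s = 0")
        case False
        have "ln (cmod (beurling_zeta p s)) \<le> K + (\<Sum>\<tau>\<in>A. \<beta> \<tau> * ln (cmod (Complex \<delta> (t - \<tau>))))"
          using K[of t "1 + \<delta>"] d t r by (simp add: s_def)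
        then have "exp (ln (cmod (beurling_zeta p s))) \<le> exp (K + (\<Sum>\<tau>\<in>A. \<beta> \<tau> * ln (cmod (Complex \<delta> (t - \<tau>)))))" by simp
        also have "\<dots> = exp K * (\<Prod>\<tau>\<in>A. exp (\<beta> \<tau> * ln (cmod (Complex \<delta> (t - \<tau>)))))"
          by (simp add: exp_add exp_sum[OF finA])
        also have "(\<Prod>\<tau>\<in>A. exp (\<beta> \<tau> * ln (cmod (Complex \<delta> (t - \<tau>))))) = (\<Prod>\<tau>\<in>A. cmod (Complex \<delta> (t - \<tau>)) powr \<beta> \<tau>)"
        proof (intro prod.cong refl)
          fix \<tau>
          have "Complex \<delta> (t - \<tau>) \<noteq> 0" using d by (simp add: complex_eq_iff)
          then show "exp (\<beta> \<tau> * ln (cmod (Complex \<delta> (t - \<tau>)))) = cmod (Complex \<delta> (t - \<tau>)) powr \<beta> \<tau>" by (simp add: powr_def)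
        qed
        finally show ?thesis using False by simp
      qed (auto intro!: mult_nonneg_nonneg prod_nonneg)
      also have "\<dots> \<le> exp K * (\<Prod>\<tau>\<in>A. D \<tau> * \<bar>t - \<tau>\<bar> powr (min (\<beta> \<tau>) 0))"
      proof (intro mult_left_mono prod_mono conjI)
        fix \<tau> assume "\<tau> \<in> A"
        then have "t \<noteq> \<tau>" "\<bar>t - \<tau>\<bar> \<le> Q" using t r by (auto simp: A_def Q_def abs_le_iff)
        then show "cmod (Complex \<delta> (t - \<tau>)) powr \<beta> \<tau> \<le> D \<tau> * \<bar>t - \<tau>\<bar> powr (min (\<beta> \<tau>) 0)"
          unfolding D_def using d by (intro powr_distance_le) auto
      qed auto
      also have "\<dots> = c * (\<Prod>\<tau>\<in>A. \<bar>t - \<tau>\<bar> powr (min (\<beta> \<tau>) 0))" by (simp add: c_def prod.distrib)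
      also have "\<dots> \<le> c * h1 t" using h1(3)[of t] t r c0 by (intro mult_left_mono) auto
      finally have z: "cmod (beurling_zeta p s) \<le> c * h1 t" .
      have "cmod s \<ge> 1" using abs_Re_le_cmod[of s] d by (simp add: s_def)
      then have "cmod (beurling_zeta p s) / cmod s \<le> cmod (beurling_zeta p s) / 1" by (intro divide_left_mono) auto
      then show ?thesis using z laplace_B(2)[OF d(1) zeta_conv, of t] by (simp add: s_def norm_divide)
    qed
    \<comment> \<open>For \<open>\<bar>t\<bar> \<le> r\<close> the factor
      \<open>\<bar>t\<bar>\<close> is absorbed into the modulus of
      \<open>Complex \<delta> t\<close>, beyond that it is bounded by \<open>T\<close>; the
      reflected \<open>h1\<close> accounts for negative \<open>t\<close>.\<close>
    define h where "h = (\<lambda>t. indicator {-T..T} t * C + (T * c) * (h1 t + h1 (- t)))"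
    have ih: "integrable lborel h" unfolding h_def
      using lborel_integrable_real_affine[OF h1(1), of "-1" 0] h1(1)
      by (intro Bochner_Integration.integrable_add integrable_mult_right integrable_mult_left integrable_real_indicator)
         (auto simp: emeasure_lborel_Icc_eq)
    show ?thesis
    proof (intro exI[of _ h] conjI ih allI impI)
      fix \<delta> :: real assume d: "0 < \<delta>" "\<delta> < 1"
      have "AE t in lborel. t \<notin> A \<union> uminus ` A"
        using finA by (intro AE_not_in finite_imp_null_set_lborel) auto
      then show "AE t in lborel. \<bar>t\<bar> \<le> T \<longrightarrow> \<bar>t\<bar> * cmod (laplace_line B \<delta> t) \<le> h t"
      proof (eventually_elim, intro impI)
        fix t assume nA: "t \<notin> A \<union> uminus ` A" and tT: "\<bar>t\<bar> \<le> T"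
        have tI: "t \<in> {-T..T}" using tT by auto
        have hn: "0 \<le> (T * c) * (h1 t + h1 (- t))" using T c0 h1(2) by (intro mult_nonneg_nonneg add_nonneg_nonneg) auto
        show "\<bar>t\<bar> * cmod (laplace_line B \<delta> t) \<le> h t"
        proof (cases "\<bar>t\<bar> \<le> r")
          case True
          have "\<bar>t\<bar> * cmod (laplace_line B \<delta> t) \<le> cmod (Complex \<delta> t) * cmod (laplace_line B \<delta> t)"
            using abs_Im_le_cmod[of "Complex \<delta> t"] by (intro mult_right_mono) auto
          also have "\<dots> \<le> C" using C(2)[of \<delta> t] d True by (simp add: norm_mult)
          finally show ?thesis using hn tI by (simp add: h_def)
        next
          case False
          have "cmod (laplace_line B \<delta> t) \<le> c * (h1 t + h1 (- t))"
          proof (cases "t > 0")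
            case True
            then have "cmod (laplace_line B \<delta> t) \<le> c * h1 t" using False tT nA d by (intro pos) auto
            also have "\<dots> \<le> c * (h1 t + h1 (- t))" using h1(2) c0 by (intro mult_left_mono) auto
            finally show ?thesis .
          next
            case neg: False
            have nA': "- t \<notin> A" using nA by (metis UnCI image_eqI minus_minus)
            have "cmod (laplace_line B \<delta> t) = cmod (laplace_line B \<delta> (- t))" by (simp add: cmod_laplace_line_minus)
            also have "\<dots> \<le> c * h1 (- t)" using neg False tT nA' d by (intro pos) auto
            also have "\<dots> \<le> c * (h1 t + h1 (- t))" using h1(2) c0 by (intro mult_left_mono) auto
            finally show ?thesis .
          qed
          then have "\<bar>t\<bar> * cmod (laplace_line B \<delta> t) \<le> T * (c * (h1 t + h1 (- t)))" using tT by (intro mult_mono) auto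
          then show ?thesis using tI C(1) by (simp add: h_def mult.assoc)
        qed
      qed
    qed
  qed
  define I where "I = (\<lambda>L y. LINT v|lborel. B v * fejer L (v - y))"
  have near: "((\<lambda>y. complex_of_real (I e y)) \<longlongrightarrow> of_real fejer_mass * exp (LINT x|lborel. f x)) at_top"
    unfolding I_def
    by (rule fejer_conv_near_zero[OF B_meas B_nonneg B_neg Bint BC e(1) f _ lim, where C'=C1]) (use C1 in auto)
  define z where "z = exp (LINT x|lborel. f x)"
  \<comment> \<open>The limit is real because the convolutions are, nonnegative because
    \<open>B\<close> and the kernel are, and nonzero because it is a positive multiple of a value of
    \<open>exp\<close>. Hence the density is positive.\<close>
  have IR: "(I e \<longlongrightarrow> fejer_mass * Re z) at_top" using tendsto_Re[OF near] by (simp add: z_def)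
  have "((\<lambda>y::real. 0) \<longlongrightarrow> fejer_mass * Im z) at_top" using tendsto_Im[OF near] by (simp add: z_def)
  then have "fejer_mass * Im z = 0" by (intro tendsto_unique[OF _ _ tendsto_const]) auto
  then have "Im z = 0" using fejer_mass_pos by simp
  moreover have "z \<noteq> 0" by (simp add: z_def)
  ultimately have "Re z \<noteq> 0" by (simp add: complex_eq_iff)
  moreover have "0 \<le> fejer_mass * Re z"
    by (rule tendsto_lowerbound[OF IR])
       (auto simp: I_def intro!: always_eventually Bochner_Integration.integral_nonneg mult_nonneg_nonneg B_nonneg fejer_nonneg e)
  ultimately have a: "Re z > 0" using fejer_mass_pos by (simp add: zero_le_mult_iff)
  have "(B \<longlongrightarrow> Re z) at_top"
  proof (rule tauberian_fejer[OF B_nonneg B_neg B_mono])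
    fix L y :: real assume L: "L > 0"
    show "integrable lborel (\<lambda>v. B v * fejer L (v - y))"
      by (rule integrable_fejer_conv[OF B_meas B_nonneg B_neg Bint BC L])
  next
    fix L :: real assume L: "L > 0"
    obtain h where h: "integrable lborel h" "\<And>\<delta>. 0 < \<delta> \<Longrightarrow> \<delta> < 1 \<Longrightarrow> AE t in lborel. \<bar>t\<bar> \<le> max L e \<longrightarrow> \<bar>t\<bar> * cmod (laplace_line B \<delta> t) \<le> h t"
      using dom[OF less_max_iff_disj[THEN iffD2, OF disjI1, OF L]] by blast
    have "((\<lambda>y. I L y - I e y) \<longlongrightarrow> 0) at_top"
      unfolding I_def by (rule fejer_conv_diff_tendsto[OF B_meas B_nonneg B_neg Bint BC L e(1) h])
    from tendsto_add[OF this IR] show "((\<lambda>y. LINT v|lborel. B v * fejer L (v - y)) \<longlongrightarrow> fejer_mass * Re z) at_top"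
      by (simp add: I_def)
  qed
  then have "((\<lambda>x. B (ln x)) \<longlongrightarrow> Re z) at_top" by (rule filterlim_compose[OF _ ln_at_top])
  then have "((\<lambda>x. B (ln x) / Re z) \<longlongrightarrow> Re z / Re z) at_top" using a by (intro tendsto_intros) auto
  moreover have "\<forall>\<^sub>F x in at_top. B (ln x) / Re z = integer_count p x / (Re z * x)"
    using eventually_gt_at_top[of 0]
  proof eventually_elim
    case (elim x)
    have "exp (- ln x) = 1 / x" using elim by (simp add: exp_minus inverse_eq_divide)
    then show ?case using elim by (simp add: B_def)
  qed
  ultimately have "((\<lambda>x. integer_count p x / (Re z * x)) \<longlongrightarrow> Re z / Re z) at_top" by (rule Lim_transform_eventually)
  then have "((\<lambda>x. integer_count p x / (Re z * x)) \<longlongrightarrow> 1) at_top" using a by simp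
  then have "integer_count p \<sim>[at_top] (\<lambda>x. Re z * x)" by (rule asymp_equivI')
  then show ?thesis using a by blast
qed

end
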